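(* Let $r,s\ge1$ be integers and $n=r+s$. The number of realizations of quivers in $\mathcal{Q}_{n-1}$ with parameters $r_1+2r_2=r$ and $s_1+2s_2=s$ is $$\frac12\sum_{k|r,\,k|s}\frac{\phi(k)}{r+s}\binom{2r/k}{r/k}\binom{2s/k}{s/k}.$$ Moreover, for integers $r_2,s_2\ge0$ with $r=r_1+2r_2$, $s=s_1+2s_2$ ($r_1,s_1\ge0$), the number of realizations of quivers in $\mathcal{Q}_{n-1}$ with parameters $(r_1,r_2,s_1,s_2)$ is $$\sum_{k|r,\,k|r_2,\,k|s,\,k|s_2}\frac{\phi(k)}k(-1)^{(r+r_2+s+s_2)/k}\sum_{\substack{i,j\geq0\\(i,j)\neq(0,0)}}\frac{(-1)^{i+j}}{2(i+j)}\binom{2i}{i,\,2i-r/k,\,r_2/k,\,(r-r_2)/k-i}\binom{2j}{j,\,2j-s/k,\,s_2/k,\,(s-s_2)/k-j}.$$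
   Context: $\phi$ is Euler's totient function ($\phi(k)=\#\{1\le d\le k:\gcd(d,k)=1\}$); $k$ runs over positive integers. Multinomial coefficients $\binom{m}{a_1,\dots,a_t}$ with $\sum a_i=m$ equal $m!/(a_1!\cdots a_t!)$ if all $a_i\ge0$ and $0$ otherwise. All quivers are finite, connected, without loops and without oriented 2-cycles, considered up to isomorphism. A rooted quiver of type $A$ is a quiver with a distinguished vertex (the root), defined recursively as one of: (i) a single vertex, the root; (ii) a root $\rho$, a rooted quiver of type $A$ with root $v\ne\rho$, and one arrow between $\rho$ and $v$ (either direction); (iii) a root $\rho$, an oriented 3-cycle $\rho\to u\to w\to\rho$, and two vertex-disjoint rooted quivers of type $A$ with roots $u$ and $w$. For $n\ge2$, $\mathcal{Q}_{n-1}$ is the class of quivers with $n$ vertices such that: (1) there is exactly one full subquiver which is a non-oriented cycle (underlying graph a cycle, arrows not all oriented the same way) of length $\ge2$ (length 2 = double arrow); its arrows are base arrows; (2) for each base arrow $\alpha:x\to y$ there may be a vertex $z_\alpha$ off the cycle with arrows $y\to z_\alpha\to x$ (an oriented 3-cycle; for a double arrow only one of its arrows is regarded as part of such a 3-cycle), and no other arrows are incident to cycle vertices; (3) removing the cycle vertices leaves a disjoint union of rooted quivers of type $A$, one with root $z_\alpha$ for each existing $z_\alpha$, attached to $\alpha$. (These are exactly the quivers mutation equivalent to a non-oriented $n$-cycle, i.e. of type $\tilde A_{n-1}$.) A realization of $Q\in\mathcal{Q}_{n-1}$ is $Q$ with an embedding of its non-oriented cycle in the plane (a choice of clockwise direction),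 realizations being identified if a quiver isomorphism maps one to the other preserving the clockwise direction. For a realization: $r_1$ = number of arrows in no oriented 3-cycle which are anti-clockwise base arrows or lie in a rooted quiver attached to an anti-clockwise base arrow; $r_2$ = number of oriented 3-cycles containing an anti-clockwise base arrow or lying in a rooted quiver attached to an anti-clockwise base arrow; $s_1,s_2$ likewise with "clockwise". Then $r_1+2r_2+s_1+2s_2=n$. *)

theory Defs
  imports
    "HOL-Analysis.Infinite_Sum"
    "HOL-Number_Theory.Totient"
    "Graph_Theory.Digraph_Isomorphism"
begin

text \<open>
  Quivers are the directed multigraphs of the Graph\_Theory library; \<open>G \<restriction> V\<close> is the full subquiver
  on \<open>V\<close>. \<open>connected\<close> must be qualified, since the topological notion has the same name.
\<close>

definition is_quiver :: "('a, 'b) pre_digraph \<Rightarrow> bool" where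
  "is_quiver G \<longleftrightarrow> fin_digraph G \<and> loopfree_digraph G \<and> Digraph_Component.connected G \<and>
     \<not> (\<exists>a\<in>arcs G. \<exists>b\<in>arcs G. tail G a = head G b \<and> head G a = tail G b)"

inductive rooted_type_A :: "('a, 'b) pre_digraph \<Rightarrow> 'a \<Rightarrow> bool" where
  single: "verts G = {\<rho>} \<Longrightarrow> arcs G = {} \<Longrightarrow> rooted_type_A G \<rho>"
| arrow: "\<lbrakk> verts G = insert \<rho> V; \<rho> \<notin> V;
     arcs G = insert a (arcs (G \<restriction> V));
     (tail G a = \<rho> \<and> head G a = v) \<or> (tail G a = v \<and> head G a = \<rho>);
     rooted_type_A (G \<restriction> V) v \<rbrakk> \<Longrightarrow> rooted_type_A G \<rho>"
| triangle: "\<lbrakk> verts G = insert \<rho> (U \<union> W); \<rho> \<notin> U \<union> W; U \<inter> W = {};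
     arcs G = {a, b, c} \<union> arcs (G \<restriction> U) \<union> arcs (G \<restriction> W);
     tail G a = \<rho>; head G a = u; tail G b = u; head G b = w; tail G c = w; head G c = \<rho>;
     rooted_type_A (G \<restriction> U) u; rooted_type_A (G \<restriction> W) w \<rbrakk> \<Longrightarrow> rooted_type_A G \<rho>"

text \<open>
  One turn around a quiver whose underlying graph is a cycle, as the list of steps
  \<open>(v\<^sub>0, e\<^sub>0), (v\<^sub>1, e\<^sub>1), \<dots>\<close>, where \<open>e\<^sub>i\<close> joins \<open>v\<^sub>i\<close> to \<open>v\<^sub>i\<^sub>+\<^sub>1\<close>, in either direction.
  For length 2 this is a pair of arrows between two vertices.
\<close>

definition cycle_turn :: "('a, 'b) pre_digraph \<Rightarrow> ('a \<times> 'b) list \<Rightarrow> bool" where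
  "cycle_turn H p \<longleftrightarrow> length p \<ge> 2 \<and>
     distinct (map fst p) \<and> set (map fst p) = verts H \<and>
     distinct (map snd p) \<and> set (map snd p) = arcs H \<and>
     (\<forall>i<length p. let v = fst (p ! i); e = snd (p ! i); w = fst (p ! (Suc i mod length p)) in
        (tail H e = v \<and> head H e = w) \<or> (tail H e = w \<and> head H e = v))"

text \<open>
  A step \<open>(v, e)\<close> with \<open>tail H e = v\<close> runs along its arrow, one with \<open>head H e = v\<close> against it.
  A double arrow is a non-oriented cycle: a turn runs along one arrow and against the other.
\<close>

definition nonoriented_cycle :: "('a, 'b) pre_digraph \<Rightarrow> bool" where
  "nonoriented_cycle H \<longleftrightarrow> (\<exists>p. cycle_turn H p \<and>
     (\<exists>(v, e)\<in>set p. tail H e = v) \<and> (\<exists>(v, e)\<in>set p. head H e = v))"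

definition base_verts :: "('a, 'b) pre_digraph \<Rightarrow> 'a set" where
  "base_verts G = (THE B. B \<subseteq> verts G \<and> nonoriented_cycle (G \<restriction> B))"

definition base_arcs :: "('a, 'b) pre_digraph \<Rightarrow> 'b set" where
  "base_arcs G = arcs (G \<restriction> base_verts G)"

text \<open>
  The vertices of the connected component of \<open>z\<close> after removal of the cycle vertices
  (\<open>mk_symmetric\<close> is the underlying undirected graph).
\<close>

definition attached_verts :: "('a, 'b) pre_digraph \<Rightarrow> 'a \<Rightarrow> 'a set" where
  "attached_verts G z =
     {v. reachable (with_proj (mk_symmetric (G \<restriction> (verts G - base_verts G)))) z v}"

text \<open>
  \<open>z\<close> sends a base arrow \<open>\<alpha>\<close> to the vertex \<open>z\<^sub>\<alpha>\<close>, if there is one. It is determined by the quiver,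
  except that for a double arrow it also records which of the two arrows is regarded as part of an
  oriented 3-cycle through the cycle.
\<close>

definition attachment :: "('a, 'b) pre_digraph \<Rightarrow> ('b \<Rightarrow> 'a option) \<Rightarrow> bool" where
  "attachment G z \<longleftrightarrow>
     dom z \<subseteq> base_arcs G \<and> ran z \<subseteq> verts G - base_verts G \<and>
     (\<forall>\<alpha> v. z \<alpha> = Some v \<longrightarrow>
        (\<exists>!e. e \<in> arcs G \<and> tail G e = head G \<alpha> \<and> head G e = v) \<and>
        (\<exists>!e. e \<in> arcs G \<and> tail G e = v \<and> head G e = tail G \<alpha>)) \<and>
     (\<forall>e\<in>arcs G. tail G e \<in> base_verts G \<or> head G e \<in> base_verts G \<longrightarrow>
        e \<in> base_arcs G \<or>
        (\<exists>\<alpha> v. z \<alpha> = Some v \<and>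
           ((tail G e = head G \<alpha> \<and> head G e = v) \<or> (tail G e = v \<and> head G e = tail G \<alpha>)))) \<and>
     verts G - base_verts G = (\<Union>v\<in>ran z. attached_verts G v) \<and>
     (\<forall>\<alpha> \<beta> v w. z \<alpha> = Some v \<longrightarrow> z \<beta> = Some w \<longrightarrow> \<alpha> \<noteq> \<beta> \<longrightarrow>
        attached_verts G v \<inter> attached_verts G w = {}) \<and>
     (\<forall>v\<in>ran z. rooted_type_A (G \<restriction> attached_verts G v) v)"

text \<open>The class written \<open>Q\<^sub>n\<^sub>-\<^sub>1\<close> in the literature; the parameter \<open>n\<close> here is the number of vertices.\<close>

definition affine_A_class :: "nat \<Rightarrow> ('a, 'b) pre_digraph set" where
  "affine_A_class n = {G. is_quiver G \<and> card (verts G) = n \<and>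
     (\<exists>!B. B \<subseteq> verts G \<and> nonoriented_cycle (G \<restriction> B)) \<and> (\<exists>z. attachment G z)}"

text \<open>
  The clockwise direction is recorded as the set of steps of a turn around the non-oriented cycle,
  so that the starting point of the turn is forgotten.
\<close>

record ('a, 'b) realization =
  quiver :: "('a, 'b) pre_digraph"
  apex :: "'b \<Rightarrow> 'a option"
  clockwise :: "('a \<times> 'b) set"

definition realizations :: "nat \<Rightarrow> ('a, 'b) realization set" where
  "realizations n = {R. quiver R \<in> affine_A_class n \<and> attachment (quiver R) (apex R) \<and>
     (\<exists>p. cycle_turn (quiver R \<restriction> base_verts (quiver R)) p \<and> clockwise R = set p)}"

definition realization_iso ::
    "('a, 'b) realization \<Rightarrow> ('c, 'd) realization \<Rightarrow> bool" where
  "realization_iso R R' \<longleftrightarrow> (\<exists>h. pre_digraph.digraph_isomorphism (quiver R) h \<and>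
     quiver R' = app_iso h (quiver R) \<and>
     (\<forall>\<alpha>\<in>arcs (quiver R). apex R' (iso_arcs h \<alpha>) = map_option (iso_verts h) (apex R \<alpha>)) \<and>
     clockwise R' = map_prod (iso_verts h) (iso_arcs h) ` clockwise R)"

definition num_up_to_iso :: "('a, 'b) realization set \<Rightarrow> nat" where
  "num_up_to_iso S = card (S // {(R, R'). R \<in> S \<and> R' \<in> S \<and> realization_iso R R'})"

definition clockwise_arcs :: "('a, 'b) realization \<Rightarrow> 'b set" where
  "clockwise_arcs R = {\<alpha>\<in>base_arcs (quiver R). (tail (quiver R) \<alpha>, \<alpha>) \<in> clockwise R}"

definition anticlockwise_arcs :: "('a, 'b) realization \<Rightarrow> 'b set" where
  "anticlockwise_arcs R = {\<alpha>\<in>base_arcs (quiver R). (head (quiver R) \<alpha>, \<alpha>) \<in> clockwise R}"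

text \<open>
  The oriented 3-cycles, as sets of arrows. The condition on base arrows matters only for a double
  arrow: there, the arrow not regarded as part of the 3-cycle through \<open>z\<^sub>\<alpha>\<close> is excluded.
\<close>

definition three_cycles :: "('a, 'b) realization \<Rightarrow> 'b set set" where
  "three_cycles R = (let G = quiver R in
     {{a, b, c} | a b c. {a, b, c} \<subseteq> arcs G \<and>
        head G a = tail G b \<and> head G b = tail G c \<and> head G c = tail G a \<and>
        (\<forall>\<alpha>\<in>{a, b, c} \<inter> base_arcs G. \<exists>e\<in>{a, b, c}. apex R \<alpha> = Some (tail G e))})"

definition attached_arcs :: "('a, 'b) realization \<Rightarrow> 'b \<Rightarrow> 'b set" where
  "attached_arcs R \<alpha> = (case apex R \<alpha> of None \<Rightarrow> {}
     | Some v \<Rightarrow> arcs (quiver R \<restriction> attached_verts (quiver R) v))"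

definition num_arcs :: "('a, 'b) realization \<Rightarrow> 'b set \<Rightarrow> nat" where
  "num_arcs R D = card {a\<in>arcs (quiver R). a \<notin> \<Union> (three_cycles R) \<and>
     (a \<in> D \<or> (\<exists>\<alpha>\<in>D. a \<in> attached_arcs R \<alpha>))}"

definition num_three_cycles :: "('a, 'b) realization \<Rightarrow> 'b set \<Rightarrow> nat" where
  "num_three_cycles R D = card {C\<in>three_cycles R.
     (\<exists>\<alpha>\<in>D. \<alpha> \<in> C) \<or> (\<exists>\<alpha>\<in>D. C \<subseteq> attached_arcs R \<alpha>)}"

definition par_r1 :: "('a, 'b) realization \<Rightarrow> nat" where
  "par_r1 R = num_arcs R (anticlockwise_arcs R)"

definition par_r2 :: "('a, 'b) realization \<Rightarrow> nat" where
  "par_r2 R = num_three_cycles R (anticlockwise_arcs R)"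

definition par_s1 :: "('a, 'b) realization \<Rightarrow> nat" where
  "par_s1 R = num_arcs R (clockwise_arcs R)"

definition par_s2 :: "('a, 'b) realization \<Rightarrow> nat" where
  "par_s2 R = num_three_cycles R (clockwise_arcs R)"

text \<open>
  Multinomial coefficients with integer lower entries, zero if some entry is negative.
  Only meaningful if the entries sum to \<open>m\<close>.
\<close>

definition multinomial :: "nat \<Rightarrow> int list \<Rightarrow> real" where
  "multinomial m as = (if \<forall>a\<in>set as. a \<ge> 0
     then fact m / (\<Prod>a\<leftarrow>as. fact (nat a)) else 0)"

end

theory Submission
  imports Defs "HOL-Computational_Algebra.Formal_Power_Series"
    "HOL-Computational_Algebra.Polynomial"
begin

text \<open>
  Reading a realization once clockwise around its non-oriented cycle gives a word whose letters record
  the direction of a base arrow and the rooted quiver attached to it, if any. The word is determined up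
  to rotation and determines the realization up to isomorphism, so the realizations are necklaces over
  these letters; a full subquiver all of whose vertices meet two of its arrows contains an oriented
  3-cycle or the base, which is why every word gives a quiver with only one non-oriented cycle.

  Counting necklaces by their rotational symmetry turns the number into
  \<open>\<Sum>\<^sub>k \<phi>(k)/k N(\<dots>/k)\<close>, where \<open>N\<close> is the sum of \<open>1/|v|\<close> over the words \<open>v\<close> with the given parameters. The
  generating function \<open>F\<close> of the letters of one direction satisfies \<open>F - F\<^sup>2 = x + (\<tau> - 1) x\<^sup>2\<close>, where \<open>\<tau>\<close>
  marks the 3-cycles, so \<open>F\<close> is the Catalan series \<open>c = x + c\<^sup>2\<close> composed with \<open>x + (\<tau> - 1) x\<^sup>2\<close>. This
  reduces the second formula to the first, that is, to \<open>\<tau> = 1\<close>, where the coefficients of the powers of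
  \<open>c\<close> are ballot numbers and \<open>N\<close> is a telescoping sum.
\<close>

section \<open>Rooted quivers of type A\<close>

text \<open>The weight 1/|v| makes the count depend on very little: the words with given clockwise
  and anti-clockwise letters are the shuffles of two lists, so only the lengths a and b of these
  lists enter, through the kernel C(a+b, a)/(a+b).

  The kernel does not factor, but the count is bilinear in the numbers of lists of length a and of
  length b. Substituting x + (\<tau> - 1) x^2 into c^a is a linear change of coefficients that is
  the same for every a. Hence the kernel sum has to be evaluated at \<tau> = 1 only, and prescribing
  the number of 3-cycles merely applies this change to the result in each of the two directions.

  On the side of quivers, the obstacle is that the base is singled out by unique existence, the
  attached quivers by reachability and their shape by nested restrictions. All of this is replaced
  by one description with explicit vertex and arrow sets, the locale \<open>decomposed\<close>; the
  original conditions are derived from it, and every realization is shown to fit it.\<close>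

text \<open>The flag of \<open>Arr\<close> tells whether the arrow leaves the root.\<close>

datatype rtree = Leaf | Arr bool rtree | Tri rtree rtree

text \<open>Only arrows outside all oriented 3-cycles count, hence nothing for the three arrows of
  \<open>Tri\<close>.\<close>

primrec narr :: "rtree \<Rightarrow> nat" where
  "narr Leaf = 0"
| "narr (Arr d t) = Suc (narr t)"
| "narr (Tri t u) = narr t + narr u"

primrec ntri :: "rtree \<Rightarrow> nat" where
  "ntri Leaf = 0"
| "ntri (Arr d t) = ntri t"
| "ntri (Tri t u) = Suc (ntri t + ntri u)"

text \<open>The tail and head maps stay fixed while the vertex and arrow sets vary, which avoids
  nested restrictions. The derivation is recorded as a tree, so that sizes can be computed by
  recursion.\<close>

inductive rooted_code ::
    "('b \<Rightarrow> 'a) \<Rightarrow> ('b \<Rightarrow> 'a) \<Rightarrow> 'a set \<Rightarrow> 'b set \<Rightarrow> 'a \<Rightarrow> rtree \<Rightarrow> bool" for T H where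
  Leaf: "rooted_code T H {\<rho>} {} \<rho> Leaf"
| Arr: "\<lbrakk>rooted_code T H V E v t; \<rho> \<notin> V;
    T a = (if d then \<rho> else v); H a = (if d then v else \<rho>)\<rbrakk> \<Longrightarrow>
    rooted_code T H (insert \<rho> V) (insert a E) \<rho> (Arr d t)"
| Tri: "\<lbrakk>rooted_code T H U E u t; rooted_code T H W F w t'; \<rho> \<notin> U \<union> W; U \<inter> W = {};
    T a = \<rho>; H a = u; T b = u; H b = w; T c = w; H c = \<rho>\<rbrakk> \<Longrightarrow>
    rooted_code T H (insert \<rho> (U \<union> W)) ({a, b, c} \<union> E \<union> F) \<rho> (Tri t t')"

lemma rooted_code_root: "rooted_code T H V E \<rho> t \<Longrightarrow> \<rho> \<in> V"
  by (induction rule: rooted_code.induct) auto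

lemma rooted_code_ends:
  assumes "rooted_code T H V E \<rho> t"
  shows "e \<in> E \<Longrightarrow> T e \<in> V" "e \<in> E \<Longrightarrow> H e \<in> V"
  using assms by (induction arbitrary: e and e rule: rooted_code.induct) (auto dest: rooted_code_root split: if_splits)

lemma rooted_code_finite:
  assumes "rooted_code T H V E \<rho> t"
  shows "finite V" "finite E"
  using assms by (induction rule: rooted_code.induct) auto

lemma rooted_code_card: "rooted_code T H V E \<rho> t \<Longrightarrow> card V = narr t + 2 * ntri t + 1"
proof (induction rule: rooted_code.induct)
  case (Tri U E u t W F w t' \<rho> a b c)
  then show ?case by (auto simp: card_insert_if card_Un_disjoint rooted_code_finite)
qed (auto simp: card_insert_if rooted_code_finite)

lemma rooted_code_no_loop:
  "rooted_code T H V E \<rho> t \<Longrightarrow> e \<in> E \<Longrightarrow> T e \<noteq> H e"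
proof (induction arbitrary: e rule: rooted_code.induct)
  case (Tri U E u t W F w t' \<rho> a b c)
  then show ?case using rooted_code_root[OF Tri.hyps(1)] rooted_code_root[OF Tri.hyps(2)] by auto
qed (auto dest: rooted_code_root split: if_splits)

lemma rooted_code_no_2cycle:
  "rooted_code T H V E \<rho> t \<Longrightarrow> e \<in> E \<Longrightarrow> f \<in> E \<Longrightarrow> T e = H f \<Longrightarrow> H e \<noteq> T f"
proof (induction arbitrary: e f rule: rooted_code.induct)
  case (Leaf \<rho>)
  then show ?case by simp
next
  case (Arr V E v t \<rho> a d)
  note ends = rooted_code_ends[OF Arr.hyps(1)]
  from Arr show ?case by (auto dest: ends rooted_code_root split: if_splits)
next
  case (Tri U E u t W F w t' \<rho> a b c)
  note ends = rooted_code_ends[OF Tri.hyps(1)] rooted_code_ends[OF Tri.hyps(2)]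
    and root = rooted_code_root[OF Tri.hyps(1)] rooted_code_root[OF Tri.hyps(2)]
  from Tri.prems Tri.IH Tri.hyps(3-) root ends show ?case
    by (elim UnE insertE emptyE; simp) (fastforce+)
qed

text \<open>Connectedness phrased without paths: \<open>S\<close> is any set that no arrow of
  \<open>E\<close> enters or leaves, and the computations of components below reduce to a choice of
  \<open>S\<close>.\<close>

lemma rooted_code_connected:
  "rooted_code T H V E \<rho> t \<Longrightarrow> \<rho> \<in> S \<Longrightarrow> (\<And>e. e \<in> E \<Longrightarrow> T e \<in> S \<longleftrightarrow> H e \<in> S) \<Longrightarrow> V \<subseteq> S"
proof (induction rule: rooted_code.induct)
  case (Arr V E v t \<rho> a d)
  then have "v \<in> S" by (metis insertI1)
  with Arr show ?case by auto
next
  case (Tri U E u t W F w t' \<rho> a b c)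
  then have "u \<in> S" "w \<in> S" by (metis UnI1 insertI1 insertI2)+
  with Tri show ?case by auto
qed simp

section \<open>Subquivers of a rooted quiver with minimal degree two\<close>

text \<open>Degree at least two at \<open>x\<close> inside the full subquiver on \<open>S\<close>.
  Arrows are counted rather than neighbours, so that both vertices of a double arrow
  qualify.\<close>

definition two_arcs :: "('b \<Rightarrow> 'a) \<Rightarrow> ('b \<Rightarrow> 'a) \<Rightarrow> 'b set \<Rightarrow> 'a set \<Rightarrow> 'a \<Rightarrow> bool" where
  "two_arcs T H E S x \<longleftrightarrow> (\<exists>e\<in>E. \<exists>f\<in>E. e \<noteq> f \<and> T e \<in> S \<and> H e \<in> S \<and> T f \<in> S \<and> H f \<in> S \<and>
     (T e = x \<or> H e = x) \<and> (T f = x \<or> H f = x))"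

definition triangles :: "('b \<Rightarrow> 'a) \<Rightarrow> ('b \<Rightarrow> 'a) \<Rightarrow> 'b set \<Rightarrow> 'b set set" where
  "triangles T H E =
     {{a, b, c} | a b c. {a, b, c} \<subseteq> E \<and> H a = T b \<and> H b = T c \<and> H c = T a}"

lemma trianglesI:
  "\<lbrakk>a \<in> E; b \<in> E; c \<in> E; H a = T b; H b = T c; H c = T a\<rbrakk> \<Longrightarrow> {a, b, c} \<in> triangles T H E"
  unfolding triangles_def by blast

lemma triangles_mono: "E \<subseteq> F \<Longrightarrow> triangles T H E \<subseteq> triangles T H F"
  unfolding triangles_def by blast

text \<open>Descent along the code. The root is exempt because arrows outside \<open>E\<close> may
  meet it in a larger quiver. If \<open>S\<close> meets a smaller rooted quiver in at most its root,
  that root has no arrows in \<open>S\<close> besides those added in the last step: one added arrow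
  is too few, and two arrows of the added triangle bring all three of its vertices into
  \<open>S\<close>.\<close>

lemma rooted_code_two_arcs:
  assumes "rooted_code T H V E \<rho> t" "\<And>x. x \<in> S \<inter> V \<Longrightarrow> x \<noteq> \<rho> \<Longrightarrow> two_arcs T H E S x"
    "\<not> S \<inter> V \<subseteq> {\<rho>}"
  shows "\<exists>C\<in>triangles T H E. T ` C \<subseteq> S"
  using assms
proof (induction rule: rooted_code.induct)
  case (Leaf \<rho>)
  then show ?case by auto
next
  case (Arr V E v t \<rho> a d)
  note ends = rooted_code_ends[OF Arr.hyps(1)]
  have sub: "two_arcs T H E S x" if "x \<in> S \<inter> V" "x \<noteq> v" for x
  proof -
    have "x \<noteq> \<rho>" using that Arr.hyps by auto
    then have "two_arcs T H (insert a E) S x" using Arr.prems(1)[of x] that by auto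
    with \<open>x \<noteq> \<rho>\<close> that(2) Arr.hyps(3,4) show ?thesis
      unfolding two_arcs_def by (auto split: if_splits)
  qed
  show ?case
  proof (cases "S \<inter> V \<subseteq> {v}")
    case False
    then obtain C where "C \<in> triangles T H E" "T ` C \<subseteq> S" using Arr.IH sub by blast
    then show ?thesis using triangles_mono[of E "insert a E"] by blast
  next
    case True
    with Arr.prems(2) have v: "v \<in> S" "v \<in> V" "v \<noteq> \<rho>" using Arr.hyps(2) by auto
    then have "two_arcs T H (insert a E) S v" using Arr.prems(1) by auto
    \<comment> \<open>Of two distinct arrows at least one differs from \<open>a\<close>; it lies in
      \<open>E\<close> with both ends equal to \<open>v\<close>, a loop.\<close>
    then obtain e where e: "e \<in> E" "T e \<in> S" "H e \<in> S"
      unfolding two_arcs_def by blast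
    then have "T e = v" "H e = v" using ends True by auto
    then show ?thesis using rooted_code_no_loop[OF Arr.hyps(1) e(1)] by simp
  qed
next
  case (Tri U E u t W F w t' \<rho> a b c)
  let ?E = "{a, b, c} \<union> E \<union> F"
  note ends = rooted_code_ends[OF Tri.hyps(1)] rooted_code_ends[OF Tri.hyps(2)]
    and root = rooted_code_root[OF Tri.hyps(1)] rooted_code_root[OF Tri.hyps(2)]
    and arcs = Tri.hyps(5-10)
  have two: "two_arcs T H ?E S x" if "x \<in> S" "x \<in> U \<union> W" for x
    using Tri.prems(1)[of x] that Tri.hyps(3) by auto
  have subU: "two_arcs T H E S x" if "x \<in> S \<inter> U" "x \<noteq> u" for x
  proof -
    have "x \<noteq> \<rho>" "x \<notin> W" "x \<noteq> w" using that Tri.hyps root by auto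
    then show ?thesis using two[of x] that ends(3,4) arcs
      unfolding two_arcs_def by (smt (verit, ccfv_threshold) IntD1 IntD2 Un_iff insert_iff singletonD)
  qed
  have subW: "two_arcs T H F S x" if "x \<in> S \<inter> W" "x \<noteq> w" for x
  proof -
    have "x \<noteq> \<rho>" "x \<notin> U" "x \<noteq> u" using that Tri.hyps root by auto
    then show ?thesis using two[of x] that ends(1,2) arcs
      unfolding two_arcs_def by (smt (verit, ccfv_threshold) IntD1 IntD2 Un_iff insert_iff singletonD)
  qed
  consider "\<not> S \<inter> U \<subseteq> {u}" | "\<not> S \<inter> W \<subseteq> {w}" | "S \<inter> U \<subseteq> {u}" "S \<inter> W \<subseteq> {w}" by blast
  then show ?case
  proof cases
    case 1
    then obtain C where "C \<in> triangles T H E" "T ` C \<subseteq> S" using Tri.IH(1) subU by blast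
    then show ?thesis using triangles_mono[of E ?E] by blast
  next
    case 2
    then obtain C where "C \<in> triangles T H F" "T ` C \<subseteq> S" using Tri.IH(2) subW by blast
    then show ?thesis using triangles_mono[of F ?E] by blast
  next
    case 3
    \<comment> \<open>Arrows of the smaller quivers inside \<open>S\<close> would be loops, so only
      \<open>a\<close>, \<open>b\<close>, \<open>c\<close> remain, and any two of these touch all
      three vertices.\<close>
    have E: "\<not> (T e \<in> S \<and> H e \<in> S)" if "e \<in> E" for e
      using rooted_code_no_loop[OF Tri.hyps(1) that] ends(1,2)[OF that] 3 by auto
    have F: "\<not> (T e \<in> S \<and> H e \<in> S)" if "e \<in> F" for e
      using rooted_code_no_loop[OF Tri.hyps(2) that] ends(3,4)[OF that] 3 by auto
    have "u \<noteq> w" "u \<noteq> \<rho>" "w \<noteq> \<rho>" using Tri.hyps root by auto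
    have "u \<in> S \<or> w \<in> S" using Tri.prems(2) 3 by auto
    then have "\<rho> \<in> S \<and> u \<in> S \<and> w \<in> S"
    proof
      assume "u \<in> S"
      then have "two_arcs T H ?E S u" using two root by auto
      then obtain e f where "e \<in> {a, b, c}" "f \<in> {a, b, c}" "e \<noteq> f" "T e \<in> S" "H e \<in> S"
        "T f \<in> S" "H f \<in> S" "T e = u \<or> H e = u" "T f = u \<or> H f = u"
        using E F unfolding two_arcs_def by blast
      then show ?thesis using arcs \<open>u \<noteq> w\<close> \<open>u \<noteq> \<rho>\<close> by auto
    next
      assume "w \<in> S"
      then have "two_arcs T H ?E S w" using two root by auto
      then obtain e f where "e \<in> {a, b, c}" "f \<in> {a, b, c}" "e \<noteq> f" "T e \<in> S" "H e \<in> S"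
        "T f \<in> S" "H f \<in> S" "T e = w \<or> H e = w" "T f = w \<or> H f = w"
        using E F unfolding two_arcs_def by blast
      then show ?thesis using arcs \<open>u \<noteq> w\<close> \<open>w \<noteq> \<rho>\<close> by auto
    qed
    moreover have "{a, b, c} \<in> triangles T H ?E" using arcs by (intro trianglesI) auto
    ultimately show ?thesis using arcs by (intro bexI[of _ "{a, b, c}"]) auto
  qed
qed

section \<open>Oriented 3-cycles of a rooted quiver\<close>

lemma triangles_subset: "C \<in> triangles T H E \<Longrightarrow> C \<subseteq> E"
  unfolding triangles_def by auto

lemma triangles_nonempty: "C \<in> triangles T H E \<Longrightarrow> C \<noteq> {}"
  unfolding triangles_def by auto

lemma finite_triangles: "finite E \<Longrightarrow> finite (triangles T H E)"
  by (rule finite_subset[of _ "Pow E"]) (auto dest: triangles_subset)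

text \<open>The root has no arrow besides \<open>a\<close>, so no 3-cycle can pass through
  it.\<close>

lemma rooted_code_triangles_Arr:
  assumes "rooted_code T H V E v t" "\<rho> \<notin> V"
    "T a = (if d then \<rho> else v)" "H a = (if d then v else \<rho>)"
  shows "triangles T H (insert a E) = triangles T H E"
proof
  note ends = rooted_code_ends[OF assms(1)] and root = rooted_code_root[OF assms(1)]
  show "triangles T H (insert a E) \<subseteq> triangles T H E"
  proof
    fix C assume "C \<in> triangles T H (insert a E)"
    then obtain x y z where C: "C = {x, y, z}" "{x, y, z} \<subseteq> insert a E"
      "H x = T y" "H y = T z" "H z = T x" unfolding triangles_def by auto
    have "x \<noteq> a" "y \<noteq> a" "z \<noteq> a" 
      using C(2-) assms(2-) ends root by (auto split: if_splits) metis+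
    with C show "C \<in> triangles T H E" unfolding triangles_def by auto
  qed
qed (auto intro: subsetD[OF triangles_mono, of E])

text \<open>A 3-cycle through \<open>a\<close> must go on with \<open>b\<close> and
  \<open>c\<close>, since turning into \<open>E\<close> or \<open>F\<close> leaves no way back to
  \<open>\<rho>\<close> in time. One through \<open>c\<close> contains \<open>a\<close>, the only
  arrow leaving the root. One through \<open>b\<close> alone would have to pass from
  \<open>F\<close> to \<open>E\<close>, which share no vertex.\<close>

lemma rooted_code_triangles_Tri:
  assumes "rooted_code T H U E u t" "rooted_code T H W F w t'" "\<rho> \<notin> U \<union> W" "U \<inter> W = {}"
    "T a = \<rho>" "H a = u" "T b = u" "H b = w" "T c = w" "H c = \<rho>"
  shows "triangles T H ({a, b, c} \<union> E \<union> F) =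
    insert {a, b, c} (triangles T H E \<union> triangles T H F)"
proof
  note ends = rooted_code_ends[OF assms(1)] rooted_code_ends[OF assms(2)]
    and root = rooted_code_root[OF assms(1)] rooted_code_root[OF assms(2)]
  let ?E = "{a, b, c} \<union> E \<union> F"
  have ne: "u \<noteq> w" "u \<noteq> \<rho>" "w \<noteq> \<rho>" using assms root by auto
  have out_a: "e = b \<or> e \<in> E" if "e \<in> ?E" "T e \<in> U" for e
    using that assms(3-) ends root ne by auto
  have out_b: "e = c \<or> e \<in> F" if "e \<in> ?E" "T e \<in> W" for e
    using that assms(3-) ends root ne by auto
  have out_c: "e = a" if "e \<in> ?E" "T e = \<rho>" for e
    using that assms(3-) ends root ne by auto
  have into: "e = a \<or> e \<in> E" if "e \<in> ?E" "H e \<in> U" for e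
    using that assms(3-) ends root ne by auto
  have "triangles T H ?E \<subseteq> insert {a, b, c} (triangles T H E \<union> triangles T H F)"
  proof
    fix C assume "C \<in> triangles T H ?E"
    then obtain x y z where C: "C = {x, y, z}" "x \<in> ?E" "y \<in> ?E" "z \<in> ?E"
      "H x = T y" "H y = T z" "H z = T x" unfolding triangles_def by auto
    have from_a: "y' = b \<and> z' = c"
      if "x' = a" "y' \<in> ?E" "z' \<in> ?E" "H x' = T y'" "H y' = T z'" "H z' = T x'" for x' y' z'
    proof -
      have "y' = b \<or> y' \<in> E" using out_a[of y'] that assms(6) root by simp
      moreover have "y' \<notin> E"
      proof
        assume "y' \<in> E"
        then have "T z' \<in> U" using ends that by metis
        then have "z' = b \<or> z' \<in> E" using out_a that by blast
        then have "H z' \<in> W \<or> H z' \<in> U" using ends assms(8) root by metis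
        then show False using that assms(3,5) by auto
      qed
      ultimately have "y' = b" by simp
      then have "z' = c \<or> z' \<in> F" using out_b[of z'] that assms(8) root by simp
      moreover have "z' \<notin> F" using that assms(3,5) ends by auto
      ultimately show ?thesis using \<open>y' = b\<close> by simp
    qed
    consider "a \<in> C" | "a \<notin> C" "b \<in> C \<or> c \<in> C" | "a \<notin> C" "b \<notin> C" "c \<notin> C" by blast
    then show "C \<in> insert {a, b, c} (triangles T H E \<union> triangles T H F)"
    proof cases
      case 1
      with C(1) consider "x = a" | "y = a" | "z = a" by auto
      then have "C = {a, b, c}"
      proof cases
        case 1
        with from_a[of x y z] C show ?thesis by metis
      next
        case 2
        with from_a[of y z x] C have "z = b" "x = c" by metis+
        with 2 C(1) show ?thesis by auto
      next
        case 3
        with from_a[of z x y] C have "x = b" "y = c" by metis+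
        with 3 C(1) show ?thesis by auto
      qed
      then show ?thesis by simp
    next
      case 2
      have c: "c \<notin> C"
      proof
        assume "c \<in> C"
        then have "c = x \<or> c = y \<or> c = z" using C(1) by auto
        then have "T y = \<rho> \<or> T z = \<rho> \<or> T x = \<rho>" using C(5-) assms(10) by metis
        then show False using out_c C(1-4) 2(1) by auto
      qed
      with 2 have "b \<in> C" by simp
      have "\<not> (x' = b \<and> y' \<noteq> a \<and> z' \<noteq> a \<and> y' \<noteq> c \<and> z' \<noteq> c \<and> y' \<in> ?E \<and> z' \<in> ?E \<and> H x' = T y' \<and> H y' = T z' \<and> H z' = T x')" for x' y' z'
      proof (intro notI, elim conjE)
        assume *: "x' = b" "y' \<noteq> a" "z' \<noteq> a" "y' \<noteq> c" "z' \<noteq> c" "y' \<in> ?E" "z' \<in> ?E" "H x' = T y'" "H y' = T z'" "H z' = T x'"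
        have "y' \<in> F" using * out_b[of y'] assms(8) root by simp
        moreover have "z' \<in> E" using * into[of z'] assms(7) root by simp
        ultimately show False using ends *(9) assms(4) by (metis IntI empty_iff)
      qed
      from this[of x y z] this[of y z x] this[of z x y] \<open>b \<in> C\<close> c 2(1) C show ?thesis by auto
    next
      case 3
      then have "{x, y, z} \<subseteq> E \<union> F" using C by auto
      moreover have False if "e \<in> E" "f \<in> F" "H e = T f \<or> H f = T e" for e f
        using that ends assms(4) by (metis IntI empty_iff)
      ultimately have "{x, y, z} \<subseteq> E \<or> {x, y, z} \<subseteq> F" using C by auto
      then show ?thesis using C(5-) trianglesI[of x E y z H T] trianglesI[of x F y z H T]
        unfolding C(1) by auto
    qed
  qed
  then show "triangles T H ?E \<subseteq> insert {a, b, c} (triangles T H E \<union> triangles T H F)" .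
  have "{a, b, c} \<in> triangles T H ?E" using assms(5-) by (intro trianglesI) auto
  then show "insert {a, b, c} (triangles T H E \<union> triangles T H F) \<subseteq> triangles T H ?E"
    using triangles_mono[of E ?E] triangles_mono[of F ?E] by blast
qed

lemma rooted_code_triangles:
  assumes "rooted_code T H V E \<rho> t"
  shows "card (triangles T H E) = ntri t" "card (E - \<Union> (triangles T H E)) = narr t"
  using assms
proof (induction rule: rooted_code.induct)
  case (Leaf \<rho>)
  { case 1 show ?case by (auto simp: triangles_def) }
  { case 2 show ?case by simp }
next
  case (Arr V E v t \<rho> a d)
  note eq = rooted_code_triangles_Arr[OF Arr.hyps]
  have "a \<notin> E" using rooted_code_ends[OF Arr.hyps(1), of a] Arr.hyps by (auto split: if_splits)
  { case 1 show ?case using Arr.IH eq by simp }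
  { case 2
    have "insert a E - \<Union> (triangles T H E) = insert a (E - \<Union> (triangles T H E))"
      using \<open>a \<notin> E\<close> triangles_subset[of _ T H E] by auto
    then show ?case using Arr.IH eq \<open>a \<notin> E\<close> rooted_code_finite[OF Arr.hyps(1)] by simp }
next
  case (Tri U E u t W F w t' \<rho> a b c)
  note eq = rooted_code_triangles_Tri[OF Tri.hyps]
  note ends = rooted_code_ends[OF Tri.hyps(1)] rooted_code_ends[OF Tri.hyps(2)]
    and root = rooted_code_root[OF Tri.hyps(1)] rooted_code_root[OF Tri.hyps(2)]
    and fin = rooted_code_finite[OF Tri.hyps(1)] rooted_code_finite[OF Tri.hyps(2)]
  have EF: "E \<inter> F = {}" using ends Tri.hyps(4) by blast
  have a: "a \<notin> E" "a \<notin> F" "b \<notin> E" "b \<notin> F" "c \<notin> E" "c \<notin> F"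
    using ends(1,2)[of a] ends(3,4)[of a] ends(1,2)[of b] ends(3,4)[of b] ends(1,2)[of c]
      ends(3,4)[of c] root Tri.hyps(3-) by auto
  have "{a, b, c} \<notin> triangles T H E \<union> triangles T H F"
    using a triangles_subset[of "{a, b, c}" T H E] triangles_subset[of "{a, b, c}" T H F] by auto
  moreover have "triangles T H E \<inter> triangles T H F = {}"
  proof (rule equals0I)
    fix C assume "C \<in> triangles T H E \<inter> triangles T H F"
    then have "C \<subseteq> E" "C \<subseteq> F" "C \<noteq> {}"
      using triangles_subset[of C] triangles_nonempty[of C] by auto
    then show False using EF by blast
  qed
  ultimately have "card (triangles T H ({a, b, c} \<union> E \<union> F)) = Suc (ntri t + ntri t')"
    unfolding eq using Tri.IH fin by (simp add: card_Un_disjoint finite_triangles)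
  { case 1 show ?case using \<open>card _ = Suc _\<close> by simp }
  { case 2
    have "{a, b, c} \<union> E \<union> F - \<Union> (triangles T H ({a, b, c} \<union> E \<union> F)) =
        (E - \<Union> (triangles T H E)) \<union> (F - \<Union> (triangles T H F))"
      unfolding eq using a EF triangles_subset[of _ T H E] triangles_subset[of _ T H F] by auto
    also have "card \<dots> = narr t + narr t'"
      using Tri.IH fin EF by (subst card_Un_disjoint) auto
    finally show ?case by simp }
qed

section \<open>Transport along isomorphisms and standard copies\<close>

lemma inj_on_UnI: "\<lbrakk>inj_on f A; inj_on f B; f ` A \<inter> f ` B = {}\<rbrakk> \<Longrightarrow> inj_on f (A \<union> B)"
  by (auto simp: inj_on_Un)

lemma rooted_code_image:
  "\<lbrakk>rooted_code T H V E \<rho> t; inj_on f V; \<And>e. e \<in> E \<Longrightarrow> T' (g e) = f (T e) \<and> H' (g e) = f (H e)\<rbrakk>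
    \<Longrightarrow> rooted_code T' H' (f ` V) (g ` E) (f \<rho>) t"
proof (induction rule: rooted_code.induct)
  case (Leaf \<rho>)
  then show ?case by (auto intro: rooted_code.Leaf)
next
  case (Arr V E v t \<rho> a d)
  have "rooted_code T' H' (f ` V) (g ` E) (f v) t"
    using Arr.prems by (intro Arr.IH) (auto simp: inj_on_def)
  moreover have "f \<rho> \<notin> f ` V" using Arr.hyps(2) Arr.prems(1) by (auto simp: inj_on_def)
  ultimately have "rooted_code T' H' (insert (f \<rho>) (f ` V)) (insert (g a) (g ` E)) (f \<rho>) (Arr d t)"
    using Arr.hyps(3,4) Arr.prems(2)[of a] by (intro rooted_code.Arr) auto
  then show ?case by simp
next
  case (Tri U E u t W F w t' \<rho> a b c)
  have "rooted_code T' H' (f ` U) (g ` E) (f u) t" "rooted_code T' H' (f ` W) (g ` F) (f w) t'"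
    using Tri.prems by (auto intro!: Tri.IH simp: inj_on_def)
  moreover have "f \<rho> \<notin> f ` U \<union> f ` W" "f ` U \<inter> f ` W = {}"
    using Tri.hyps(3,4) Tri.prems(1) by (auto simp: inj_on_def)
  ultimately have "rooted_code T' H' (insert (f \<rho>) (f ` U \<union> f ` W)) ({g a, g b, g c} \<union> g ` E \<union> g ` F)
      (f \<rho>) (Tri t t')"
    using Tri.hyps(5-) Tri.prems(2)[of a] Tri.prems(2)[of b] Tri.prems(2)[of c]
    by (intro rooted_code.Tri) auto
  then show ?case by (simp add: image_Un)
qed

text \<open>
  A standard copy of the rooted quiver with code \<open>t\<close>: the prefixes 3 and 4 label the parts of the
  first and of the second subquiver, and \<open>[0], [1], [2]\<close> are the arrows outside the subquivers.
\<close>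

primrec model_verts :: "rtree \<Rightarrow> nat list set" where
  "model_verts Leaf = {[]}"
| "model_verts (Arr d t) = insert [] ((#) 3 ` model_verts t)"
| "model_verts (Tri t u) = insert [] ((#) 3 ` model_verts t \<union> (#) 4 ` model_verts u)"

primrec model_arcs :: "rtree \<Rightarrow> nat list set" where
  "model_arcs Leaf = {}"
| "model_arcs (Arr d t) = insert [0] ((#) 3 ` model_arcs t)"
| "model_arcs (Tri t u) = {[0], [1], [2]} \<union> (#) 3 ` model_arcs t \<union> (#) 4 ` model_arcs u"

primrec model_tail :: "rtree \<Rightarrow> nat list \<Rightarrow> nat list" where
  "model_tail Leaf = (\<lambda>e. [])"
| "model_tail (Arr d t) = (\<lambda>e. if hd e = 3 then 3 # model_tail t (tl e) else if d then [] else [3])"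
| "model_tail (Tri t u) = (\<lambda>e. if hd e = 3 then 3 # model_tail t (tl e)
     else if hd e = 4 then 4 # model_tail u (tl e)
     else if hd e = 0 then [] else if hd e = 1 then [3] else [4])"

primrec model_head :: "rtree \<Rightarrow> nat list \<Rightarrow> nat list" where
  "model_head Leaf = (\<lambda>e. [])"
| "model_head (Arr d t) = (\<lambda>e. if hd e = 3 then 3 # model_head t (tl e) else if d then [3] else [])"
| "model_head (Tri t u) = (\<lambda>e. if hd e = 3 then 3 # model_head t (tl e)
     else if hd e = 4 then 4 # model_head u (tl e)
     else if hd e = 0 then [3] else if hd e = 1 then [4] else [])"

lemma rooted_code_model:
  "rooted_code (model_tail t) (model_head t) (model_verts t) (model_arcs t) [] t"
proof (induction t)
  case Leaf
  then show ?case by (simp add: rooted_code.Leaf)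
next
  case (Arr d t)
  let ?T = "model_tail (Arr d t)" and ?H = "model_head (Arr d t)"
  have "rooted_code ?T ?H ((#) 3 ` model_verts t) ((#) 3 ` model_arcs t) [3] t"
    using rooted_code_image[OF Arr, of "(#) 3" ?T "(#) 3" ?H] by simp
  then have "rooted_code ?T ?H (insert [] ((#) 3 ` model_verts t))
      (insert [0] ((#) 3 ` model_arcs t)) [] (Arr d t)"
    by (rule rooted_code.Arr) auto
  then show ?case by simp
next
  case (Tri t u)
  let ?T = "model_tail (Tri t u)" and ?H = "model_head (Tri t u)"
  have "rooted_code ?T ?H ((#) 3 ` model_verts t) ((#) 3 ` model_arcs t) [3] t"
    using rooted_code_image[OF Tri(1), of "(#) 3" ?T "(#) 3" ?H] by simp
  moreover have "rooted_code ?T ?H ((#) 4 ` model_verts u) ((#) 4 ` model_arcs u) [4] u"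
    using rooted_code_image[OF Tri(2), of "(#) 4" ?T "(#) 4" ?H] by simp
  ultimately have "rooted_code ?T ?H (insert [] ((#) 3 ` model_verts t \<union> (#) 4 ` model_verts u))
      ({[0], [1], [2]} \<union> (#) 3 ` model_arcs t \<union> (#) 4 ` model_arcs u) [] (Tri t u)"
    by (rule rooted_code.Tri) auto
  then show ?case by simp
qed

text \<open>Rooted quivers with equal codes are isomorphic because all of them are copies of one
  fixed quiver. The maps are glued along the code, and they stay injective because the pieces have
  disjoint images.\<close>

lemma rooted_code_model_iso:
  "rooted_code T H V E \<rho> t \<Longrightarrow> \<exists>f g. inj_on f (model_verts t) \<and> inj_on g (model_arcs t) \<and>
    V = f ` model_verts t \<and> E = g ` model_arcs t \<and> f [] = \<rho> \<and>
    (\<forall>e\<in>model_arcs t. T (g e) = f (model_tail t e) \<and> H (g e) = f (model_head t e))"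
proof (induction rule: rooted_code.induct)
  case (Leaf \<rho>)
  show ?case by (rule exI[of _ "\<lambda>_. \<rho>"]) auto
next
  case (Arr V E v t \<rho> a d)
  then obtain f g where fg: "inj_on f (model_verts t)" "inj_on g (model_arcs t)"
    "V = f ` model_verts t" "E = g ` model_arcs t" "f [] = v"
    "\<And>e. e \<in> model_arcs t \<Longrightarrow> T (g e) = f (model_tail t e) \<and> H (g e) = f (model_head t e)"
    by blast
  have a: "a \<notin> E" using rooted_code_ends[OF Arr.hyps(1), of a] Arr.hyps by (auto split: if_splits)
  define f' where "f' q = (if q = [] then \<rho> else f (tl q))" for q
  define g' where "g' q = (if q = [0::nat] then a else g (tl q))" for q
  have simps: "f' [] = \<rho>" "\<And>n q. f' (n # q) = f q" "g' [0] = a" "\<And>q. g' (3 # q) = g q"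
    by (auto simp: f'_def g'_def)
  have "inj_on f' (model_verts (Arr d t))" "inj_on g' (model_arcs (Arr d t))"
    using fg(1-4) Arr.hyps(2) a by (auto simp: simps inj_on_def)
  moreover have "insert \<rho> V = f' ` model_verts (Arr d t)" "insert a E = g' ` model_arcs (Arr d t)"
    using fg(3,4) by (auto simp: simps image_image)
  moreover have "T (g' e) = f' (model_tail (Arr d t) e) \<and> H (g' e) = f' (model_head (Arr d t) e)"
    if "e \<in> model_arcs (Arr d t)" for e
    using that fg(5,6) Arr.hyps(3,4) by (auto simp: simps)
  ultimately show ?case by (intro exI[of _ f'] exI[of _ g']) (use simps(1) in blast)
next
  case (Tri U E u t W F w t' \<rho> a b c)
  from Tri.IH(1) obtain f1 g1 where fg1: "inj_on f1 (model_verts t)" "inj_on g1 (model_arcs t)"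
    "U = f1 ` model_verts t" "E = g1 ` model_arcs t" "f1 [] = u"
    "\<And>e. e \<in> model_arcs t \<Longrightarrow> T (g1 e) = f1 (model_tail t e) \<and> H (g1 e) = f1 (model_head t e)"
    by blast
  from Tri.IH(2) obtain f2 g2 where fg2: "inj_on f2 (model_verts t')" "inj_on g2 (model_arcs t')"
    "W = f2 ` model_verts t'" "F = g2 ` model_arcs t'" "f2 [] = w"
    "\<And>e. e \<in> model_arcs t' \<Longrightarrow> T (g2 e) = f2 (model_tail t' e) \<and> H (g2 e) = f2 (model_head t' e)"
    by blast
  note ends = rooted_code_ends[OF Tri.hyps(1)] rooted_code_ends[OF Tri.hyps(2)]
    and root = rooted_code_root[OF Tri.hyps(1)] rooted_code_root[OF Tri.hyps(2)]
  have a: "a \<notin> E" "a \<notin> F" "b \<notin> E" "b \<notin> F" "c \<notin> E" "c \<notin> F"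
    using ends(1,2)[of a] ends(3,4)[of a] ends(1,2)[of b] ends(3,4)[of b] ends(1,2)[of c]
      ends(3,4)[of c] root Tri.hyps(3-) by auto
  have abc: "a \<noteq> b" "b \<noteq> c" "a \<noteq> c" using root Tri.hyps(3-) by auto
  have EF: "E \<inter> F = {}" using ends Tri.hyps(4) by blast
  define f' where "f' q = (if q = [] then \<rho> else if hd q = 3 then f1 (tl q) else f2 (tl q))"
    for q :: "nat list"
  define g' where "g' q = (if hd q = 3 then g1 (tl q) else if hd q = 4 then g2 (tl q)
    else if hd q = 0 then a else if hd q = 1 then b else c)" for q :: "nat list"
  have simps: "f' [] = \<rho>" "\<And>q. f' (3 # q) = f1 q" "\<And>q. f' (4 # q) = f2 q"
    "g' [0] = a" "g' [1] = b" "g' [Suc 0] = b" "g' [2] = c" "\<And>q. g' (3 # q) = g1 q" "\<And>q. g' (4 # q) = g2 q"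
    by (auto simp: f'_def g'_def)
  have inj: "inj_on f' ((#) 3 ` model_verts t)" "inj_on f' ((#) 4 ` model_verts t')"
    "inj_on g' ((#) 3 ` model_arcs t)" "inj_on g' ((#) 4 ` model_arcs t')" "inj_on g' {[0], [1], [2]}"
    using fg1(1,2) fg2(1,2) abc by (auto simp: simps inj_on_def)
  have im: "f' ` (#) 3 ` model_verts t = U" "f' ` (#) 4 ` model_verts t' = W"
    "g' ` (#) 3 ` model_arcs t = E" "g' ` (#) 4 ` model_arcs t' = F" "g' ` {[0], [1], [2]} = {a, b, c}"
    using fg1(3,4) fg2(3,4) by (auto simp: simps image_image)
  have inj': "inj_on f' ({[]} \<union> ((#) 3 ` model_verts t \<union> (#) 4 ` model_verts t'))"
    by (intro inj_on_UnI) (use inj im(1,2) Tri.hyps(3,4) in \<open>auto simp only: image_Un simps(1) image_insert image_empty inj_on_insert inj_on_empty\<close>)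
  have "inj_on g' ({[0], [1], [2]} \<union> (#) 3 ` model_arcs t \<union> (#) 4 ` model_arcs t')"
    by (intro inj_on_UnI inj; simp only: image_Un im) (use a EF in auto)
  with inj' have "inj_on f' (model_verts (Tri t t'))" "inj_on g' (model_arcs (Tri t t'))"
    by simp_all
  moreover have "insert \<rho> (U \<union> W) = f' ` model_verts (Tri t t')"
    "{a, b, c} \<union> E \<union> F = g' ` model_arcs (Tri t t')"
    by (simp only: model_verts.simps image_insert image_Un im simps(1),
        simp only: model_arcs.simps image_Un im)
  moreover have "T (g' e) = f' (model_tail (Tri t t') e) \<and> H (g' e) = f' (model_head (Tri t t') e)"
    if "e \<in> model_arcs (Tri t t')" for e
    using that fg1(5,6) fg2(5,6) Tri.hyps(5-) by (auto simp: simps)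
  ultimately show ?case by (intro exI[of _ f'] exI[of _ g']) (use simps(1) in blast)
qed

section \<open>Uniqueness of the code\<close>

lemma rooted_code_incident_Arr:
  assumes "rooted_code T H V E v t" "\<rho> \<notin> V"
    "T a = (if d then \<rho> else v)" "H a = (if d then v else \<rho>)"
  shows "{e \<in> insert a E. T e = \<rho> \<or> H e = \<rho>} = {a}" "a \<notin> E"
proof -
  have "T e \<noteq> \<rho> \<and> H e \<noteq> \<rho>" if "e \<in> E" for e
    using rooted_code_ends[OF assms(1) that] assms(2) by metis
  then show "{e \<in> insert a E. T e = \<rho> \<or> H e = \<rho>} = {a}" "a \<notin> E"
    using assms(3,4) by (auto split: if_splits)
qed

text \<open>Each part of the last construction step is characterized by the ends of its arrows,
  which makes two derivations over the same sets comparable.\<close>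

lemma rooted_code_incident_Tri:
  assumes "rooted_code T H U E u t" "rooted_code T H W F w t'" "\<rho> \<notin> U \<union> W" "U \<inter> W = {}"
    "T a = \<rho>" "H a = u" "T b = u" "H b = w" "T c = w" "H c = \<rho>"
  defines "D \<equiv> {a, b, c} \<union> E \<union> F"
  shows "{e \<in> D. T e = \<rho>} = {a}" "{e \<in> D. H e = \<rho>} = {c}" "{e \<in> D. T e = u \<and> H e = w} = {b}"
    "{e \<in> D. T e \<in> U \<and> H e \<in> U} = E" "{e \<in> D. T e \<in> W \<and> H e \<in> W} = F" "a \<noteq> c"
    "{a, b, c} \<inter> (E \<union> F) = {}"
proof -
  note ends = rooted_code_ends[OF assms(1)] rooted_code_ends[OF assms(2)]
    and root = rooted_code_root[OF assms(1)] rooted_code_root[OF assms(2)]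
  have E: "T e \<noteq> \<rho> \<and> H e \<noteq> \<rho> \<and> T e \<notin> W \<and> H e \<notin> W \<and> H e \<noteq> w \<and> T e \<in> U \<and> H e \<in> U" if "e \<in> E" for e
    using ends(1,2)[OF that] assms(3,4) root by auto
  have F: "T e \<noteq> \<rho> \<and> H e \<noteq> \<rho> \<and> T e \<notin> U \<and> H e \<notin> U \<and> T e \<noteq> u \<and> T e \<in> W \<and> H e \<in> W" if "e \<in> F" for e
    using ends(3,4)[OF that] assms(3,4) root by auto
  have ne: "u \<noteq> w" "u \<noteq> \<rho>" "w \<noteq> \<rho>" "u \<in> U" "w \<in> W" "u \<notin> W" "w \<notin> U" "\<rho> \<notin> U" "\<rho> \<notin> W"
    using assms(3,4) root by auto
  show "{e \<in> D. T e = \<rho>} = {a}" "{e \<in> D. H e = \<rho>} = {c}" "{e \<in> D. T e = u \<and> H e = w} = {b}" "a \<noteq> c"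
    using E F ne assms(5-10) unfolding D_def by auto
  show "{a, b, c} \<inter> (E \<union> F) = {}"
    using E[of a] E[of b] E[of c] F[of a] F[of b] F[of c] ne assms(5-10) by auto
  show "{e \<in> D. T e \<in> U \<and> H e \<in> U} = E" "{e \<in> D. T e \<in> W \<and> H e \<in> W} = F" 
    using E F ne assms(5-10) unfolding D_def by auto
qed

text \<open>\<open>U\<close> is connected and contains \<open>u\<close>, while no arrow of
  \<open>E' \<union> F'\<close> joins \<open>U'\<close> to \<open>W'\<close>. Exchanging the two
  derivations gives equality.\<close>

lemma rooted_code_split_unique:
  assumes "rooted_code T H U E u t" "rooted_code T H W F w t'" 
    "rooted_code T H U' E' u s" "rooted_code T H W' F' w s'" "E \<subseteq> E' \<union> F'" "U' \<inter> W' = {}"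
  shows "U \<subseteq> U'"
proof (rule rooted_code_connected[OF assms(1)])
  show "u \<in> U'" by (rule rooted_code_root[OF assms(3)])
  show "T e \<in> U' \<longleftrightarrow> H e \<in> U'" if "e \<in> E" for e
    using that assms(5,6) rooted_code_ends[OF assms(3), of e] rooted_code_ends[OF assms(4), of e] by blast
qed

text \<open>The last construction step is visible at the root: one incident arrow means
  \<open>Arr\<close>, two mean \<open>Tri\<close>. In the second case the outgoing and the incoming
  arrow determine \<open>u\<close> and \<open>w\<close>, and the rest falls apart into their
  components.\<close>

lemma rooted_code_unique:
  "rooted_code T H V E \<rho> t \<Longrightarrow> rooted_code T H V E \<rho> t' \<Longrightarrow> t = t'"
proof (induction arbitrary: t' rule: rooted_code.induct)
  case (Leaf \<rho>)
  from rooted_code_card[OF Leaf] show ?case by (cases t') (use Leaf in \<open>auto elim: rooted_code.cases\<close>)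
next
  case (Arr V E v t \<rho> a d)
  note inc = rooted_code_incident_Arr[OF Arr.hyps]
  from Arr.prems show ?case
  proof (cases rule: rooted_code.cases)
    case Leaf
    then show ?thesis by simp
  next
    case (Arr V' E' v' s a' d')
    note inc' = rooted_code_incident_Arr[OF Arr(4-7)]
    have "{a} = {a'}" using inc(1) inc'(1) unfolding Arr(2)[symmetric] by simp
    then have "a' = a" by simp
    moreover have "V' = V" using Arr(1,5) Arr.hyps(2) by (metis Diff_insert_absorb)
    moreover have "E' = E" using Arr(2) inc(2) inc'(2) \<open>a' = a\<close> by (metis Diff_insert_absorb)
    moreover have "v' = v \<and> d' = d"
      using Arr.hyps(2-4) Arr(5-7) \<open>a' = a\<close> rooted_code_root[OF Arr.hyps(1)] rooted_code_root[OF Arr(4)]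
      by (auto split: if_splits)
    ultimately show ?thesis using Arr.IH[of s] Arr(3,4) by simp
  next
    case (Tri U E1 u t1 W F1 w t2 a' b' c')
    note inc' = rooted_code_incident_Tri[OF Tri(4-13)]
    have "a' \<in> {e \<in> insert a E. T e = \<rho> \<or> H e = \<rho>}" "c' \<in> {e \<in> insert a E. T e = \<rho> \<or> H e = \<rho>}"
      using Tri(2,8,13) by auto
    then have "a' = a" "c' = a" unfolding inc(1) by simp_all
    then show ?thesis using inc'(6) by simp
  qed
next
  case (Tri U E u t W F w t' \<rho> a b c s)
  note inc = rooted_code_incident_Tri[OF Tri.hyps]
  from Tri.prems show ?case
  proof (cases rule: rooted_code.cases)
    case Leaf
    then show ?thesis by simp
  next
    case (Arr V' E' v' s' a' d')
    note inc' = rooted_code_incident_Arr[OF Arr(4-7)]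
    have "a \<in> {e \<in> insert a' E'. T e = \<rho> \<or> H e = \<rho>}" "c \<in> {e \<in> insert a' E'. T e = \<rho> \<or> H e = \<rho>}"
      using Arr(2) Tri.hyps by auto
    then have "a = a'" "c = a'" unfolding inc'(1) by simp_all
    then show ?thesis using inc(6) by simp
  next
    case (Tri U' E' u' s1 W' F' w' s2 a' b' c')
    note inc' = rooted_code_incident_Tri[OF Tri(4-13)]
    note D = Tri(2)
    have "a' = a" "c' = c" using inc(1,2) inc'(1,2) unfolding D by auto
    then have uw: "u' = u" "w' = w" using Tri.hyps(5-) Tri(8-13) by auto
    then have "b' = b" using inc(3) inc'(3) unfolding D by auto
    have EF: "E \<union> F = E' \<union> F'"
    proof -
      have "E \<union> F = ({a, b, c} \<union> E \<union> F) - {a, b, c}" using inc(7) by blast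
      also have "\<dots> = ({a, b, c} \<union> E' \<union> F') - {a, b, c}"
        using D \<open>a' = a\<close> \<open>b' = b\<close> \<open>c' = c\<close> by simp
      also have "\<dots> = E' \<union> F'" using inc'(7) \<open>a' = a\<close> \<open>b' = b\<close> \<open>c' = c\<close> by blast
      finally show ?thesis .
    qed
    have "U \<subseteq> U'" "U' \<subseteq> U"
      using EF rooted_code_split_unique[OF Tri.hyps(1,2) Tri(4,5)[unfolded uw] _ Tri(7)]
        rooted_code_split_unique[OF Tri(4,5)[unfolded uw] Tri.hyps(1,2) _ Tri.hyps(4)] by auto
    then have U: "U' = U" by simp
    then have W: "W' = W" using Tri(1,6,7) Tri.hyps(3,4) by (auto simp: insert_eq_iff)
    have "E' = E" "F' = F" using inc(4,5) inc'(4,5) U W unfolding D by auto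
    then show ?thesis using Tri.IH Tri(3-5) U W uw by simp
  qed
qed

section \<open>Non-oriented cycles\<close>

text \<open>
  What a base arrow contributes to the parameters, \<open>None\<close> standing for a base arrow without attached
  rooted quiver. The \<open>Suc\<close> counts the 3-cycle through the base arrow.
\<close>

fun opt_narr :: "rtree option \<Rightarrow> nat" where
  "opt_narr None = 1"
| "opt_narr (Some t) = narr t"

fun opt_ntri :: "rtree option \<Rightarrow> nat" where
  "opt_ntri None = 0"
| "opt_ntri (Some t) = Suc (ntri t)"

section \<open>Codes and rooted quivers of type A\<close>

lemma rooted_type_A_imp_code:
  "rooted_type_A G \<rho> \<Longrightarrow> \<exists>t. rooted_code (tail G) (head G) (verts G) (arcs G) \<rho> t"
proof (induction rule: rooted_type_A.induct)
  case (single G \<rho>)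
  then show ?case by (auto intro: rooted_code.Leaf)
next
  case (arrow G \<rho> V a v)
  define E where "E = arcs (G \<restriction> V)"
  from arrow.IH obtain t where t: "rooted_code (tail G) (head G) V E v t" unfolding E_def by auto
  then have "v \<noteq> \<rho>" using rooted_code_root arrow.hyps(2) by metis
  have "rooted_code (tail G) (head G) (insert \<rho> V) (insert a E) \<rho> (Arr (tail G a = \<rho>) t)"
    by (rule rooted_code.Arr[OF t arrow.hyps(2)]) (use arrow.hyps(4) \<open>v \<noteq> \<rho>\<close> in auto)
  then show ?case using arrow.hyps(1,3) unfolding E_def by metis
next
  case (triangle G \<rho> U W a b c u w)
  define E F where "E = arcs (G \<restriction> U)" and "F = arcs (G \<restriction> W)"
  from triangle.IH obtain t t' where "rooted_code (tail G) (head G) U E u t"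
    "rooted_code (tail G) (head G) W F w t'" unfolding E_def F_def by auto
  from rooted_code.Tri[OF this triangle.hyps(2,3,5-10)]
  show ?case using triangle.hyps(1,4) unfolding E_def F_def by metis
qed

lemma rooted_code_imp_type_A:
  "rooted_code T H V E \<rho> t \<Longrightarrow> tail G = T \<Longrightarrow> head G = H \<Longrightarrow> verts G = V \<Longrightarrow> arcs G = E \<Longrightarrow>
    rooted_type_A G \<rho>"
proof (induction arbitrary: G rule: rooted_code.induct)
  case (Leaf \<rho>)
  then show ?case by (auto intro: rooted_type_A.single)
next
  case (Arr V E v t \<rho> a d)
  have "arcs (G \<restriction> V) = E"
    using Arr.hyps(2-) Arr.prems rooted_code_ends[OF Arr.hyps(1)] by (auto split: if_splits)
  moreover from this have "rooted_type_A (G \<restriction> V) v" using Arr.prems by (intro Arr.IH) auto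
  moreover have "(tail G a = \<rho> \<and> head G a = v) \<or> (tail G a = v \<and> head G a = \<rho>)"
    using Arr.hyps(3,4) Arr.prems by auto
  ultimately show ?case using Arr.hyps(2) Arr.prems(3,4) by (metis rooted_type_A.arrow)
next
  case (Tri U E u t W F w t' \<rho> a b c)
  note inc = rooted_code_incident_Tri[OF Tri.hyps]
  have U: "arcs (G \<restriction> U) = E" and W: "arcs (G \<restriction> W) = F" using inc(4,5) Tri.prems by simp_all
  have "rooted_type_A (G \<restriction> U) u" "rooted_type_A (G \<restriction> W) w"
    using Tri.prems U W by (auto intro!: Tri.IH)
  moreover have "arcs G = {a, b, c} \<union> arcs (G \<restriction> U) \<union> arcs (G \<restriction> W)"
    unfolding U W by (rule Tri.prems(4))
  ultimately show ?case using rooted_type_A.triangle[OF Tri.prems(3) Tri.hyps(3,4)] Tri.hyps(5-10) Tri.prems(1,2)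
    by metis
qed

section \<open>Connected components as closed sets\<close>

abbreviation sym_reachable :: "('a, 'b) pre_digraph \<Rightarrow> 'a \<Rightarrow> 'a \<Rightarrow> bool" where
  "sym_reachable G \<equiv> reachable (with_proj (mk_symmetric G))"

lemma sym_reachable_eq: "sym_reachable G u v \<longleftrightarrow>
    (u, v) \<in> rtrancl_on (verts G) (\<Union>e\<in>arcs G. {(tail G e, head G e), (head G e, tail G e)})"
  by (simp add: reachable_def arcs_ends_def arc_to_ends_def mk_symmetric_def)

text \<open>Such sets control reachability from both sides: a closed set bounds a component from
  above, and a reachable set is itself closed.\<close>

definition arc_closed :: "('a, 'b) pre_digraph \<Rightarrow> 'a set \<Rightarrow> bool" where
  "arc_closed G S \<longleftrightarrow> (\<forall>e\<in>arcs G. tail G e \<in> S \<longleftrightarrow> head G e \<in> S)"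

lemma sym_reachable_arc_closed:
  assumes "sym_reachable G u v" "u \<in> S" "arc_closed G S"
  shows "v \<in> S"
  using assms(1) unfolding sym_reachable_eq
  by (induction rule: rtrancl_on_induct) (use assms(2,3) in \<open>auto simp: arc_closed_def\<close>)

lemma arc_closed_sym_reachable:
  assumes "wf_digraph G"
  shows "arc_closed G {v. sym_reachable G u v}"
proof -
  interpret wf_digraph G by fact
  show ?thesis
    unfolding arc_closed_def sym_reachable_eq mem_Collect_eq
    by (intro ballI iffI; erule rtrancl_on_into_rtrancl_on) auto
qed

section \<open>Turns around a cycle\<close>

lemma cycle_turnD:
  assumes "cycle_turn H p"
  shows "length p \<ge> 2"
    "i < length p \<Longrightarrow> fst (p ! i) \<in> verts H" "i < length p \<Longrightarrow> snd (p ! i) \<in> arcs H"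
    "x \<in> verts H \<Longrightarrow> \<exists>i<length p. x = fst (p ! i)" "e \<in> arcs H \<Longrightarrow> \<exists>i<length p. e = snd (p ! i)"
    "\<lbrakk>i < length p; j < length p; fst (p ! i) = fst (p ! j)\<rbrakk> \<Longrightarrow> i = j"
    "\<lbrakk>i < length p; j < length p; snd (p ! i) = snd (p ! j)\<rbrakk> \<Longrightarrow> i = j"
    "i < length p \<Longrightarrow>
      (tail H (snd (p ! i)) = fst (p ! i) \<and> head H (snd (p ! i)) = fst (p ! (Suc i mod length p))) \<or>
      (tail H (snd (p ! i)) = fst (p ! (Suc i mod length p)) \<and> head H (snd (p ! i)) = fst (p ! i))"
proof -
  have p: "length p \<ge> 2" "set (map fst p) = verts H" "set (map snd p) = arcs H"
    "distinct (map fst p)" "distinct (map snd p)" using assms by (auto simp: cycle_turn_def)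
  show "length p \<ge> 2" by fact
  show "i < length p \<Longrightarrow> fst (p ! i) \<in> verts H" "i < length p \<Longrightarrow> snd (p ! i) \<in> arcs H"
    unfolding p(2,3)[symmetric] by auto
  show "x \<in> verts H \<Longrightarrow> \<exists>i<length p. x = fst (p ! i)" "e \<in> arcs H \<Longrightarrow> \<exists>i<length p. e = snd (p ! i)"
    unfolding p(2,3)[symmetric] in_set_conv_nth by auto
  show "\<lbrakk>i < length p; j < length p; fst (p ! i) = fst (p ! j)\<rbrakk> \<Longrightarrow> i = j"
    using nth_eq_iff_index_eq[OF p(4), of i j] by simp
  show "\<lbrakk>i < length p; j < length p; snd (p ! i) = snd (p ! j)\<rbrakk> \<Longrightarrow> i = j"
    using nth_eq_iff_index_eq[OF p(5), of i j] by simp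
qed (use assms in \<open>auto simp: cycle_turn_def Let_def\<close>)

lemma Suc_mod_neq: "2 \<le> n \<Longrightarrow> i < n \<Longrightarrow> Suc i mod n < n \<and> Suc i mod n \<noteq> i"
  by (auto simp: mod_Suc)

lemma Suc_mod_inject: "i < n \<Longrightarrow> j < n \<Longrightarrow> Suc i mod n = Suc j mod n \<Longrightarrow> i = j"
  by (auto simp: mod_Suc split: if_splits)

lemma Suc_mod_surj: "j < n \<Longrightarrow> \<exists>i<n. Suc i mod n = j"
  by (rule exI[of _ "if j = 0 then n - 1 else j - 1"]) auto

text \<open>Position \<open>j\<close> is reached from \<open>i\<close> after
  \<open>n - i + j\<close> steps, possibly going round more than once.\<close>

lemma cyclic_induct:
  assumes "i < n" "P i" "\<And>k. k < n \<Longrightarrow> P k \<Longrightarrow> P (Suc k mod n)" "j < n"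
  shows "P j"
proof -
  have "P ((i + k) mod n)" for k
  proof (induction k)
    case (Suc k)
    then show ?case using assms(3)[of "(i + k) mod n"] assms(1) by (simp add: mod_Suc_eq)
  qed (use assms in simp)
  moreover have "(i + (n - i + j)) mod n = j" using assms(1,4) by simp
  ultimately show ?thesis by metis
qed

lemma cycle_turn_two_arcs:
  assumes p: "cycle_turn H p" and x: "x \<in> verts H"
  shows "two_arcs (tail H) (head H) (arcs H) (verts H) x"
proof -
  note D = cycle_turnD[OF p]
  let ?n = "length p"
  obtain i where i: "i < ?n" "x = fst (p ! i)" using D(4)[OF x] by blast
  obtain j where j: "j < ?n" "Suc j mod ?n = i" using Suc_mod_surj[OF i(1)] by blast
  have "snd (p ! i) \<noteq> snd (p ! j)" using D(7)[OF i(1) j(1)] Suc_mod_neq[OF D(1) j(1)] j(2) by auto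
  moreover have "Suc i mod ?n < ?n" using Suc_mod_neq[OF D(1) i(1)] by simp
  ultimately show ?thesis
    unfolding two_arcs_def
    using D(8)[OF i(1)] D(8)[OF j(1)] D(2)[OF i(1)] D(2)[OF j(1)] D(3)[OF i(1)] D(3)[OF j(1)]
      D(2)[of "Suc i mod ?n"] i(2) j(2)
    by (intro bexI[of _ "snd (p ! i)"] bexI[of _ "snd (p ! j)"]) auto
qed

text \<open>A vertex of \<open>X\<close> whose successor is missing keeps at most the arrow to its
  predecessor inside \<open>X\<close>, which is one too few. Hence \<open>X\<close> is closed under
  successors.\<close>

lemma cycle_turn_two_arcs_subset:
  assumes p: "cycle_turn H p" and X: "X \<noteq> {}" "X \<subseteq> verts H"
    "\<And>x. x \<in> X \<Longrightarrow> two_arcs (tail H) (head H) (arcs H) X x"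
  shows "X = verts H"
proof -
  note D = cycle_turnD[OF p]
  let ?n = "length p" and ?v = "\<lambda>i. fst (p ! i)" and ?e = "\<lambda>i. snd (p ! i)"
  have nxt: "?v (Suc i mod ?n) \<in> X" if i: "i < ?n" "?v i \<in> X" for i
  proof (rule ccontr)
    assume no: "?v (Suc i mod ?n) \<notin> X"
    \<comment> \<open>Every arrow inside \<open>X\<close> at \<open>?v i\<close> belongs to the
      preceding step, so two such arrows coincide.\<close>
    have j: "Suc j mod ?n = i" if "j < ?n" "tail H (?e j) \<in> X" "head H (?e j) \<in> X"
      "tail H (?e j) = ?v i \<or> head H (?e j) = ?v i" for j
    proof -
      have "j \<noteq> i" using that(2,3) D(8)[OF i(1)] no by auto
      then have "?v j \<noteq> ?v i" using D(6)[OF that(1) i(1)] by blast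
      then have "?v (Suc j mod ?n) = ?v i" using D(8)[OF that(1)] that(4) by auto
      then show ?thesis using D(6)[of "Suc j mod ?n" i] Suc_mod_neq[OF D(1) that(1)] i(1) by blast
    qed
    from X(3)[OF i(2)] obtain e f where ef: "e \<in> arcs H" "f \<in> arcs H" "e \<noteq> f"
      "tail H e \<in> X" "head H e \<in> X" "tail H f \<in> X" "head H f \<in> X"
      "tail H e = ?v i \<or> head H e = ?v i" "tail H f = ?v i \<or> head H f = ?v i"
      unfolding two_arcs_def by blast
    obtain k where k: "k < ?n" "e = ?e k" using D(5)[OF ef(1)] by blast
    obtain l where l: "l < ?n" "f = ?e l" using D(5)[OF ef(2)] by blast
    have "Suc k mod ?n = Suc l mod ?n" using j[of k] j[of l] k l ef by simp
    then have "k = l" using k(1) l(1) by (rule Suc_mod_inject[rotated 2])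
    then show False using ef(3) k l by simp
  qed
  obtain i where i: "i < ?n" "?v i \<in> X" using X(1,2) D(4) by blast
  have "?v j \<in> X" if "j < ?n" for j
    using i nxt that by (rule cyclic_induct[where P = "\<lambda>j. ?v j \<in> X"])
  then have "verts H \<subseteq> X" using D(4) by blast
  then show ?thesis using X(2) by blast
qed

text \<open>A form of non-orientedness that mentions no turn. With distinct heads, a step along its
  arrow can only be followed by another such step, so a single one spreads over the whole
  turn.\<close>

lemma nonoriented_not_inj_head:
  assumes "nonoriented_cycle H"
  shows "\<not> inj_on (head H) (arcs H)"
proof
  assume inj: "inj_on (head H) (arcs H)"
  from assms obtain p v e v' e' where p: "cycle_turn H p" and
    ve: "(v, e) \<in> set p" "tail H e = v" and ve': "(v', e') \<in> set p" "head H e' = v'"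
    unfolding nonoriented_cycle_def by blast
  note D = cycle_turnD[OF p]
  let ?n = "length p" and ?v = "\<lambda>i. fst (p ! i)" and ?e = "\<lambda>i. snd (p ! i)"
  have ne: "?v (Suc i mod ?n) \<noteq> ?v i" "?e (Suc i mod ?n) \<noteq> ?e i" "Suc i mod ?n < ?n" if "i < ?n" for i
    using D(6,7)[OF _ that, of "Suc i mod ?n"] Suc_mod_neq[OF D(1) that] by auto
  have step: "tail H (?e (Suc i mod ?n)) = ?v (Suc i mod ?n)" if i: "i < ?n" "tail H (?e i) = ?v i" for i
  proof (rule ccontr)
    assume "tail H (?e (Suc i mod ?n)) \<noteq> ?v (Suc i mod ?n)"
    then have "head H (?e (Suc i mod ?n)) = ?v (Suc i mod ?n)" using D(8)[OF ne(3)[OF i(1)]] by auto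
    moreover have "head H (?e i) = ?v (Suc i mod ?n)"
      using D(8)[OF i(1)] i(2) ne(1)[OF i(1)] by auto
    ultimately have "?e (Suc i mod ?n) = ?e i"
      using D(3)[OF i(1)] D(3)[OF ne(3)[OF i(1)]] by (intro inj_onD[OF inj]) simp_all
    then show False using ne(2) i(1) by blast
  qed
  obtain i where i: "i < ?n" "p ! i = (v, e)" using ve(1) by (meson in_set_conv_nth)
  obtain j where j: "j < ?n" "p ! j = (v', e')" using ve'(1) by (meson in_set_conv_nth)
  have "tail H (?e i) = ?v i" using i ve(2) by simp
  from i(1) this step j(1) have "tail H (?e j) = ?v j"
    by (rule cyclic_induct[where P = "\<lambda>j. tail H (?e j) = ?v j"])
  moreover have "head H (?e j) = ?v j" using j(2) ve'(2) by simp
  ultimately show False using D(8)[OF j(1)] ne(1)[OF j(1)] by auto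
qed

text \<open>The definition provides some turn with steps of both kinds, whereas a realization brings
  a turn of its own. If all steps of the latter were of one kind, the arrows would end at distinct
  vertices.\<close>

lemma nonoriented_cycle_turn:
  assumes "nonoriented_cycle H" "cycle_turn H p"
  shows "\<exists>i<length p. tail H (snd (p ! i)) = fst (p ! i)" "\<exists>i<length p. head H (snd (p ! i)) = fst (p ! i)"
proof -
  note D = cycle_turnD[OF assms(2)]
  let ?n = "length p" and ?v = "\<lambda>i. fst (p ! i)" and ?e = "\<lambda>i. snd (p ! i)"
  \<comment> \<open>\<open>f i\<close> is the position of the head of the \<open>i\<close>-th arrow:
    \<open>i\<close> itself if all steps run against their arrows, the next position if all run
    along them.\<close>
  have inj: "inj_on (head H) (arcs H)" if "\<And>i. i < ?n \<Longrightarrow> head H (?e i) = ?v (f i)"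
    "\<And>i. i < ?n \<Longrightarrow> f i < ?n" "\<And>i j. i < ?n \<Longrightarrow> j < ?n \<Longrightarrow> f i = f j \<Longrightarrow> i = j" for f
  proof (rule inj_onI)
    fix e e' assume "e \<in> arcs H" "e' \<in> arcs H" and eq: "head H e = head H e'"
    then obtain i j where ij: "i < ?n" "e = ?e i" "j < ?n" "e' = ?e j" using D(5) by blast
    then have "f i = f j" using eq that(1,2) D(6)[of "f i" "f j"] by simp
    then have "i = j" using that(3) ij by blast
    then show "e = e'" using ij by simp
  qed
  show "\<exists>i<?n. tail H (?e i) = ?v i"
  proof (rule ccontr)
    assume no: "\<not> ?thesis"
    have "inj_on (head H) (arcs H)" by (rule inj[of "\<lambda>i. i"]) (use D(8) no in blast)+
    then show False using nonoriented_not_inj_head[OF assms(1)] by blast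
  qed
  show "\<exists>i<?n. head H (?e i) = ?v i"
  proof (rule ccontr)
    assume no: "\<not> ?thesis"
    have "inj_on (head H) (arcs H)"
    proof (rule inj[of "\<lambda>i. Suc i mod ?n"])
      show "head H (?e i) = ?v (Suc i mod ?n)" if "i < ?n" for i using D(8)[OF that] no that by blast
    qed (use Suc_mod_inject Suc_mod_neq[OF D(1)] in blast)+
    then show False using nonoriented_not_inj_head[OF assms(1)] by blast
  qed
qed

lemma two_arcs_mono: "two_arcs T H E S x \<Longrightarrow> E \<subseteq> E' \<Longrightarrow> S \<subseteq> S' \<Longrightarrow> two_arcs T H E' S' x"
  unfolding two_arcs_def by blast

lemma two_arcs_induced:
  "two_arcs (tail G) (head G) (arcs G) S x \<longleftrightarrow> two_arcs (tail G) (head G) (arcs (G \<restriction> S)) S x"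
  unfolding two_arcs_def by auto

text \<open>The three vertices of \<open>C\<close> have degree two among themselves, so they exhaust
  \<open>S\<close>. A cycle has as many arrows as vertices, so \<open>S\<close> carries just the
  oriented triangle, whose heads are distinct.\<close>

lemma no_triangle_in_nonoriented:
  assumes "nonoriented_cycle (G \<restriction> S)" "C \<in> triangles (tail G) (head G) (arcs G)" "tail G ` C \<subseteq> S"
    "\<And>e. e \<in> arcs G \<Longrightarrow> tail G e \<noteq> head G e"
  shows False
proof -
  from assms(2) obtain a b c where C: "C = {a, b, c}" "{a, b, c} \<subseteq> arcs G"
    "head G a = tail G b" "head G b = tail G c" "head G c = tail G a" unfolding triangles_def by blast
  have ne: "tail G a \<noteq> tail G b" "tail G b \<noteq> tail G c" "tail G c \<noteq> tail G a"
    using assms(4)[of a] assms(4)[of b] assms(4)[of c] C by auto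
  let ?X = "{tail G a, tail G b, tail G c}"
  obtain p where p: "cycle_turn (G \<restriction> S) p" using assms(1) unfolding nonoriented_cycle_def by blast
  have sub: "?X \<subseteq> S" using assms(3) C(1) by auto
  have abc: "a \<in> arcs (G \<restriction> S)" "b \<in> arcs (G \<restriction> S)" "c \<in> arcs (G \<restriction> S)" using C sub by auto
  have "two_arcs (tail G) (head G) (arcs (G \<restriction> S)) ?X x" if "x \<in> ?X" for x
  proof -
    have "a \<noteq> b" "b \<noteq> c" "c \<noteq> a" using ne by auto
    from that consider "x = tail G a" | "x = tail G b" | "x = tail G c" by auto
    then show ?thesis
    proof cases
      case 1
      then show ?thesis unfolding two_arcs_def using abc C(3-) \<open>c \<noteq> a\<close> by (intro bexI[of _ c] bexI[of _ a]) auto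
    next
      case 2
      then show ?thesis unfolding two_arcs_def using abc C(3-) \<open>a \<noteq> b\<close> by (intro bexI[of _ a] bexI[of _ b]) auto
    next
      case 3
      then show ?thesis unfolding two_arcs_def using abc C(3-) \<open>b \<noteq> c\<close> by (intro bexI[of _ b] bexI[of _ c]) auto
    qed
  qed
  then have X: "?X = S" using cycle_turn_two_arcs_subset[OF p, of ?X] sub by auto
  have "card (arcs (G \<restriction> S)) = length p" "card S = length p"
    using p unfolding cycle_turn_def by (metis distinct_card length_map induce_subgraph_verts)+
  then have "card (arcs (G \<restriction> S)) = 3" using X ne by (auto simp: card_insert_if)
  moreover have "card {a, b, c} = 3" using ne by (auto simp: card_insert_if)
  moreover have "finite (arcs (G \<restriction> S))" using \<open>card (arcs (G \<restriction> S)) = 3\<close> by (metis card.infinite zero_neq_numeral)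
  ultimately have "arcs (G \<restriction> S) = {a, b, c}" using abc by (metis card_subset_eq empty_subsetI insert_subset)
  then have "inj_on (head (G \<restriction> S)) (arcs (G \<restriction> S))" using C(3-) ne by (auto simp: inj_on_def)
  then show False using nonoriented_not_inj_head[OF assms(1)] by blast
qed

section \<open>Quivers cut along a turn of their non-oriented cycle\<close>

type_synonym word = "(bool \<times> rtree option) list"

definition step_code :: "('b \<Rightarrow> 'a) \<Rightarrow> ('b \<Rightarrow> 'a) \<Rightarrow> 'a \<Rightarrow> 'b \<Rightarrow> 'a \<Rightarrow> 'a option \<Rightarrow> 'a set \<Rightarrow> 'b set \<Rightarrow>
    bool \<times> rtree option \<Rightarrow> bool" where
  "step_code T H x e y z V E l \<longleftrightarrow>
    (if fst l then T e = x \<and> H e = y else T e = y \<and> H e = x) \<and>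
    (case snd l of None \<Rightarrow> z = None \<and> V = {} \<and> E = {}
     | Some t \<Rightarrow> \<exists>v a b F. z = Some v \<and> T a = H e \<and> H a = v \<and> T b = v \<and> H b = T e \<and>
         E = {a, b} \<union> F \<and> rooted_code T H V F v t)"

text \<open>
  The quiver \<open>G\<close> is cut along the turn \<open>p\<close>: the \<open>i\<close>-th letter of \<open>w\<close> records whether the \<open>i\<close>-th base
  arrow runs along \<open>p\<close> and which rooted quiver, with vertices \<open>D i\<close>, is attached to it; \<open>A i\<close> also
  contains the two arrows that attach it.
\<close>

locale decomposed =
  fixes G :: "('a, 'b) pre_digraph" and z :: "'b \<Rightarrow> 'a option" and p :: "('a \<times> 'b) list"
    and D :: "nat \<Rightarrow> 'a set" and A :: "nat \<Rightarrow> 'b set" and w :: word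
  assumes length_w: "length w = length p"
    and length_p: "2 \<le> length p"
    and distinct_verts: "distinct (map fst p)"
    and distinct_arcs: "distinct (map snd p)"
    and code: "\<And>i. i < length p \<Longrightarrow> step_code (tail G) (head G) (fst (p ! i)) (snd (p ! i))
      (fst (p ! (Suc i mod length p))) (z (snd (p ! i))) (D i) (A i) (w ! i)"
    and D_base: "\<And>i. i < length p \<Longrightarrow> D i \<inter> set (map fst p) = {}"
    and D_disjoint: "\<And>i j. i < length p \<Longrightarrow> j < length p \<Longrightarrow> i \<noteq> j \<Longrightarrow> D i \<inter> D j = {}"
    and verts_eq: "verts G = set (map fst p) \<union> (\<Union>i<length p. D i)"
    and arcs_eq: "arcs G = set (map snd p) \<union> (\<Union>i<length p. A i)"
    and dom_z: "dom z \<subseteq> set (map snd p)"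
    and along: "\<exists>l\<in>set w. fst l" and against: "\<exists>l\<in>set w. \<not> fst l"
begin

abbreviation "n \<equiv> length p"
abbreviation "v i \<equiv> fst (p ! i)"
abbreviation "e i \<equiv> snd (p ! i)"
abbreviation "B \<equiv> set (map fst p)"
abbreviation "nxt i \<equiv> Suc i mod n"
abbreviation "T \<equiv> tail G"
abbreviation "H \<equiv> head G"

lemma nxt: "i < n \<Longrightarrow> nxt i < n" "i < n \<Longrightarrow> nxt i \<noteq> i"
  using Suc_mod_neq[OF length_p] by auto

lemma v_inject: "i < n \<Longrightarrow> j < n \<Longrightarrow> v i = v j \<Longrightarrow> i = j"
  using nth_eq_iff_index_eq[OF distinct_verts, of i j] by simp

lemma e_inject: "i < n \<Longrightarrow> j < n \<Longrightarrow> e i = e j \<Longrightarrow> i = j"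
  using nth_eq_iff_index_eq[OF distinct_arcs, of i j] by simp

lemma v_B: "i < n \<Longrightarrow> v i \<in> B"
  by simp

lemma B_E: "x \<in> B \<Longrightarrow> (\<And>i. i < n \<Longrightarrow> x = v i \<Longrightarrow> thesis) \<Longrightarrow> thesis"
  by (auto simp: in_set_conv_nth)

lemma v_D: "i < n \<Longrightarrow> j < n \<Longrightarrow> v i \<notin> D j"
  using D_base[of j] v_B[of i] by blast

lemma e_ends: "i < n \<Longrightarrow> (if fst (w ! i) then T (e i) = v i \<and> H (e i) = v (nxt i)
    else T (e i) = v (nxt i) \<and> H (e i) = v i)"
  using code[of i] unfolding step_code_def by blast

lemma e_ends': "i < n \<Longrightarrow> T (e i) \<in> B \<and> H (e i) \<in> B \<and> T (e i) \<noteq> H (e i)"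
  using e_ends[of i] nxt[of i] v_inject[of "nxt i" i] by (auto split: if_splits)

lemma no_attachment: "i < n \<Longrightarrow> snd (w ! i) = None \<Longrightarrow> z (e i) = None \<and> D i = {} \<and> A i = {}"
  using code[of i] unfolding step_code_def by simp

definition is_attached where
  "is_attached i r a b F t \<longleftrightarrow> i < n \<and> snd (w ! i) = Some t \<and> z (e i) = Some r \<and>
    T a = H (e i) \<and> H a = r \<and> T b = r \<and> H b = T (e i) \<and> A i = {a, b} \<union> F \<and> rooted_code T H (D i) F r t"

lemma attachment_obtain:
  assumes "i < n" "snd (w ! i) = Some t"
  obtains r a b F where "is_attached i r a b F t"
  using code[of i] assms unfolding step_code_def is_attached_def by auto

lemma attachedD:
  assumes "is_attached i r a b F t"
  shows "i < n" "snd (w ! i) = Some t" "z (e i) = Some r" "T a = H (e i)" "H a = r" "T b = r"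
    "H b = T (e i)" "A i = {a, b} \<union> F" "rooted_code T H (D i) F r t"
    "r \<in> D i" "r \<notin> B" "\<And>x. x \<in> F \<Longrightarrow> T x \<in> D i \<and> H x \<in> D i" "T a \<in> B" "H b \<in> B" "D i \<inter> B = {}"
    "a \<noteq> b" "a \<notin> F" "b \<notin> F"
proof -
  show *: "i < n" "snd (w ! i) = Some t" "z (e i) = Some r" "T a = H (e i)" "H a = r" "T b = r"
    "H b = T (e i)" "A i = {a, b} \<union> F" "rooted_code T H (D i) F r t"
    using assms unfolding is_attached_def by simp_all
  show r: "r \<in> D i" by (rule rooted_code_root[OF *(9)])
  show DB: "D i \<inter> B = {}" by (rule D_base[OF *(1)])
  then show rB: "r \<notin> B" using r by blast
  show F: "T x \<in> D i \<and> H x \<in> D i" if "x \<in> F" for x using rooted_code_ends[OF *(9) that] by blast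
  show TB: "T a \<in> B" and HB: "H b \<in> B" unfolding *(4,7) using e_ends'[OF *(1)] by blast+
  show "a \<noteq> b" using TB rB *(6) by auto
  show "a \<notin> F" "b \<notin> F" using F TB HB DB by blast+
qed

lemma A_cases:
  assumes "i < n" "x \<in> A i"
  obtains r a b F t where "is_attached i r a b F t" "x \<in> {a, b} \<union> F"
proof (cases "snd (w ! i)")
  case None
  then show ?thesis using assms no_attachment by auto
next
  case (Some t)
  then obtain r a b F where "is_attached i r a b F t" using attachment_obtain[OF assms(1)] by blast
  then show ?thesis using that assms(2) attachedD(8) by metis
qed

lemma A_ends:
  assumes "i < n" "x \<in> A i"
  shows "T x \<in> D i \<union> B" "H x \<in> D i \<union> B" "T x \<in> D i \<or> H x \<in> D i" 
proof -
  from assms obtain r a b F t where *: "is_attached i r a b F t" "x \<in> {a, b} \<union> F" by (rule A_cases)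
  note D = attachedD[OF *(1)]
  have "T a \<in> D i \<union> B" "H a \<in> D i" "T b \<in> D i" "H b \<in> D i \<union> B"
    unfolding D(5,6) using D(10,13,14) by blast+
  with *(2) D(12) show "T x \<in> D i \<union> B" "H x \<in> D i \<union> B" "T x \<in> D i \<or> H x \<in> D i" by blast+
qed

lemma arc_cases:
  assumes "x \<in> arcs G"
  obtains i where "i < n" "x = e i" | i where "i < n" "x \<in> A i"
  using assms unfolding arcs_eq by (auto simp: in_set_conv_nth)

lemma e_in_arcs: "i < n \<Longrightarrow> e i \<in> arcs G"
  unfolding arcs_eq by simp

lemma A_in_arcs: "i < n \<Longrightarrow> x \<in> A i \<Longrightarrow> x \<in> arcs G"
  unfolding arcs_eq by auto

lemma arc_meets_D:
  assumes "x \<in> arcs G" "i < n" "T x \<in> D i \<or> H x \<in> D i"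
  shows "x \<in> A i"
  using assms(1)
proof (cases rule: arc_cases)
  case (1 j)
  then show ?thesis using e_ends'[OF 1(1)] D_base[OF assms(2)] assms(3) by blast
next
  case (2 j)
  then have "j = i"
    using A_ends[OF 2] D_disjoint[OF 2(1) assms(2)] D_base[OF assms(2)] assms(3) by blast
  then show ?thesis using 2 by simp
qed

lemma arc_in_B:
  assumes "x \<in> arcs G" "T x \<in> B" "H x \<in> B"
  obtains i where "i < n" "x = e i"
  using assms(1)
proof (cases rule: arc_cases)
  case (2 j)
  then show ?thesis using A_ends(3)[OF 2] D_base[OF 2(1)] assms(2,3) by blast
qed (rule that)

lemma wf: "wf_digraph G"
proof
  fix x assume "x \<in> arcs G"
  then show "T x \<in> verts G" "H x \<in> verts G"
    by (cases rule: arc_cases; use e_ends' A_ends verts_eq in blast)+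
qed

lemma finite_D: "i < n \<Longrightarrow> finite (D i)" and finite_A: "i < n \<Longrightarrow> finite (A i)"
proof -
  assume i: "i < n"
  have "finite (D i) \<and> finite (A i)"
  proof (cases "snd (w ! i)")
    case None
    then show ?thesis using no_attachment i by simp
  next
    case (Some t)
    obtain r a b F where *: "is_attached i r a b F t" by (rule attachment_obtain[OF i Some])
    show ?thesis using rooted_code_finite[OF attachedD(9)[OF *]] attachedD(8)[OF *] by simp
  qed
  then show "finite (D i)" "finite (A i)" by auto
qed

lemma fin: "fin_digraph G"
proof -
  interpret wf_digraph G by (rule wf)
  show ?thesis by (rule fin_digraphI) (use finite_D finite_A in \<open>auto simp: verts_eq arcs_eq\<close>)
qed

lemma no_loop:
  assumes "x \<in> arcs G"
  shows "T x \<noteq> H x"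
  using assms
proof (cases rule: arc_cases)
  case (2 i)
  from 2 obtain r a b F t where *: "is_attached i r a b F t" "x \<in> {a, b} \<union> F" by (rule A_cases)
  note D = attachedD[OF *(1)]
  have "T a \<noteq> H a" "T b \<noteq> H b" using D(5,6,11,13,14) by metis+
  then show ?thesis using *(2) rooted_code_no_loop[OF D(9), of x] by blast
qed (use e_ends' in auto)

lemma no_2cycle:
  assumes "x \<in> arcs G" "y \<in> arcs G" "T x = H y" "H x = T y"
  shows False
  using assms(1)
proof (cases rule: arc_cases)
  case (1 i)
  have "T y \<in> B" "H y \<in> B" using e_ends'[OF 1(1)] assms(3,4) unfolding 1(2) by auto
  with assms(2) obtain j where j: "j < n" "y = e j" by (rule arc_in_B)
  have "i \<noteq> j" using no_loop[OF assms(1)] assms(3) 1 j by auto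
  note inj = v_inject[OF 1(1) j(1)] v_inject[OF nxt(1)[OF 1(1)] j(1)] v_inject[OF 1(1) nxt(1)[OF j(1)]]
  \<comment> \<open>Two antiparallel base arrows close a turn of length two whose letters have the
    same direction, which \<open>along\<close> and \<open>against\<close> exclude.\<close>
  have "nxt i = j \<and> nxt j = i \<and> fst (w ! i) = fst (w ! j)"
    using e_ends[OF 1(1)] e_ends[OF j(1)] assms(3,4) \<open>i \<noteq> j\<close> inj unfolding 1(2) j(2)
    by (auto split: if_splits)
  then have ij: "nxt i = j" "nxt j = i" "fst (w ! i) = fst (w ! j)" by auto
  have "fst (w ! k) = fst (w ! i)" if "k < n" for k
  proof -
    have "k = i \<or> k = j"
    proof (rule cyclic_induct[where P = "\<lambda>k. k = i \<or> k = j"])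
      show "i < n" by fact
      show "k < n" by fact
    qed (use ij in auto)
    then show ?thesis using ij(3) by auto
  qed
  then show False using along against unfolding in_set_conv_nth Bex_def length_w by metis
next
  case (2 i)
  from 2 obtain r a b F t where *: "is_attached i r a b F t" "x \<in> {a, b} \<union> F" by (rule A_cases)
  note D = attachedD[OF *(1)]
  have "T x \<in> D i \<or> H x \<in> D i" by (rule A_ends(3)[OF 2])
  then have y: "y \<in> {a, b} \<union> F" using arc_meets_D[OF assms(2) D(1)] assms(3,4) D(8) by auto
  have "H (e i) \<noteq> T (e i)" using e_ends'[OF D(1)] by auto
  \<comment> \<open>Within the \<open>i\<close>-th piece, \<open>a\<close> is the only arrow
    starting on the base and \<open>b\<close> the only one ending there. An antiparallel pair
    therefore consists of \<open>a\<close> and \<open>b\<close> or lies in \<open>F\<close>.\<close>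
  have into_B: "(T u \<in> B \<longleftrightarrow> u = a) \<and> (H u \<in> B \<longleftrightarrow> u = b)" if u: "u \<in> {a, b} \<union> F" for u
  proof -
    consider "u = a" | "u = b" | "u \<in> F" using u by blast
    then show ?thesis
    proof cases
      case 1
      then show ?thesis using D(5,11,13,16) by simp
    next
      case 2
      then show ?thesis using D(6,11,14,16) by auto
    next
      case 3
      then show ?thesis using D(12)[OF 3] D(15,17,18) by blast
    qed
  qed
  note B = into_B[OF *(2), THEN conjunct1] into_B[OF *(2), THEN conjunct2]
    into_B[OF y, THEN conjunct1] into_B[OF y, THEN conjunct2]
  consider "x = a" | "x = b" | "x \<in> F" using *(2) by blast
  then show False
  proof cases
    case 1
    then have "y = b" using B(1,4) assms(3) by simp
    then show False using 1 assms(3) D(4,7) \<open>H (e i) \<noteq> T (e i)\<close> by simp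
  next
    case 2
    then have "y = a" using B(2,3) assms(4) by simp
    then show False using 2 assms(4) D(4,7) \<open>H (e i) \<noteq> T (e i)\<close> by simp
  next
    case 3
    then have "y \<in> F" using y B D(17,18) assms(3,4) by auto
    with 3 show False using rooted_code_no_2cycle[OF D(9)] assms(3,4) by metis
  qed
qed

lemma verts_subset_closed:
  assumes "arc_closed G S" "v 0 \<in> S"
  shows "verts G \<subseteq> S"
proof -
  have cl: "T x \<in> S \<longleftrightarrow> H x \<in> S" if "x \<in> arcs G" for x using assms(1) that unfolding arc_closed_def by blast
  have v: "v i \<in> S" if "i < n" for i
  proof (rule cyclic_induct[where P = "\<lambda>i. v i \<in> S"])
    show "0 < n" using length_p by linarith
    show "v (nxt k) \<in> S" if "k < n" "v k \<in> S" for k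
      using e_ends[OF that(1)] cl[OF e_in_arcs[OF that(1)]] that(2) by (auto split: if_splits)
  qed (use assms(2) that in auto)
  have "D i \<subseteq> S" if i: "i < n" for i
  proof (cases "snd (w ! i)")
    case None
    then show ?thesis using no_attachment[OF i] by simp
  next
    case (Some t)
    obtain r a b F where *: "is_attached i r a b F t" by (rule attachment_obtain[OF i Some])
    note D = attachedD[OF *]
    have "a \<in> arcs G" "F \<subseteq> arcs G" using A_in_arcs[OF i] D(8) by auto
    obtain j where "j < n" "T a = v j" using D(13) by (rule B_E)
    then have "H (e i) \<in> S" using v D(4) by simp
    then have "r \<in> S" using cl[OF \<open>a \<in> arcs G\<close>] D(4,5) by simp
    then show ?thesis by (rule rooted_code_connected[OF D(9)]) (use cl \<open>F \<subseteq> arcs G\<close> in blast)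
  qed
  moreover have "B \<subseteq> S"
  proof
    fix x assume "x \<in> B"
    then obtain i where "i < n" "x = v i" by (rule B_E)
    then show "x \<in> S" using v by simp
  qed
  ultimately show ?thesis unfolding verts_eq by blast
qed

lemma connected: "Digraph_Component.connected G"
proof -
  have "sym_reachable G x y" if "x \<in> verts G" "y \<in> verts G" for x y
  proof -
    let ?S = "{y. sym_reachable G x y}"
    have cl: "arc_closed G ?S" by (rule arc_closed_sym_reachable[OF wf])
    \<comment> \<open>If the complement, which is closed too, contained \<open>v 0\<close>, it would
      contain all vertices, among them \<open>x\<close>.\<close>
    then have "arc_closed G (- ?S)" unfolding arc_closed_def by auto
    moreover have "x \<in> ?S" using that(1) by (simp add: sym_reachable_eq)
    ultimately have "v 0 \<in> ?S" using verts_subset_closed[of "- ?S"] that(1) by blast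
    then show ?thesis using verts_subset_closed[OF cl] that(2) by blast
  qed
  moreover have "0 < n" using length_p by linarith
  then have "v 0 \<in> verts G" unfolding verts_eq using v_B[of 0] by blast
  ultimately show ?thesis unfolding connected_def strongly_connected_def by auto
qed

lemma is_quiver: "is_quiver G"
proof -
  have "loopfree_digraph G"
    by (intro loopfree_digraph.intro wf loopfree_digraph_axioms.intro no_loop)
  then show ?thesis unfolding is_quiver_def using fin connected no_2cycle by metis
qed

lemma arcs_base: "arcs (G \<restriction> B) = set (map snd p)"
proof
  show "arcs (G \<restriction> B) \<subseteq> set (map snd p)"
  proof
    fix x assume "x \<in> arcs (G \<restriction> B)"
    then have "x \<in> arcs G" "T x \<in> B" "H x \<in> B" by simp_all
    then obtain i where "i < n" "x = e i" by (rule arc_in_B)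
    then show "x \<in> set (map snd p)" by simp
  qed
  show "set (map snd p) \<subseteq> arcs (G \<restriction> B)"
  proof
    fix x assume "x \<in> set (map snd p)"
    then obtain i where i: "i < n" "x = e i" by (auto simp: in_set_conv_nth)
    show "x \<in> arcs (G \<restriction> B)" using e_in_arcs[OF i(1)] e_ends'[OF i(1)] unfolding i(2) by simp
  qed
qed

lemma turn: "cycle_turn (G \<restriction> B) p"
proof -
  have "(T (e i) = v i \<and> H (e i) = v (nxt i)) \<or> (T (e i) = v (nxt i) \<and> H (e i) = v i)" if "i < n" for i
    using e_ends[OF that] by (cases "fst (w ! i)") simp_all
  then show ?thesis
    unfolding cycle_turn_def arcs_base Let_def using length_p distinct_verts distinct_arcs by simp
qed

lemma nonoriented: "nonoriented_cycle (G \<restriction> B)"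
proof -
  obtain l where l: "l \<in> set w" "fst l" using along by blast
  then obtain i where i: "i < n" "fst (w ! i)" unfolding in_set_conv_nth length_w by metis
  obtain m where m: "m \<in> set w" "\<not> fst m" using against by blast
  then obtain j where j: "j < n" "\<not> fst (w ! j)" unfolding in_set_conv_nth length_w by metis
  have "T (e i) = v i" "H (e j) = v j" using e_ends[OF i(1)] e_ends[OF j(1)] i j by auto
  then have "\<exists>(x, y)\<in>set p. T y = x" "\<exists>(x, y)\<in>set p. H y = x"
    using i(1) j(1) by (auto simp: case_prod_beta intro: bexI[of _ "p ! i"] bexI[of _ "p ! j"])
  then show ?thesis unfolding nonoriented_cycle_def using turn by auto
qed

section \<open>Uniqueness of the base\<close>

text \<open>If \<open>S\<close> meets an attached quiver beyond its root, the descent for rooted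
  quivers applies. If it meets it in the root only, the two arrows at the root must be
  \<open>a\<close> and \<open>b\<close>, which brings the triangle over \<open>e i\<close> into
  \<open>S\<close>. Otherwise \<open>S\<close> lies on the base and has to be all of it.\<close>

lemma two_arcs_contains_cycle:
  assumes "S \<noteq> {}" "S \<subseteq> verts G" and two: "\<And>x. x \<in> S \<Longrightarrow> two_arcs T H (arcs G) S x"
  shows "(\<exists>C\<in>triangles T H (arcs G). T ` C \<subseteq> S) \<or> S = B"
proof (cases "\<exists>i<n. S \<inter> D i \<noteq> {}")
  case True
  then obtain i where i: "i < n" "S \<inter> D i \<noteq> {}" by blast
  then have "snd (w ! i) \<noteq> None" using no_attachment[OF i(1)] by auto
  then obtain t where t: "snd (w ! i) = Some t" by blast
  obtain r a b F where *: "is_attached i r a b F t" by (rule attachment_obtain[OF i(1) t])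
  note D = attachedD[OF *]
  have abF: "a \<in> arcs G" "b \<in> arcs G" "F \<subseteq> arcs G" using A_in_arcs[OF i(1)] D(8) by auto
  have meet: "x \<in> {a, b} \<union> F" if "x \<in> arcs G" "T x \<in> D i \<or> H x \<in> D i" for x
    using arc_meets_D[OF that(1) i(1) that(2)] D(8) by simp
  have sub: "two_arcs T H F S x" if x: "x \<in> S \<inter> D i" "x \<noteq> r" for x
  proof -
    obtain f g where fg: "f \<in> arcs G" "g \<in> arcs G" "f \<noteq> g" "T f \<in> S" "H f \<in> S" "T g \<in> S" "H g \<in> S"
      "T f = x \<or> H f = x" "T g = x \<or> H g = x" using two[of x] x(1) unfolding two_arcs_def by blast
    have "h \<in> F" if "h \<in> arcs G" "T h = x \<or> H h = x" for h
    proof -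
      have "h \<in> {a, b} \<union> F" using meet[OF that(1)] that(2) x(1) by blast
      moreover have "x \<notin> B" using x(1) D(15) by blast
      ultimately show ?thesis using that(2) x(2) D(5,6,13,14) by auto
    qed
    then show ?thesis unfolding two_arcs_def using fg by blast
  qed
  show ?thesis
  proof (cases "S \<inter> D i \<subseteq> {r}")
    case False
    then obtain C where "C \<in> triangles T H F" "T ` C \<subseteq> S"
      using rooted_code_two_arcs[OF D(9), of S] sub by blast
    then show ?thesis using triangles_mono[OF abF(3), of T H] by blast
  next
    case True
    then have r: "r \<in> S" using i(2) by blast
    obtain f g where fg: "f \<in> arcs G" "g \<in> arcs G" "f \<noteq> g" "T f \<in> S" "H f \<in> S" "T g \<in> S" "H g \<in> S"
      "T f = r \<or> H f = r" "T g = r \<or> H g = r" using two[OF r] unfolding two_arcs_def by blast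
    have F: "h \<notin> F" if "T h \<in> S" "H h \<in> S" for h
      using D(12)[of h] True that rooted_code_no_loop[OF D(9), of h] by blast
    have "f \<in> {a, b}" using meet[of f] fg D(10) F[of f] by auto
    moreover have "g \<in> {a, b}" using meet[of g] fg D(10) F[of g] by auto
    ultimately have "T (e i) \<in> S" "H (e i) \<in> S" using fg(3-7) D(4,7) by auto
    moreover have "{e i, a, b} \<in> triangles T H (arcs G)"
      using D abF e_in_arcs[OF i(1)] by (intro trianglesI) auto
    ultimately show ?thesis using r D(4,6) by (intro disjI1 bexI[of _ "{e i, a, b}"]) auto
  qed
next
  case False
  then have "S \<subseteq> B" using assms(2) unfolding verts_eq by blast
  have "two_arcs T H (arcs (G \<restriction> B)) S x" if "x \<in> S" for x
    using two[OF that, unfolded two_arcs_induced] by (rule two_arcs_mono) (use \<open>S \<subseteq> B\<close> in auto)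
  then have "S = verts (G \<restriction> B)"
    using cycle_turn_two_arcs_subset[OF turn, of S] assms(1) \<open>S \<subseteq> B\<close> by simp
  then show ?thesis by simp
qed

lemma base_unique:
  assumes "S \<subseteq> verts G" "nonoriented_cycle (G \<restriction> S)"
  shows "S = B"
proof -
  obtain q where q: "cycle_turn (G \<restriction> S) q" using assms(2) unfolding nonoriented_cycle_def by blast
  have "S \<noteq> {}" using cycle_turnD(1)[OF q] cycle_turnD(2)[OF q, of 0] by (cases q) auto
  moreover have "two_arcs T H (arcs G) S x" if "x \<in> S" for x
    using cycle_turn_two_arcs[OF q, of x] that two_arcs_induced[of G S x] by simp
  ultimately show ?thesis
    using two_arcs_contains_cycle[of S] assms no_triangle_in_nonoriented[OF assms(2) _ _ no_loop] by blast
qed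

lemma base_verts_eq: "base_verts G = B"
  unfolding base_verts_def
  by (rule the_equality) (use nonoriented base_unique in \<open>auto simp: verts_eq\<close>)

lemma base_arcs_eq: "base_arcs G = set (map snd p)"
  unfolding base_arcs_def base_verts_eq by (rule arcs_base)

text \<open>No arrow off the base enters or leaves \<open>D i\<close>, which bounds the component
  from above; the rooted quiver on \<open>D i\<close> is connected, which bounds it from
  below.\<close>

lemma attached_verts_eq:
  assumes "is_attached i r a b F t"
  shows "attached_verts G r = D i" "arcs (G \<restriction> D i) = F"
proof -
  note D = attachedD[OF assms]
  have abF: "F \<subseteq> arcs G" using A_in_arcs[OF D(1)] D(8) by auto
  have inD: "x \<in> F" if "x \<in> arcs G" "T x \<in> D i \<or> H x \<in> D i" "T x \<notin> B" "H x \<notin> B" for x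
    using arc_meets_D[OF that(1) D(1) that(2)] that(3,4) D(8,13,14) by auto
  show "arcs (G \<restriction> D i) = F" using inD D(12,15) abF by auto
  let ?G = "G \<restriction> (verts G - B)"
  interpret wf_digraph G by (rule wf)
  have wf': "wf_digraph ?G" by blast
  have "arc_closed ?G (D i)"
    unfolding arc_closed_def
  proof
    fix x assume "x \<in> arcs ?G"
    then have "x \<in> arcs G" "T x \<notin> B" "H x \<notin> B" by simp_all
    then have "T x \<in> D i \<longleftrightarrow> H x \<in> D i" using inD[of x] D(12)[of x] by blast
    then show "tail ?G x \<in> D i \<longleftrightarrow> head ?G x \<in> D i" by simp
  qed
  moreover have "r \<in> verts ?G" using D(1,10,11) verts_eq by auto
  ultimately have "{x. sym_reachable ?G r x} \<subseteq> D i"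
    using sym_reachable_arc_closed[of ?G r _ "D i"] D(10) by blast
  moreover have "D i \<subseteq> {x. sym_reachable ?G r x}"
  proof (rule rooted_code_connected[OF D(9)])
    show "r \<in> {x. sym_reachable ?G r x}" using \<open>r \<in> verts ?G\<close> by (simp add: sym_reachable_eq)
    fix x assume "x \<in> F"
    moreover from this have "T x \<in> verts G - B" "H x \<in> verts G - B"
      using D(1,12,15) verts_eq by blast+
    ultimately have "x \<in> arcs ?G" using abF by auto
    then show "T x \<in> {x. sym_reachable ?G r x} \<longleftrightarrow> H x \<in> {x. sym_reachable ?G r x}"
      using arc_closed_sym_reachable[OF wf', of r] unfolding arc_closed_def by simp
  qed
  ultimately show "attached_verts G r = D i" unfolding attached_verts_def base_verts_eq by blast
qed

lemma z_Some_obtain: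
  assumes "z \<alpha> = Some r"
  obtains i a b F t where "\<alpha> = e i" "is_attached i r a b F t"
proof -
  have "\<alpha> \<in> set (map snd p)" using assms dom_z by blast
  then obtain i where i: "i < n" "\<alpha> = e i" by (auto simp: in_set_conv_nth)
  then have "snd (w ! i) \<noteq> None" using no_attachment[OF i(1)] assms by auto
  then obtain t where t: "snd (w ! i) = Some t" by blast
  obtain r' a b F where *: "is_attached i r' a b F t" by (rule attachment_obtain[OF i(1) t])
  then have "r' = r" using attachedD(3)[OF *] assms i by simp
  then show ?thesis using that[OF i(2)] * by simp
qed

lemma attachment: "attachment G z"
proof -
  have unique: "(\<exists>!x. x \<in> arcs G \<and> T x = H \<alpha> \<and> H x = r) \<and> (\<exists>!x. x \<in> arcs G \<and> T x = r \<and> H x = T \<alpha>)"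
    if "z \<alpha> = Some r" for \<alpha> r
  proof -
    from that obtain i a b F t where i: "\<alpha> = e i" "is_attached i r a b F t" by (rule z_Some_obtain)
    note D = attachedD[OF i(2)]
    have abF: "a \<in> arcs G" "b \<in> arcs G" using A_in_arcs[OF D(1)] D(8) by auto
    have meet: "x \<in> {a, b} \<union> F" if "x \<in> arcs G" "T x = r \<or> H x = r" for x
      using arc_meets_D[OF that(1) D(1)] that(2) D(8,10) by auto
    have ends: "T \<alpha> \<in> B" "H \<alpha> \<in> B" using e_ends'[OF D(1)] i(1) by auto
    have "x = a" if "x \<in> arcs G" "T x = H \<alpha>" "H x = r" for x
    proof -
      have "x \<noteq> b" using that(2) ends(2) D(6,11) by metis
      moreover have "x \<notin> F" using that(2) ends(2) D(12,15) by (metis IntI empty_iff)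
      ultimately show ?thesis using meet[OF that(1)] that(3) by blast
    qed
    moreover have "x = b" if "x \<in> arcs G" "T x = r" "H x = T \<alpha>" for x
    proof -
      have "x \<noteq> a" using that(3) ends(1) D(5,11) by metis
      moreover have "x \<notin> F" using that(3) ends(1) D(12,15) by (metis IntI empty_iff)
      ultimately show ?thesis using meet[OF that(1)] that(2) by blast
    qed
    ultimately show ?thesis using abF D(4-7) i(1) by blast
  qed
  have incident: "x \<in> base_arcs G \<or> (\<exists>\<alpha> r. z \<alpha> = Some r \<and>
      ((T x = H \<alpha> \<and> H x = r) \<or> (T x = r \<and> H x = T \<alpha>)))"
    if "x \<in> arcs G" "T x \<in> base_verts G \<or> H x \<in> base_verts G" for x
    using that(1)
  proof (cases rule: arc_cases)
    case (2 i)
    from 2 obtain r a b F t where *: "is_attached i r a b F t" "x \<in> {a, b} \<union> F" by (rule A_cases)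
    note D = attachedD[OF *(1)]
    have "x \<notin> F" using that(2) D(12,15) unfolding base_verts_eq by blast
    then show ?thesis using *(2) D(3-7) by blast
  qed (simp add: base_arcs_eq)
  have att: "\<exists>i r a b F t. is_attached i r a b F t \<and> x \<in> D i" if "x \<in> verts G - base_verts G" for x
  proof -
    from that obtain i where i: "i < n" "x \<in> D i" unfolding verts_eq base_verts_eq by blast
    then have "snd (w ! i) \<noteq> None" using no_attachment[OF i(1)] by auto
    then obtain t where t: "snd (w ! i) = Some t" by blast
    show ?thesis using attachment_obtain[OF i(1) t] i(2) by metis
  qed
  have verts: "verts G - base_verts G = (\<Union>r\<in>ran z. attached_verts G r)"
  proof
    show "verts G - base_verts G \<subseteq> (\<Union>r\<in>ran z. attached_verts G r)"
    proof
      fix x assume "x \<in> verts G - base_verts G"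
      then obtain i r a b F t where *: "is_attached i r a b F t" "x \<in> D i" using att by blast
      then show "x \<in> (\<Union>r\<in>ran z. attached_verts G r)"
        using attached_verts_eq(1)[OF *(1)] attachedD(3)[OF *(1)] by (auto simp: ran_def)
    qed
    show "(\<Union>r\<in>ran z. attached_verts G r) \<subseteq> verts G - base_verts G"
    proof
      fix x assume "x \<in> (\<Union>r\<in>ran z. attached_verts G r)"
      then obtain \<alpha> r where r: "z \<alpha> = Some r" "x \<in> attached_verts G r" by (auto simp: ran_def)
      from r(1) obtain i a b F t where i: "\<alpha> = e i" "is_attached i r a b F t" by (rule z_Some_obtain)
      have "x \<in> D i" using attached_verts_eq(1)[OF i(2)] r(2) by simp
      then show "x \<in> verts G - base_verts G"
        unfolding base_verts_eq using attachedD(1,15)[OF i(2)] verts_eq by blast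
    qed
  qed
  have disjoint: "attached_verts G r \<inter> attached_verts G s = {}"
    if "z \<alpha> = Some r" "z \<beta> = Some s" "\<alpha> \<noteq> \<beta>" for \<alpha> \<beta> r s
  proof -
    from that(1) obtain i a b F t where i: "\<alpha> = e i" "is_attached i r a b F t" by (rule z_Some_obtain)
    from that(2) obtain j a' b' F' t' where j: "\<beta> = e j" "is_attached j s a' b' F' t'" by (rule z_Some_obtain)
    have "i \<noteq> j" using that(3) i(1) j(1) by auto
    then show ?thesis
      unfolding attached_verts_eq(1)[OF i(2)] attached_verts_eq(1)[OF j(2)]
      using D_disjoint attachedD(1)[OF i(2)] attachedD(1)[OF j(2)] by blast
  qed
  have rooted: "rooted_type_A (G \<restriction> attached_verts G r) r" if "r \<in> ran z" for r
  proof -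
    from that obtain \<alpha> where "z \<alpha> = Some r" by (auto simp: ran_def)
    then obtain i a b F t where i: "\<alpha> = e i" "is_attached i r a b F t" by (rule z_Some_obtain)
    show ?thesis
      by (rule rooted_code_imp_type_A[OF attachedD(9)[OF i(2)]]) (use attached_verts_eq[OF i(2)] in simp_all)
  qed
  have dom: "dom z \<subseteq> base_arcs G" unfolding base_arcs_eq by (rule dom_z)
  have ran: "ran z \<subseteq> verts G - base_verts G"
  proof
    fix r assume "r \<in> ran z"
    then obtain \<alpha> where "z \<alpha> = Some r" by (auto simp: ran_def)
    then obtain i a b F t where i: "\<alpha> = e i" "is_attached i r a b F t" by (rule z_Some_obtain)
    then show "r \<in> verts G - base_verts G"
      unfolding base_verts_eq using attachedD(1,10,11)[OF i(2)] verts_eq by blast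
  qed
  show ?thesis
    unfolding attachment_def
    by (intro conjI, rule dom, rule ran, (use unique in blast), (use incident in blast),
        (rule verts), (use disjoint in blast), (use rooted in blast))
qed

end

section \<open>The parameters as sums over letters\<close>

text \<open>\<open>d = True\<close> selects the clockwise letters, which give the parameters
  \<open>s\<close>, and \<open>d = False\<close> the anti-clockwise ones, which give the parameters
  \<open>r\<close>.\<close>

definition dir_letters :: "bool \<Rightarrow> word \<Rightarrow> rtree option list" where
  "dir_letters d w = map snd (filter (\<lambda>l. fst l = d) w)"

definition word_narr :: "rtree option list \<Rightarrow> nat" where
  "word_narr w = sum_list (map opt_narr w)"

definition word_ntri :: "rtree option list \<Rightarrow> nat" where
  "word_ntri w = sum_list (map opt_ntri w)"

lemma sum_list_dir_letters:
  fixes f :: "rtree option \<Rightarrow> nat"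
  shows "sum_list (map f (dir_letters d w)) = (\<Sum>i | i < length w \<and> fst (w ! i) = d. f (snd (w ! i)))"
proof -
  have "sum_list (map f (dir_letters d w)) = sum_list (map (\<lambda>l. if fst l = d then f (snd l) else 0) w)"
    by (induction w) (auto simp: dir_letters_def)
  also have "\<dots> = (\<Sum>i\<in>{..<length w}. if fst (w ! i) = d then f (snd (w ! i)) else 0)"
    by (simp add: sum_list_sum_nth atLeast0LessThan)
  also have "\<dots> = (\<Sum>i | i \<in> {..<length w} \<and> fst (w ! i) = d. f (snd (w ! i)))"
    by (rule sum.inter_filter[symmetric]) simp
  finally show ?thesis by simp
qed

lemma three_cyclesE:
  fixes R :: "('a, 'b) realization"
  defines "G \<equiv> quiver R"
  assumes "C \<in> three_cycles R"
  obtains a b c where "C = {a, b, c}" "{a, b, c} \<subseteq> arcs G"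
    "head G a = tail G b" "head G b = tail G c" "head G c = tail G a"
    "\<forall>\<alpha>\<in>{a, b, c} \<inter> base_arcs G. \<exists>e\<in>{a, b, c}. apex R \<alpha> = Some (tail G e)"
proof -
  from assms(2) have "\<exists>a b c. C = {a, b, c} \<and> {a, b, c} \<subseteq> arcs G \<and>
      head G a = tail G b \<and> head G b = tail G c \<and> head G c = tail G a \<and>
      (\<forall>\<alpha>\<in>{a, b, c} \<inter> base_arcs G. \<exists>e\<in>{a, b, c}. apex R \<alpha> = Some (tail G e))"
    unfolding three_cycles_def Let_def mem_Collect_eq G_def .
  then show ?thesis by (elim exE conjE) (rule that; assumption)
qed

context decomposed
begin

lemma card_D:
  assumes "i < n"
  shows "Suc (card (D i)) = opt_narr (snd (w ! i)) + 2 * opt_ntri (snd (w ! i))"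
proof (cases "snd (w ! i)")
  case None
  then show ?thesis using no_attachment[OF assms] by simp
next
  case (Some t)
  obtain r a b F where *: "is_attached i r a b F t" by (rule attachment_obtain[OF assms Some])
  show ?thesis using rooted_code_card[OF attachedD(9)[OF *]] Some by simp
qed

lemma card_verts: "card (verts G) = (\<Sum>i<n. opt_narr (snd (w ! i)) + 2 * opt_ntri (snd (w ! i)))"
proof -
  have "card B = n" using distinct_card[OF distinct_verts] by simp
  moreover have "card (\<Union>i<n. D i) = (\<Sum>i<n. card (D i))"
    using finite_D D_disjoint by (intro card_UN_disjoint) auto
  moreover have "B \<inter> (\<Union>i<n. D i) = {}" using D_base by blast
  moreover have "finite (\<Union>i<n. D i)" using finite_D by blast
  ultimately have "card (verts G) = n + (\<Sum>i<n. card (D i))"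
    unfolding verts_eq by (simp add: card_Un_disjoint del: set_map)
  also have "\<dots> = (\<Sum>i<n. Suc (card (D i)))" by (simp add: sum.distrib sum_Suc)
  finally show ?thesis using card_D by simp
qed

text \<open>\<open>F\<close> is an induced arrow set, and \<open>a\<close> and \<open>b\<close> are
  told apart by which of their ends lies on the base.\<close>

lemma attached_unique:
  assumes "is_attached i r a b F t" "is_attached i r' a' b' F' t'"
  shows "r' = r" "a' = a" "b' = b" "F' = F" "t' = t"
proof -
  note D = attachedD[OF assms(1)] and D' = attachedD[OF assms(2)]
  show r: "r' = r" and "t' = t" using D(2,3) D'(2,3) by auto
  show F: "F' = F" using attached_verts_eq(2)[OF assms(1)] attached_verts_eq(2)[OF assms(2)] by simp
  have "a' \<in> {a, b} \<union> F" "b' \<in> {a, b} \<union> F" using D(8) D'(8) by auto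
  moreover have "a' \<noteq> b" using D'(13) D(6,11) by metis
  moreover have "b' \<noteq> a" using D'(14) D(5,11) by metis
  ultimately show "a' = a" "b' = b" using D'(17,18) F by auto
qed

text \<open>The share of the \<open>i\<close>-th letter in the 3-cycles: the triangle over its base
  arrow and those of the attached quiver. Distinct steps have disjoint arrow sets, so the parameters
  become sums over letters.\<close>

definition step_cycles where
  "step_cycles i = {C. \<exists>r a b F t. is_attached i r a b F t \<and> (C = {e i, a, b} \<or> C \<in> triangles T H F)}"

definition step_arcs where
  "step_arcs i = insert (e i) (A i)"

lemma step_arcs_disjoint:
  assumes "i < n" "j < n" "x \<in> step_arcs i" "x \<in> step_arcs j"
  shows "i = j"
proof -
  have A: "e k \<notin> A l" if "k < n" "l < n" for k l
    using A_ends(3)[OF that(2)] e_ends'[OF that(1)] D_base[OF that(2)] by blast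
  consider "x = e i" "x = e j" | "x \<in> A i" "x \<in> A j"
    using assms A unfolding step_arcs_def by blast
  then show ?thesis
  proof cases
    case 1
    then show ?thesis using e_inject assms(1,2) by metis
  next
    case 2
    then show ?thesis
      using A_ends[OF assms(1) 2(1)] A_ends[OF assms(2) 2(2)] D_disjoint[OF assms(1,2)]
        D_base[OF assms(1)] by blast
  qed
qed

lemma step_arcs_in_arcs: "i < n \<Longrightarrow> step_arcs i \<subseteq> arcs G"
  unfolding step_arcs_def using e_in_arcs A_in_arcs by blast

lemma step_cycles_None: "i < n \<Longrightarrow> snd (w ! i) = None \<Longrightarrow> step_cycles i = {}"
  unfolding step_cycles_def is_attached_def by auto

lemma step_cycles_attached:
  "is_attached i r a b F t \<Longrightarrow> step_cycles i = insert {e i, a, b} (triangles T H F)"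
proof -
  assume *: "is_attached i r a b F t"
  have "C \<in> insert {e i, a, b} (triangles T H F)" if C: "C \<in> step_cycles i" for C
  proof -
    from C obtain r' a' b' F' t' where **: "is_attached i r' a' b' F' t'"
      "C = {e i, a', b'} \<or> C \<in> triangles T H F'" unfolding step_cycles_def by blast
    show ?thesis using **(2) unfolding attached_unique[OF * **(1)] by blast
  qed
  moreover have "insert {e i, a, b} (triangles T H F) \<subseteq> step_cycles i"
    unfolding step_cycles_def using * by blast
  ultimately show ?thesis by blast
qed

lemma step_cycles_subset: "C \<in> step_cycles i \<Longrightarrow> C \<subseteq> step_arcs i \<and> C \<noteq> {}"
  unfolding step_cycles_def step_arcs_def
  using attachedD(8) triangles_subset triangles_nonempty by blast

lemma e_notin_F: "is_attached i r a b F t \<Longrightarrow> e i \<notin> F \<and> e i \<noteq> a \<and> e i \<noteq> b"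
proof -
  assume *: "is_attached i r a b F t"
  note D = attachedD[OF *]
  show ?thesis using e_ends'[OF D(1)] D(5,6,11,12,15) by (metis IntI empty_iff)
qed

lemma card_step_cycles:
  assumes "i < n"
  shows "finite (step_cycles i)" "card (step_cycles i) = opt_ntri (snd (w ! i))"
    "finite (step_arcs i)" "card (step_arcs i - \<Union> (step_cycles i)) = opt_narr (snd (w ! i))"
proof -
  show "finite (step_arcs i)" unfolding step_arcs_def using finite_A[OF assms] by simp
  have "finite (step_cycles i) \<and> card (step_cycles i) = opt_ntri (snd (w ! i)) \<and>
    card (step_arcs i - \<Union> (step_cycles i)) = opt_narr (snd (w ! i))"
  proof (cases "snd (w ! i)")
    case None
    then show ?thesis using step_cycles_None[OF assms] no_attachment[OF assms] by (simp add: step_arcs_def)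
  next
    case (Some t)
    obtain r a b F where *: "is_attached i r a b F t" by (rule attachment_obtain[OF assms Some])
    note D = attachedD[OF *]
    note e = e_notin_F[OF *]
    have fin: "finite F" by (rule rooted_code_finite[OF D(9)])
    have "{e i, a, b} \<notin> triangles T H F" using e triangles_subset[of "{e i, a, b}" T H F] by blast
    from card_insert_disjoint[OF finite_triangles[OF fin] this]
    have "card (step_cycles i) = Suc (ntri t)" "finite (step_cycles i)"
      unfolding step_cycles_attached[OF *] using rooted_code_triangles(1)[OF D(9)] finite_triangles[OF fin, of T H]
      by simp_all
    moreover have "step_arcs i - \<Union> (step_cycles i) = F - \<Union> (triangles T H F)"
      unfolding step_cycles_attached[OF *] step_arcs_def D(8)
      using e D(17,18) by auto
    ultimately show ?thesis using rooted_code_triangles(2)[OF D(9)] Some by simp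
  qed
  then show "finite (step_cycles i)" "card (step_cycles i) = opt_ntri (snd (w ! i))"
    "card (step_arcs i - \<Union> (step_cycles i)) = opt_narr (snd (w ! i))" by blast+
qed

lemma base_arc_apex:
  assumes "is_attached i r a b F t" "x \<in> arcs G" "T x \<in> B" "H x \<in> B" "z x = Some r"
  shows "x = e i"
proof -
  from assms(5) obtain j a' b' F' t' where j: "x = e j" "is_attached j r a' b' F' t'" by (rule z_Some_obtain)
  have "r \<in> D i" "r \<in> D j" using attachedD(10) assms(1) j(2) by blast+
  then have "i = j" using D_disjoint attachedD(1)[OF assms(1)] attachedD(1)[OF j(2)] by blast
  then show ?thesis using j(1) by simp
qed

text \<open>The 3-cycle is listed from an arrow \<open>x\<close> that ends off the base, so that
  \<open>y\<close> belongs to the same piece. Entering from the base by \<open>a\<close> and turning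
  into \<open>F\<close>, or leaving \<open>F\<close> by \<open>b\<close>, would force an arrow of
  \<open>F\<close> to be a loop at the root. So either all arrows lie in \<open>F\<close>, or
  \<open>x = a\<close> and \<open>y = b\<close>.\<close>

lemma three_cycle_step:
  assumes *: "is_attached i r a b F t" and x: "x \<in> A i" "H x \<in> D i"
    and arcs: "y \<in> arcs G" "u \<in> arcs G" and cyc: "H x = T y" "H y = T u" "H u = T x"
    and base: "\<And>\<alpha>. \<alpha> \<in> {x, y, u} \<Longrightarrow> \<alpha> \<in> base_arcs G \<Longrightarrow> \<exists>c\<in>{x, y, u}. z \<alpha> = Some (T c)"
  shows "{x, y, u} = {e i, a, b} \<or> {x, y, u} \<in> triangles T H F"
proof -
  note D = attachedD[OF *]
  have xa: "x \<in> {a, b} \<union> F" using x(1) D(8) by simp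
  have "x \<noteq> b" using x(2) D(14,15) by blast
  have y: "y \<in> {a, b} \<union> F" using arc_meets_D[OF arcs(1) D(1)] cyc(1) x(2) D(8) by auto
  have "y \<noteq> a" using cyc(1) x(2) D(13,15) by auto
  have meet: "u \<in> {a, b} \<union> F" if "T u \<in> D i \<or> H u \<in> D i"
    using arc_meets_D[OF arcs(2) D(1) that] D(8) by simp
  consider "x = a" "y = b" | "x = a" "y \<in> F" | "x \<in> F" "y = b" | "x \<in> F" "y \<in> F"
    using xa \<open>x \<noteq> b\<close> y \<open>y \<noteq> a\<close> by blast
  then show ?thesis
  proof cases
    case 1
    \<comment> \<open>So far \<open>u\<close> is only parallel to \<open>e i\<close>, and in a
      double arrow it could be the other arrow. The apex condition identifies it.\<close>
    have u: "T u = T (e i)" "H u = H (e i)" using 1 cyc D(4,7) by simp_all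
    then have uB: "T u \<in> B" "H u \<in> B" using e_ends'[OF D(1)] by simp_all
    obtain j where "j < n" "u = e j" using arcs(2) uB by (rule arc_in_B)
    then have "u \<in> base_arcs G" unfolding base_arcs_eq by simp
    then obtain c where c: "c \<in> {x, y, u}" "z u = Some (T c)" using base[of u] by auto
    have "T c \<notin> B"
    proof -
      obtain k a' b' F' t' where "is_attached k (T c) a' b' F' t'" using z_Some_obtain[OF c(2)] by metis
      then show ?thesis by (rule attachedD(11))
    qed
    then have "c = y" using c(1) 1 D(13) uB(1) by auto
    then have "z u = Some r" using c(2) 1 D(6) by simp
    then have "u = e i" using base_arc_apex[OF * arcs(2) uB] by simp
    then show ?thesis using 1 by blast
  next
    case 2
    then have "u \<in> {a, b} \<union> F" using meet D(12)[of y] cyc(2) by auto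
    moreover have "H u \<in> B" using cyc(3) 2 D(13) by simp
    ultimately have "u = b" using D(5,11,12,15) by (metis IntI UnE empty_iff insert_iff)
    then have "H y = T y" using 2 cyc(1,2) D(5,6) by simp
    then show ?thesis using rooted_code_no_loop[OF D(9) 2(2)] by simp
  next
    case 3
    then have "u \<in> {a, b} \<union> F" using meet D(12)[of x] cyc(3) by auto
    moreover have "T u \<in> B" using cyc(2) 3 D(14) by simp
    ultimately have "u = a" using D(6,11,12,15) by (metis IntI UnE empty_iff insert_iff)
    then have "H x = T x" using 3 cyc(1,3) D(5,6) by simp
    then show ?thesis using rooted_code_no_loop[OF D(9) 3(1)] by simp
  next
    case 4
    then have "u \<in> {a, b} \<union> F" using meet D(12)[of y] cyc(2) by auto
    moreover have "u \<noteq> a" using D(12)[OF 4(2)] cyc(2) D(13,15) by (metis IntI empty_iff)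
    moreover have "u \<noteq> b" using D(12)[OF 4(1)] cyc(3) D(14,15) by (metis IntI empty_iff)
    ultimately have "u \<in> F" by blast
    then show ?thesis using 4 cyc trianglesI[of x F y u H T] by simp
  qed
qed

context
  fixes R :: "('a, 'b) realization"
  assumes R: "quiver R = G" "apex R = z" "clockwise R = set p"
begin

lemma three_cycles_eq: "three_cycles R = (\<Union>i<n. step_cycles i)"
proof
  show "three_cycles R \<subseteq> (\<Union>i<n. step_cycles i)"
  proof
    fix C assume "C \<in> three_cycles R"
    then obtain x y u where *: "C = {x, y, u}" "{x, y, u} \<subseteq> arcs (quiver R)"
      "head (quiver R) x = tail (quiver R) y" "head (quiver R) y = tail (quiver R) u"
      "head (quiver R) u = tail (quiver R) x"
      "\<forall>\<alpha>\<in>{x, y, u} \<inter> base_arcs (quiver R). \<exists>c\<in>{x, y, u}. apex R \<alpha> = Some (tail (quiver R) c)"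
      by (rule three_cyclesE)
    note C = *(1) and xyu = *(2)[unfolded R] and cyc = *(3-5)[unfolded R] and base' = *(6)[unfolded R]
    have arcs: "x \<in> arcs G" "y \<in> arcs G" "u \<in> arcs G" using xyu by simp_all
    have base: "\<exists>c\<in>{x, y, u}. z \<alpha> = Some (T c)" if "\<alpha> \<in> {x, y, u}" "\<alpha> \<in> base_arcs G" for \<alpha>
      using base' that by blast
    \<comment> \<open>Base arrows alone never qualify, because the apex condition asks for a tail
      off the base.\<close>
    have "\<exists>i<n. C \<inter> A i \<noteq> {}"
    proof (rule ccontr)
      assume no: "\<not> ?thesis"
      have b: "c \<in> base_arcs G \<and> T c \<in> B" if "c \<in> C" for c
      proof -
        have "c \<in> arcs G" using that C arcs by auto
        then show ?thesis
        proof (cases rule: arc_cases)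
          case (1 i)
          then show ?thesis using e_ends'[OF 1(1)] unfolding base_arcs_eq by simp
        next
          case (2 i)
          then show ?thesis using no that by blast
        qed
      qed
      then obtain c where c: "c \<in> C" "z x = Some (T c)" using base[of x] C by auto
      obtain k a' b' F' t' where "is_attached k (T c) a' b' F' t'" using z_Some_obtain[OF c(2)] by metis
      then show False using attachedD(11) b[OF c(1)] by blast
    qed
    then obtain i f where i: "i < n" "f \<in> C" "f \<in> A i" by blast
    from i(1,3) obtain r a b F t where *: "is_attached i r a b F t" by (rule A_cases)
    note D = attachedD[OF *]
    \<comment> \<open>The 3-cycle is to be rotated so that it starts at an arrow ending in
      \<open>D i\<close>: this is \<open>f\<close> or its predecessor.\<close>
    have "\<exists>g\<in>C. g \<in> A i \<and> H g \<in> D i"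
    proof (cases "H f \<in> D i")
      case False
      then have "T f \<in> D i" using A_ends(3)[OF i(1,3)] by blast
      moreover obtain g where g: "g \<in> C" "H g = T f" using i(2) C cyc by auto
      moreover have "g \<in> arcs G" using g(1) C arcs by auto
      ultimately show ?thesis using arc_meets_D[of g i] i(1) by auto
    qed (use i in blast)
    then obtain g where g: "g \<in> C" "g \<in> A i" "H g \<in> D i" by blast
    have "C = {e i, a, b} \<or> C \<in> triangles T H F"
    proof -
      consider "g = x" | "g = y" | "g = u" using g(1) C by blast
      then show ?thesis
      proof cases
        case 1
        show ?thesis using three_cycle_step[OF * g(2,3), of y u] arcs cyc base unfolding C 1 by blast
      next
        case 2
        have e: "{y, u, x} = {x, y, u}" by auto
        show ?thesis using three_cycle_step[OF * g(2,3), of u x] arcs cyc base unfolding C 2 e by blast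
      next
        case 3
        have e: "{u, x, y} = {x, y, u}" by auto
        show ?thesis using three_cycle_step[OF * g(2,3), of x y] arcs cyc base unfolding C 3 e by blast
      qed
    qed
    then show "C \<in> (\<Union>i<n. step_cycles i)" using step_cycles_attached[OF *] i(1) by auto
  qed
  show "(\<Union>i<n. step_cycles i) \<subseteq> three_cycles R"
  proof
    fix C assume "C \<in> (\<Union>i<n. step_cycles i)"
    then obtain i r a b F t where *: "is_attached i r a b F t"
      and C: "C = {e i, a, b} \<or> C \<in> triangles T H F" unfolding step_cycles_def by blast
    note D = attachedD[OF *]
    have sub: "{a, b} \<union> F \<subseteq> arcs G" using A_in_arcs[OF D(1)] D(8) by blast
    have nb: "x \<notin> base_arcs G" if "x \<in> {a, b} \<union> F" for x
    proof
      assume "x \<in> base_arcs G"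
      then obtain j where "j < n" "x = e j" unfolding base_arcs_eq by (auto simp: in_set_conv_nth)
      then have "T x \<in> B" "H x \<in> B" using e_ends' by auto
      then show False using A_ends(3)[OF D(1), of x] that D(8,15) by blast
    qed
    from C show "C \<in> three_cycles R"
    proof
      assume C: "C = {e i, a, b}"
      have "\<exists>c\<in>{e i, a, b}. apex R \<alpha> = Some (T c)" if "\<alpha> \<in> {e i, a, b} \<inter> base_arcs G" for \<alpha>
        using that nb D(3,6) R(2) by auto
      then show ?thesis
        unfolding three_cycles_def Let_def R(1) C mem_Collect_eq using sub e_in_arcs[OF D(1)] D(4-7)
        by (intro exI[of _ "e i"] exI[of _ a] exI[of _ b]) simp
    next
      assume "C \<in> triangles T H F"
      then obtain x y u where C: "C = {x, y, u}" "{x, y, u} \<subseteq> F" "H x = T y" "H y = T u" "H u = T x"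
        unfolding triangles_def by blast
      moreover have "{x, y, u} \<inter> base_arcs G = {}" using nb C(2) by blast
      ultimately show ?thesis
        unfolding three_cycles_def Let_def R(1) C(1) mem_Collect_eq using sub
        by (intro exI[of _ x] exI[of _ y] exI[of _ u]) auto
    qed
  qed
qed

lemma attached_arcs_None: "i < n \<Longrightarrow> snd (w ! i) = None \<Longrightarrow> attached_arcs R (e i) = {}"
  unfolding attached_arcs_def R using no_attachment by simp

lemma attached_arcs_eq: "is_attached i r a b F t \<Longrightarrow> attached_arcs R (e i) = F"
  unfolding attached_arcs_def R
  using attached_verts_eq[of i r a b F t] attachedD(3)[of i r a b F t] by (simp del: induce_subgraph_arcs)

lemma attached_arcs_subset: "i < n \<Longrightarrow> attached_arcs R (e i) \<subseteq> step_arcs i"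
proof (cases "snd (w ! i)")
  case (Some t)
  assume i: "i < n"
  obtain r a b F where *: "is_attached i r a b F t" by (rule attachment_obtain[OF i Some])
  show ?thesis unfolding attached_arcs_eq[OF *] step_arcs_def attachedD(8)[OF *] by blast
qed (simp add: attached_arcs_None)

lemma num_three_cycles_eq:
  assumes "I \<subseteq> {..<n}"
  shows "num_three_cycles R (e ` I) = (\<Sum>i\<in>I. opt_ntri (snd (w ! i)))"
proof -
  let ?C = "{C \<in> three_cycles R. (\<exists>\<alpha>\<in>e ` I. \<alpha> \<in> C) \<or>
    (\<exists>\<alpha>\<in>e ` I. C \<subseteq> attached_arcs R \<alpha>)}"
  have "?C =
      (\<Union>i\<in>I. step_cycles i)"
  proof
    show "(\<Union>i\<in>I. step_cycles i) \<subseteq>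
      ?C"
    proof
      fix C assume "C \<in> (\<Union>i\<in>I. step_cycles i)"
      then obtain i where i: "i \<in> I" "C \<in> step_cycles i" by blast
      then have "C \<in> three_cycles R" using assms three_cycles_eq by blast
      moreover obtain r a b F t where *: "is_attached i r a b F t"
        "C = {e i, a, b} \<or> C \<in> triangles T H F" using i(2) unfolding step_cycles_def by blast
      then have "e i \<in> C \<or> C \<subseteq> attached_arcs R (e i)"
        using attached_arcs_eq[OF *(1)] triangles_subset by blast
      ultimately show "C \<in> ?C"
        using i(1) by blast
    qed
    show "?C \<subseteq>
      (\<Union>i\<in>I. step_cycles i)"
    proof
      fix C assume "C \<in> ?C"
      then obtain j i where j: "j < n" "C \<in> step_cycles j" and i: "i \<in> I" "e i \<in> C \<or> C \<subseteq> attached_arcs R (e i)"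
        unfolding three_cycles_eq by blast
      have "i < n" using i(1) assms by blast
      then have "\<exists>x\<in>C. x \<in> step_arcs i"
        using i(2) attached_arcs_subset[of i] step_cycles_subset[OF j(2)] unfolding step_arcs_def by blast
      then have "i = j" using step_arcs_disjoint[OF \<open>i < n\<close> j(1)] step_cycles_subset[OF j(2)] by blast
      then show "C \<in> (\<Union>i\<in>I. step_cycles i)" using i(1) j(2) by blast
    qed
  qed
  moreover have "card (\<Union>i\<in>I. step_cycles i) = (\<Sum>i\<in>I. card (step_cycles i))"
  proof (rule card_UN_disjoint)
    show "finite I" using assms finite_subset by blast
    show "\<forall>i\<in>I. finite (step_cycles i)" using assms card_step_cycles(1) by blast
    show "\<forall>i\<in>I. \<forall>j\<in>I. i \<noteq> j \<longrightarrow> step_cycles i \<inter> step_cycles j = {}"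
    proof (intro ballI impI equals0I)
      fix i j C assume ij: "i \<in> I" "j \<in> I" "i \<noteq> j" and C: "C \<in> step_cycles i \<inter> step_cycles j"
      then obtain x where "x \<in> step_arcs i" "x \<in> step_arcs j"
        using step_cycles_subset[of C i] step_cycles_subset[of C j] by blast
      then show False using step_arcs_disjoint[of i j x] ij assms by blast
    qed
  qed
  ultimately show ?thesis
    unfolding num_three_cycles_def using card_step_cycles(2) assms by (auto intro!: sum.cong)
qed

lemma num_arcs_eq:
  assumes "I \<subseteq> {..<n}"
  shows "num_arcs R (e ` I) = (\<Sum>i\<in>I. opt_narr (snd (w ! i)))"
proof -
  let ?X = "{x \<in> arcs (quiver R). x \<notin> \<Union> (three_cycles R) \<and>
    (x \<in> e ` I \<or> (\<exists>\<alpha>\<in>e ` I. x \<in> attached_arcs R \<alpha>))}"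
  let ?Y = "\<lambda>i. step_arcs i - \<Union> (step_cycles i)"
  have "?X =
      (\<Union>i\<in>I. ?Y i)"
  proof
    show "?X
        \<subseteq> (\<Union>i\<in>I. ?Y i)"
    proof
      fix x assume "x \<in> ?X"
      then obtain i where i: "i \<in> I" "x = e i \<or> x \<in> attached_arcs R (e i)" "x \<notin> \<Union> (three_cycles R)" by blast
      then have "i < n" using assms by blast
      then have "x \<in> step_arcs i" using i(2) attached_arcs_subset[of i] unfolding step_arcs_def by blast
      moreover have "x \<notin> \<Union> (step_cycles i)" using i(3) \<open>i < n\<close> unfolding three_cycles_eq by blast
      ultimately show "x \<in> (\<Union>i\<in>I. ?Y i)" using i(1) by blast
    qed
    show "(\<Union>i\<in>I. ?Y i) \<subseteq>
      ?X"
    proof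
      fix x assume "x \<in> (\<Union>i\<in>I. ?Y i)"
      then obtain i where i: "i \<in> I" "x \<in> step_arcs i" "x \<notin> \<Union> (step_cycles i)" by blast
      then have "i < n" using assms by blast
      have "x \<notin> \<Union> (three_cycles R)"
      proof
        assume "x \<in> \<Union> (three_cycles R)"
        then obtain j C where j: "j < n" "C \<in> step_cycles j" "x \<in> C" unfolding three_cycles_eq by blast
        then have "x \<in> step_arcs j" using step_cycles_subset by blast
        then have "i = j" using step_arcs_disjoint[OF \<open>i < n\<close> j(1) i(2)] by simp
        then show False using i(3) j by blast
      qed
      moreover have "x \<in> e ` I \<or> (\<exists>\<alpha>\<in>e ` I. x \<in> attached_arcs R \<alpha>)"
      proof (cases "x = e i")
        case False
        then have "x \<in> A i" using i(2) unfolding step_arcs_def by blast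
        with \<open>i < n\<close> obtain r a b F t where *: "is_attached i r a b F t" "x \<in> {a, b} \<union> F" by (rule A_cases)
        \<comment> \<open>The two connecting arrows lie in the triangle over \<open>e i\<close>,
          which leaves only \<open>F\<close>.\<close>
        have "x \<notin> {a, b}" using i(3) unfolding step_cycles_attached[OF *(1)] by blast
        then show ?thesis using *(2) attached_arcs_eq[OF *(1)] i(1) by blast
      qed (use i(1) in blast)
      moreover have "x \<in> arcs (quiver R)" using step_arcs_in_arcs[OF \<open>i < n\<close>] i(2) R(1) by blast
      ultimately show "x \<in> ?X" by blast
    qed
  qed
  moreover have "card (\<Union>i\<in>I. ?Y i) = (\<Sum>i\<in>I. card (?Y i))"
  proof (rule card_UN_disjoint)
    show "finite I" using assms finite_subset by blast
    show "\<forall>i\<in>I. finite (?Y i)" using assms card_step_cycles(3) by blast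
    show "\<forall>i\<in>I. \<forall>j\<in>I. i \<noteq> j \<longrightarrow> ?Y i \<inter> ?Y j = {}" using assms step_arcs_disjoint by blast
  qed
  ultimately show ?thesis
    unfolding num_arcs_def using card_step_cycles(4) assms by (auto intro!: sum.cong)
qed

lemma clockwise_arcs_eq: "clockwise_arcs R = e ` {i. i < n \<and> fst (w ! i) = True}"
  and anticlockwise_arcs_eq: "anticlockwise_arcs R = e ` {i. i < n \<and> fst (w ! i) = False}"
proof -
  \<comment> \<open>A base arrow occurs in one step only, so the unordered set of steps still tells
    where that step begins.\<close>
  have mem: "(x, e i) \<in> set p \<longleftrightarrow> x = v i" if "i < n" for i x
  proof
    assume "(x, e i) \<in> set p"
    then obtain j where "j < n" "p ! j = (x, e i)" by (meson in_set_conv_nth)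
    then show "x = v i" using e_inject[OF that, of j] by (metis fst_conv snd_conv)
  next
    assume "x = v i"
    then show "(x, e i) \<in> set p" using nth_mem[OF that] by simp
  qed
  have base: "base_arcs G = e ` {..<n}"
  proof
    show "base_arcs G \<subseteq> e ` {..<n}"
      unfolding base_arcs_eq by (auto simp: in_set_conv_nth simp del: set_map)
    show "e ` {..<n} \<subseteq> base_arcs G" unfolding base_arcs_eq by auto
  qed
  have dir: "T (e i) = v i \<longleftrightarrow> fst (w ! i) = True" "H (e i) = v i \<longleftrightarrow> fst (w ! i) = False" if "i < n" for i
    using e_ends[OF that] e_ends'[OF that] by (auto split: if_splits)
  show "clockwise_arcs R = e ` {i. i < n \<and> fst (w ! i) = True}"
    unfolding clockwise_arcs_def R base using mem dir by blast
  show "anticlockwise_arcs R = e ` {i. i < n \<and> fst (w ! i) = False}"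
    unfolding anticlockwise_arcs_def R base using mem dir by blast
qed

lemma params:
  "par_r1 R = word_narr (dir_letters False w)" "par_r2 R = word_ntri (dir_letters False w)"
  "par_s1 R = word_narr (dir_letters True w)" "par_s2 R = word_ntri (dir_letters True w)"
proof -
  have sub: "{i. i < n \<and> fst (w ! i) = d} \<subseteq> {..<n}" for d by blast
  show "par_r1 R = word_narr (dir_letters False w)" "par_s1 R = word_narr (dir_letters True w)"
    unfolding par_r1_def par_s1_def clockwise_arcs_eq anticlockwise_arcs_eq word_narr_def sum_list_dir_letters length_w
    by (rule num_arcs_eq[OF sub])+
  show "par_r2 R = word_ntri (dir_letters False w)" "par_s2 R = word_ntri (dir_letters True w)"
    unfolding par_r2_def par_s2_def clockwise_arcs_eq anticlockwise_arcs_eq word_ntri_def sum_list_dir_letters length_w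
    by (rule num_three_cycles_eq[OF sub])+
qed

lemma realization: "R \<in> realizations (card (verts G))"
proof -
  have "\<exists>!S. S \<subseteq> verts G \<and> nonoriented_cycle (G \<restriction> S)"
  proof (rule ex1I[of _ B])
    show "B \<subseteq> verts G \<and> nonoriented_cycle (G \<restriction> B)"
      using nonoriented unfolding verts_eq by blast
  qed (use base_unique in blast)
  then have "G \<in> affine_A_class (card (verts G))"
    unfolding affine_A_class_def using is_quiver attachment by blast
  then show ?thesis
    unfolding realizations_def R mem_Collect_eq base_verts_eq using attachment turn by blast
qed

end

end

section \<open>Realizations and cyclic words\<close>

text \<open>The conditions of \<open>attachment\<close> supply the parameters of the locale: the
  pieces are the attached components, their connecting arrows are the two whose unique existence is
  required, and a code exists because each component is rooted of type A.\<close>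

lemma realization_decomposed:
  assumes "R \<in> realizations m"
  obtains p D A w where "decomposed (quiver R) (apex R) p D A w" "clockwise R = set p"
proof -
  define G z where "G = quiver R" and "z = apex R"
  let ?B = "base_verts G"
  from assms obtain p where G: "G \<in> affine_A_class m" and att: "attachment G z"
    and p: "cycle_turn (G \<restriction> ?B) p" "clockwise R = set p"
    unfolding realizations_def G_def z_def by blast
  have "\<exists>!S. S \<subseteq> verts G \<and> nonoriented_cycle (G \<restriction> S)" using G unfolding affine_A_class_def by blast
  then have B: "?B \<subseteq> verts G" "nonoriented_cycle (G \<restriction> ?B)"
    unfolding base_verts_def by (metis (mono_tags, lifting) theI')+
  have "is_quiver G" using G unfolding affine_A_class_def by blast
  then have wf: "wf_digraph G" unfolding is_quiver_def fin_digraph_def by blast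
  let ?n = "length p" and ?v = "\<lambda>i. fst (p ! i)" and ?e = "\<lambda>i. snd (p ! i)"
  note C = cycle_turnD[OF p(1), simplified induce_subgraph_verts induce_subgraph_tail induce_subgraph_head]
  have setp: "set (map fst p) = ?B" "set (map snd p) = base_arcs G" "distinct (map fst p)" "distinct (map snd p)"
    using p(1) unfolding cycle_turn_def base_arcs_def by simp_all
  note att' = att[unfolded attachment_def]
  note a1 = att'[THEN conjunct1] and att2 = att'[THEN conjunct2]
  note a2 = att2[THEN conjunct1] and att3 = att2[THEN conjunct2]
  note a3 = att3[THEN conjunct1, rule_format] and att4 = att3[THEN conjunct2]
  note a4 = att4[THEN conjunct1, rule_format] and att5 = att4[THEN conjunct2]
  note a5 = att5[THEN conjunct1] and att6 = att5[THEN conjunct2]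
  note a6 = att6[THEN conjunct1, rule_format] and a7 = att6[THEN conjunct2, rule_format]
  note a = a1 a2 a3[THEN conjunct1] a3[THEN conjunct2] a4 a5 a6 a7
  define D where "D i = (case z (?e i) of None \<Rightarrow> {} | Some r \<Rightarrow> attached_verts G r)" for i
  define F where "F r = arcs (G \<restriction> attached_verts G r)" for r
  define fa where "fa \<alpha> r = (THE x. x \<in> arcs G \<and> tail G x = head G \<alpha> \<and> head G x = r)" for \<alpha> r
  define fb where "fb \<alpha> r = (THE x. x \<in> arcs G \<and> tail G x = r \<and> head G x = tail G \<alpha>)" for \<alpha> r
  define A where "A i = (case z (?e i) of None \<Rightarrow> {} | Some r \<Rightarrow> {fa (?e i) r, fb (?e i) r} \<union> F r)" for i
  define t where "t r = (SOME t. rooted_code (tail G) (head G) (attached_verts G r) (F r) r t)" for r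
  define w where "w = map (\<lambda>i. (tail G (?e i) = ?v i, map_option t (z (?e i)))) [0..<?n]"
  have w: "w ! i = (tail G (?e i) = ?v i, map_option t (z (?e i)))" if "i < ?n" for i
    using that unfolding w_def by simp
  have fa: "fa \<alpha> r \<in> arcs G \<and> tail G (fa \<alpha> r) = head G \<alpha> \<and> head G (fa \<alpha> r) = r" if "z \<alpha> = Some r" for \<alpha> r
    unfolding fa_def by (rule theI'[OF a(3)[OF that]])
  have fb: "fb \<alpha> r \<in> arcs G \<and> tail G (fb \<alpha> r) = r \<and> head G (fb \<alpha> r) = tail G \<alpha>" if "z \<alpha> = Some r" for \<alpha> r
    unfolding fb_def by (rule theI'[OF a(4)[OF that]])
  have code: "rooted_code (tail G) (head G) (attached_verts G r) (F r) r (t r)" if "z \<alpha> = Some r" for \<alpha> r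
  proof -
    have "r \<in> ran z" using that by (auto simp: ran_def)
    from rooted_type_A_imp_code[OF a(8)[OF this]] show ?thesis
      unfolding t_def F_def by (simp del: induce_subgraph_arcs) (rule someI_ex)
  qed
  have z_e: "\<exists>i<?n. \<alpha> = ?e i" if "z \<alpha> = Some r" for \<alpha> r
    using that a(1) C(5) unfolding base_arcs_def by blast
  have sub: "attached_verts G r \<subseteq> verts G - ?B" if "z \<alpha> = Some r" for \<alpha> r
    using that a(6) by (auto simp: ran_def)
  \<comment> \<open>Consecutive vertices are distinct, so a step runs either along its arrow or
    against it.\<close>
  have dir: "tail G (?e i) = ?v i \<and> head G (?e i) = ?v (Suc i mod ?n) \<or>
      tail G (?e i) \<noteq> ?v i \<and> tail G (?e i) = ?v (Suc i mod ?n) \<and> head G (?e i) = ?v i" if "i < ?n" for i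
    using C(8)[OF that] C(6)[of "Suc i mod ?n" i] Suc_mod_neq[OF C(1) that] that by metis
  have "decomposed G z p D A w"
  proof
    show "length w = ?n" unfolding w_def by simp
    show "2 \<le> ?n" by (rule C(1))
    show "distinct (map fst p)" "distinct (map snd p)" by fact+
    show "dom z \<subseteq> set (map snd p)" unfolding setp by (rule a(1))
    show "step_code (tail G) (head G) (?v i) (?e i) (?v (Suc i mod ?n)) (z (?e i)) (D i) (A i) (w ! i)"
      if i: "i < ?n" for i
    proof -
      have "case snd (w ! i) of None \<Rightarrow> z (?e i) = None \<and> D i = {} \<and> A i = {}
        | Some t \<Rightarrow> \<exists>v a b F. z (?e i) = Some v \<and> tail G a = head G (?e i) \<and> head G a = v \<and> tail G b = v \<and>
           head G b = tail G (?e i) \<and> A i = {a, b} \<union> F \<and> rooted_code (tail G) (head G) (D i) F v t"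
      proof (cases "z (?e i)")
        case None
        then show ?thesis by (simp add: w[OF i] D_def A_def)
      next
        case (Some r)
        show ?thesis
          unfolding w[OF i] Some D_def A_def using fa[OF Some] fb[OF Some] code[OF Some] by auto
      qed
      then show ?thesis unfolding step_code_def using dir[OF i] w[OF i] by auto
    qed
    show "D i \<inter> set (map fst p) = {}" if "i < ?n" for i
      unfolding setp D_def using sub by (auto split: option.splits)
    show "D i \<inter> D j = {}" if "i < ?n" "j < ?n" "i \<noteq> j" for i j
      unfolding D_def using a(7)[of "?e i" _ "?e j"] C(7)[OF that(1,2)] that(3) by (auto split: option.splits)
    have "verts G - ?B = (\<Union>i<?n. D i)"
    proof
      show "verts G - ?B \<subseteq> (\<Union>i<?n. D i)"
      proof
        fix x assume "x \<in> verts G - ?B"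
        then obtain \<alpha> r where r: "z \<alpha> = Some r" "x \<in> attached_verts G r" unfolding a(6) by (auto simp: ran_def)
        then obtain i where "i < ?n" "\<alpha> = ?e i" using z_e by blast
        then show "x \<in> (\<Union>i<?n. D i)" unfolding D_def using r by force
      qed
      show "(\<Union>i<?n. D i) \<subseteq> verts G - ?B"
      proof (rule UN_least)
        show "D i \<subseteq> verts G - ?B" for i unfolding D_def using sub by (cases "z (?e i)") auto
      qed
    qed
    then show "verts G = set (map fst p) \<union> (\<Union>i<?n. D i)" unfolding setp using B(1) by blast
    show "arcs G = set (map snd p) \<union> (\<Union>i<?n. A i)"
    proof
      show "set (map snd p) \<union> (\<Union>i<?n. A i) \<subseteq> arcs G"
        unfolding setp A_def F_def base_arcs_def using fa fb by (auto split: option.splits)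
      show "arcs G \<subseteq> set (map snd p) \<union> (\<Union>i<?n. A i)"
      proof
        fix x assume x: "x \<in> arcs G"
        show "x \<in> set (map snd p) \<union> (\<Union>i<?n. A i)"
        proof (cases "tail G x \<in> ?B \<or> head G x \<in> ?B")
          case True
          from a(5)[OF x this] consider "x \<in> base_arcs G"
            | \<alpha> r where "z \<alpha> = Some r" "tail G x = head G \<alpha>" "head G x = r"
            | \<alpha> r where "z \<alpha> = Some r" "tail G x = r" "head G x = tail G \<alpha>" by blast
          then show ?thesis
          proof cases
            case 1
            then show ?thesis unfolding setp by blast
          next
            case (2 \<alpha> r)
            then obtain i where i: "i < ?n" "\<alpha> = ?e i" using z_e by blast
            have "x = fa \<alpha> r" using a(3)[OF 2(1)] fa[OF 2(1)] x 2(2,3) by blast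
            then have "x \<in> A i" unfolding A_def using 2(1) i(2) by simp
            then show ?thesis using i(1) by blast
          next
            case (3 \<alpha> r)
            then obtain i where i: "i < ?n" "\<alpha> = ?e i" using z_e by blast
            have "x = fb \<alpha> r" using a(4)[OF 3(1)] fb[OF 3(1)] x 3(2,3) by blast
            then have "x \<in> A i" unfolding A_def using 3(1) i(2) by simp
            then show ?thesis using i(1) by blast
          qed
        next
          \<comment> \<open>An arrow avoiding the base stays within one component of the complement,
            hence within one attached quiver.\<close>
          case False
          then have "tail G x \<in> verts G - ?B" "x \<in> arcs (G \<restriction> (verts G - ?B))"
            using wf x by (auto simp: wf_digraph_def)
          from this(1) obtain \<alpha> r where r: "z \<alpha> = Some r" "tail G x \<in> attached_verts G r"
            unfolding a(6) by (auto simp: ran_def)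
          then obtain i where i: "i < ?n" "\<alpha> = ?e i" using z_e by blast
          interpret wf_digraph G by fact
          have "wf_digraph (G \<restriction> (verts G - ?B))" by blast
          from arc_closed_sym_reachable[OF this, of r]
          have "head G x \<in> attached_verts G r"
            using r(2) \<open>x \<in> arcs (G \<restriction> (verts G - ?B))\<close>
            unfolding arc_closed_def attached_verts_def by simp
          then have "x \<in> F r" unfolding F_def using x r(2) by simp
          then have "x \<in> A i" unfolding A_def using r(1) i(2) by simp
          then show ?thesis using i(1) by blast
        qed
      qed
    qed
    \<comment> \<open>The turn \<open>p\<close> of the realization may differ from the one that
      witnesses non-orientedness.\<close>
    note turn = nonoriented_cycle_turn[OF B(2) p(1), simplified induce_subgraph_tail induce_subgraph_head]
    from turn(1) obtain i where i: "i < ?n" "tail G (?e i) = ?v i" by blast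
    then have "fst (w ! i)" "i < length w" using w[OF i(1)] by (simp_all add: w_def)
    then show "\<exists>l\<in>set w. fst l" using nth_mem by blast
    from turn(2) obtain j where j: "j < ?n" "head G (?e j) = ?v j" by blast
    have "tail G (?e j) \<noteq> ?v j"
      using dir[OF j(1)] C(6)[of "Suc j mod ?n" j] Suc_mod_neq[OF C(1) j(1)] j by metis
    then have "\<not> fst (w ! j)" "j < length w" using w[OF j(1)] j(1) by (simp_all add: w_def)
    then show "\<exists>l\<in>set w. \<not> fst l" using nth_mem by blast
  qed
  then show ?thesis using that p(2) unfolding G_def z_def by blast
qed

text \<open>Transport of a decomposition with the word unchanged. It serves for isomorphic
  realizations and for copying the standard quiver to natural numbers.\<close>

lemma (in decomposed) image:
  assumes f: "inj_on f (verts G)" and g: "inj_on g (arcs G)"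
    and G': "verts G' = f ` verts G" "arcs G' = g ` arcs G"
      "\<And>x. x \<in> arcs G \<Longrightarrow> tail G' (g x) = f (T x) \<and> head G' (g x) = f (H x)"
    and z': "\<And>x. x \<in> arcs G \<Longrightarrow> z' (g x) = map_option f (z x)" "dom z' \<subseteq> arcs G'"
  shows "decomposed G' z' (map (map_prod f g) p) (\<lambda>i. f ` D i) (\<lambda>i. g ` A i) w"
proof -
  let ?p = "map (map_prod f g) p"
  have BV: "B \<subseteq> verts G" unfolding verts_eq by blast
  have BA: "set (map snd p) \<subseteq> arcs G" unfolding arcs_eq by blast
  have DV: "D i \<subseteq> verts G" if "i < n" for i unfolding verts_eq using that by blast
  have fst_map: "map fst ?p = map f (map fst p)"
    and snd_map: "map snd ?p = map g (map snd p)" by simp_all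
  show ?thesis
  proof
    show "length w = length ?p" "2 \<le> length ?p"
      using length_w length_p by simp_all
    show "distinct (map fst ?p)"
      unfolding fst_map distinct_map[of f] using distinct_verts inj_on_subset[OF f BV] by blast
    show "distinct (map snd ?p)"
      unfolding snd_map distinct_map[of g] using distinct_arcs inj_on_subset[OF g BA] by blast
    fix i assume "i < length ?p"
    then have i: "i < n" by simp
    have e: "e i \<in> arcs G" by (rule e_in_arcs[OF i])
    have nx: "Suc i mod length ?p = nxt i" by simp
    have nth: "?p ! j = (f (v j), g (e j))" if "j < n" for j
      using that by (simp add: map_prod_def case_prod_beta)
    show "step_code (tail G') (head G') (fst (?p ! i)) (snd (?p ! i))
        (fst (?p ! (Suc i mod length ?p)))
        (z' (snd (?p ! i))) (f ` D i) (g ` A i) (w ! i)"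
      unfolding nx nth[OF i] nth[OF nxt(1)[OF i]] fst_conv snd_conv
    proof (cases "snd (w ! i)")
      case None
      then show "step_code (tail G') (head G') (f (v i)) (g (e i)) (f (v (nxt i))) (z' (g (e i)))
          (f ` D i) (g ` A i) (w ! i)"
        unfolding step_code_def
        using no_attachment[OF i None] e_ends[OF i] G'(3)[OF e] z'(1)[OF e] by auto
    next
      case (Some t)
      obtain r a b F where *: "is_attached i r a b F t" by (rule attachment_obtain[OF i Some])
      note At = attachedD[OF *]
      have sub: "{a, b} \<union> F \<subseteq> arcs G" using A_in_arcs[OF i] At(8) by blast
      have "rooted_code (tail G') (head G') (f ` D i) (g ` F) (f r) t"
        using inj_on_subset[OF f DV[OF i]] sub G'(3) by (intro rooted_code_image[OF At(9)]) blast+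
      moreover have "tail G' (g a) = head G' (g (e i))" "head G' (g a) = f r" "tail G' (g b) = f r"
        "head G' (g b) = tail G' (g (e i))"
        using G'(3)[of a] G'(3)[of b] G'(3)[OF e] sub At(4-7) by simp_all
      moreover have "g ` A i = {g a, g b} \<union> g ` F" unfolding At(8) by auto
      ultimately have "\<exists>v a b F. z' (g (e i)) = Some v \<and> tail G' a = head G' (g (e i)) \<and> head G' a = v \<and>
          tail G' b = v \<and> head G' b = tail G' (g (e i)) \<and> g ` A i = {a, b} \<union> F \<and>
          rooted_code (tail G') (head G') (f ` D i) F v t"
        using z'(1)[OF e] At(3) by (intro exI[of _ "f r"] exI[of _ "g a"] exI[of _ "g b"] exI[of _ "g ` F"]) simp
      then show "step_code (tail G') (head G') (f (v i)) (g (e i)) (f (v (nxt i))) (z' (g (e i)))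
          (f ` D i) (g ` A i) (w ! i)"
        unfolding step_code_def Some using e_ends[OF i] G'(3)[OF e] by auto
    qed
    show "f ` D i \<inter> set (map fst ?p) = {}"
      unfolding fst_map set_map[of f]
      using inj_on_image_Int[OF f DV[OF i] BV] D_base[OF i] by simp
    fix j assume "j < length ?p" "i \<noteq> j"
    then show "f ` D i \<inter> f ` D j = {}"
      using inj_on_image_Int[OF f DV[OF i] DV[of j]] D_disjoint[OF i, of j] by simp
  next
    show "verts G' = set (map fst ?p) \<union> (\<Union>i<length ?p. f ` D i)"
      unfolding fst_map set_map[of f] G'(1) verts_eq by (simp add: image_Un image_UN)
    show "arcs G' = set (map snd ?p) \<union> (\<Union>i<length ?p. g ` A i)"
      unfolding snd_map set_map[of g] G'(2) arcs_eq by (simp add: image_Un image_UN)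
    show "dom z' \<subseteq> set (map snd ?p)"
    proof
      fix y assume "y \<in> dom z'"
      then obtain x where x: "x \<in> arcs G" "y = g x" using z'(2) unfolding G'(2) by blast
      then have "x \<in> dom z" using \<open>y \<in> dom z'\<close> z'(1)[OF x(1)] by (auto simp: dom_def)
      then show "y \<in> set (map snd ?p)"
        unfolding snd_map set_map[of g] x(2) using dom_z by blast
    qed
  qed (use along against in blast)+
qed

lemma (in decomposed) rotate: "decomposed G z (rotate k p) (\<lambda>i. D ((k + i) mod n)) (\<lambda>i. A ((k + i) mod n)) (rotate k w)"
proof -
  have "0 < n" using length_p by linarith
  then have lt: "(k + i) mod n < n" for i by simp
  have surj: "(\<lambda>i. (k + i) mod n) ` {..<n} = {..<n}"
  proof
    show "{..<n} \<subseteq> (\<lambda>i. (k + i) mod n) ` {..<n}"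
    proof
      fix j assume j: "j \<in> {..<n}"
      \<comment> \<open>The inverse shift, arranged so that the subtraction stays in the natural
        numbers.\<close>
      define i where "i = (j + (n - k mod n)) mod n"
      have "(k + i) mod n = (k mod n + (j + (n - k mod n))) mod n"
        unfolding i_def by (simp add: mod_add_left_eq mod_add_right_eq)
      also have "\<dots> = (j + n) mod n" using lt[of 0] by (simp add: less_imp_le)
      finally have "(k + i) mod n = j" using j by simp
      moreover have "i < n" unfolding i_def using \<open>0 < n\<close> by simp
      ultimately show "j \<in> (\<lambda>i. (k + i) mod n) ` {..<n}" by blast
    qed
  qed (use lt in blast)
  have UN: "(\<Union>i<n. D ((k + i) mod n)) = (\<Union>i<n. D i)" "(\<Union>i<n. A ((k + i) mod n)) = (\<Union>i<n. A i)"
    using arg_cong[OF surj, of "\<lambda>I. \<Union>i\<in>I. D i"] arg_cong[OF surj, of "\<lambda>I. \<Union>i\<in>I. A i"]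
    by (simp_all only: UN_simps image_image)
  have inj: "i = j" if "i < n" "j < n" "(k + i) mod n = (k + j) mod n" for i j
    using that by (metis cong_add_lcancel_nat cong_def mod_less)
  show ?thesis
  proof
    fix i assume "i < length (rotate k p)"
    then have i: "i < n" by simp
    have nx: "(k + Suc i mod length (rotate k p)) mod n = nxt ((k + i) mod n)"
      by (simp add: mod_add_right_eq mod_Suc_eq)
    have lti: "Suc i mod length (rotate k p) < n" using nxt(1)[OF i] by simp
    show "step_code T H (fst (rotate k p ! i)) (snd (rotate k p ! i)) (fst (rotate k p ! (Suc i mod length (rotate k p))))
        (z (snd (rotate k p ! i))) (D ((k + i) mod n)) (A ((k + i) mod n)) (rotate k w ! i)"
      using code[OF lt[of i]] nth_rotate[OF i, of k] nth_rotate[OF lti, of k] nth_rotate[of i w k] i length_w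
      unfolding nx by simp
    show "D ((k + i) mod n) \<inter> set (map fst (rotate k p)) = {}" using D_base[OF lt] by simp
    fix j assume "j < length (rotate k p)" "i \<noteq> j"
    then show "D ((k + i) mod n) \<inter> D ((k + j) mod n) = {}" using D_disjoint[OF lt lt] inj i by auto
  qed (use length_w length_p distinct_verts distinct_arcs verts_eq arcs_eq dom_z along against UN
        in \<open>simp_all add: rotate_map[symmetric]\<close>)
qed

text \<open>The set of steps determines the turn up to its starting point: a step leads to the other
  end of its arrow, and each vertex begins only one step. The letters then agree because apexes and
  components are the same in both decompositions and the code of a rooted quiver is unique.\<close>

lemma decomposed_unique:
  assumes "decomposed G z p D A w" "decomposed G z p' D' A' w'" "set p' = set p"
  shows "\<exists>k. w' = rotate k w"
proof -
  interpret P: decomposed G z p D A w by fact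
  interpret Q: decomposed G z p' D' A' w' by fact
  have dp: "distinct p" "distinct p'" using P.distinct_verts Q.distinct_verts by (simp_all add: distinct_map)
  then have len: "length p' = length p" using assms(3) by (metis distinct_card)
  have pos: "0 < length p" using P.length_p by linarith
  have "p' ! 0 \<in> set p" using assms(3) nth_mem[of 0 p'] pos len by simp
  then obtain k where k: "k < length p" "p' ! 0 = p ! k" by (metis in_set_conv_nth)
  have nth: "p' ! j = p ! ((k + j) mod length p)" if "j < length p" for j
    using that
  proof (induction j)
    case 0
    then show ?case using k by simp
  next
    case (Suc j)
    let ?m = "(k + j) mod length p"
    have m: "?m < length p" using pos by simp
    have IH: "p' ! j = p ! ?m" using Suc by simp
    have "Suc j mod length p' = Suc j" using Suc.prems len by simp
    then have "fst (p' ! Suc j) = fst (p ! (Suc ?m mod length p))"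
      using Q.e_ends[of j] Q.nxt(2)[of j] P.e_ends[OF m] Suc.prems len IH P.e_ends'[OF m] by (auto split: if_splits)
    moreover have "p' ! Suc j \<in> set p" using assms(3) nth_mem[of "Suc j" p'] Suc.prems len by simp
    then obtain l where l: "l < length p" "p' ! Suc j = p ! l" by (metis in_set_conv_nth)
    ultimately have "l = Suc ?m mod length p" using P.v_inject[OF l(1) P.nxt(1)[OF m]] by simp
    then show ?case using l(2) by (simp add: mod_Suc_eq)
  qed
  have "w' = rotate k w"
  proof (rule nth_equalityI)
    show "length w' = length (rotate k w)" using P.length_w Q.length_w len by simp
    fix j assume "j < length w'"
    then have j: "j < length p" "j < length p'" using Q.length_w len by simp_all
    let ?m = "(k + j) mod length p"
    have m: "?m < length p" using pos by simp
    have pj: "p' ! j = p ! ?m" by (rule nth[OF j(1)])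
    have "fst (w' ! j) \<longleftrightarrow> T = fst (p ! ?m)" if "T = tail G (snd (p ! ?m))" for T
      using Q.e_ends[OF j(2)] Q.e_ends'[OF j(2)] unfolding pj that by (auto split: if_splits)
    moreover have "fst (w ! ?m) \<longleftrightarrow> tail G (snd (p ! ?m)) = fst (p ! ?m)"
      using P.e_ends[OF m] P.e_ends'[OF m] by (auto split: if_splits)
    moreover have "snd (w' ! j) = snd (w ! ?m)"
    proof (cases "snd (w ! ?m)")
      case None
      then have "z (snd (p' ! j)) = None" using P.no_attachment[OF m] pj by simp
      then have "snd (w' ! j) = None" using Q.attachment_obtain[OF j(2)] Q.attachedD(3) by (metis option.exhaust option.simps(3))
      then show ?thesis using None by simp
    next
      case (Some t)
      obtain r a b F where *: "P.is_attached ?m r a b F t" by (rule P.attachment_obtain[OF m Some])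
      then have z: "z (snd (p' ! j)) = Some r" using P.attachedD(3) pj by simp
      then have "snd (w' ! j) \<noteq> None" using Q.no_attachment[OF j(2)] by auto
      then obtain t' where t': "snd (w' ! j) = Some t'" by blast
      obtain r' a' b' F' where **: "Q.is_attached j r' a' b' F' t'" by (rule Q.attachment_obtain[OF j(2) t'])
      then have "r' = r" using Q.attachedD(3) z by simp
      then have "D' j = D ?m" "F' = F"
        using P.attached_verts_eq[OF *] Q.attached_verts_eq[OF **] by simp_all
      then have "t' = t"
        using rooted_code_unique[OF P.attachedD(9)[OF *]] Q.attachedD(9)[OF **] \<open>r' = r\<close> by simp
      then show ?thesis using t' Some by simp
    qed
    moreover have "rotate k w ! j = w ! ?m" using nth_rotate[of j w k] j P.length_w by simp
    ultimately show "w' ! j = rotate k w ! j" by (simp add: prod_eq_iff)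
  qed
  then show ?thesis by blast
qed


text \<open>
  A standard copy of the quiver with word \<open>w\<close>: \<open>(i, [])\<close> is the \<open>i\<close>-th base vertex and the \<open>i\<close>-th
  base arrow, the prefix 0 labels the rooted quiver attached to that arrow, and \<open>[1], [2]\<close> are the
  two arrows that attach it.
\<close>

definition word_verts :: "word \<Rightarrow> (nat \<times> nat list) set" where
  "word_verts w = {(i, q). i < length w \<and>
     (q = [] \<or> (\<exists>t q'. snd (w ! i) = Some t \<and> q = 0 # q' \<and> q' \<in> model_verts t))}"

definition word_arcs :: "word \<Rightarrow> (nat \<times> nat list) set" where
  "word_arcs w = {(i, q). i < length w \<and>
     (q = [] \<or> (\<exists>t. snd (w ! i) = Some t \<and> (q = [1] \<or> q = [2] \<or> (\<exists>q'. q = 0 # q' \<and> q' \<in> model_arcs t))))}"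

definition base_tail :: "word \<Rightarrow> nat \<Rightarrow> nat \<times> nat list" where
  "base_tail w i = (if fst (w ! i) then i else Suc i mod length w, [])"

definition base_head :: "word \<Rightarrow> nat \<Rightarrow> nat \<times> nat list" where
  "base_head w i = (if fst (w ! i) then Suc i mod length w else i, [])"

definition word_tail :: "word \<Rightarrow> nat \<times> nat list \<Rightarrow> nat \<times> nat list" where
  "word_tail w = (\<lambda>(i, q). if q = [] then base_tail w i else if q = [1] then base_head w i
     else if q = [2] then (i, [0]) else (i, 0 # model_tail (the (snd (w ! i))) (tl q)))"

definition word_head :: "word \<Rightarrow> nat \<times> nat list \<Rightarrow> nat \<times> nat list" where
  "word_head w = (\<lambda>(i, q). if q = [] then base_head w i else if q = [1] then (i, [0])
     else if q = [2] then base_tail w i else (i, 0 # model_head (the (snd (w ! i))) (tl q)))"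

definition word_quiver :: "word \<Rightarrow> (nat \<times> nat list, nat \<times> nat list) pre_digraph" where
  "word_quiver w = \<lparr>verts = word_verts w, arcs = word_arcs w, tail = word_tail w, head = word_head w\<rparr>"

lemma word_quiver_simps [simp]:
  "verts (word_quiver w) = word_verts w" "arcs (word_quiver w) = word_arcs w"
  "tail (word_quiver w) = word_tail w" "head (word_quiver w) = word_head w"
  by (simp_all add: word_quiver_def)

definition word_apex :: "word \<Rightarrow> nat \<times> nat list \<Rightarrow> (nat \<times> nat list) option" where
  "word_apex w = (\<lambda>(i, q). if i < length w \<and> q = [] then map_option (\<lambda>_. (i, [0])) (snd (w ! i)) else None)"

definition word_turn :: "word \<Rightarrow> ((nat \<times> nat list) \<times> (nat \<times> nat list)) list" where
  "word_turn w = map (\<lambda>i. ((i, []), (i, []))) [0..<length w]"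

definition word_D :: "word \<Rightarrow> nat \<Rightarrow> (nat \<times> nat list) set" where
  "word_D w i = (case snd (w ! i) of None \<Rightarrow> {} | Some t \<Rightarrow> (\<lambda>q. (i, 0 # q)) ` model_verts t)"

definition word_A :: "word \<Rightarrow> nat \<Rightarrow> (nat \<times> nat list) set" where
  "word_A w i = (case snd (w ! i) of None \<Rightarrow> {}
     | Some t \<Rightarrow> {(i, [1]), (i, [2])} \<union> (\<lambda>q. (i, 0 # q)) ` model_arcs t)"

lemma decomposed_word_quiver:
  assumes "\<exists>l\<in>set w. fst l" "\<exists>l\<in>set w. \<not> fst l"
  shows "decomposed (word_quiver w) (word_apex w) (word_turn w) (word_D w) (word_A w) w"
proof
  let ?p = "word_turn w"
  have len: "length ?p = length w" by (simp add: word_turn_def)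
  have nth: "?p ! i = ((i, []), (i, []))" if "i < length w" for i using that by (simp add: word_turn_def)
  show "length w = length ?p" using len by simp
  show "2 \<le> length ?p"
  proof (rule ccontr)
    assume "\<not> ?thesis"
    then consider "w = []" | l where "w = [l]" unfolding len by (cases w; cases "tl w") auto
    then show False using assms by cases auto
  qed
  have m: "map fst ?p = map (\<lambda>i. (i, [])) [0..<length w]" "map snd ?p = map (\<lambda>i. (i, [])) [0..<length w]"
    by (simp_all add: word_turn_def)
  show "distinct (map fst ?p)" "distinct (map snd ?p)"
    unfolding m by (auto simp: distinct_map inj_on_def)
  have setm: "set (map fst ?p) = {(i, []) |i. i < length w}" "set (map snd ?p) = {(i, []) |i. i < length w}"
    unfolding m by auto
  show "verts (word_quiver w) = set (map fst ?p) \<union> (\<Union>i<length ?p. word_D w i)"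
    unfolding setm len by (auto simp: word_verts_def word_D_def split: option.splits)
  show "arcs (word_quiver w) = set (map snd ?p) \<union> (\<Union>i<length ?p. word_A w i)"
    unfolding setm len by (auto simp: word_arcs_def word_A_def split: option.splits)
  show "dom (word_apex w) \<subseteq> set (map snd ?p)"
    unfolding setm by (auto simp: word_apex_def split: if_splits)
  show "\<exists>l\<in>set w. fst l" "\<exists>l\<in>set w. \<not> fst l" by fact+
  fix i assume "i < length ?p"
  then have i: "i < length w" using len by simp
  then have nx: "Suc i mod length w < length w" by (intro mod_less_divisor) linarith
  show "word_D w i \<inter> set (map fst ?p) = {}"
    unfolding setm word_D_def by (auto split: option.splits)
  show "step_code (tail (word_quiver w)) (head (word_quiver w)) (fst (?p ! i)) (snd (?p ! i))
      (fst (?p ! (Suc i mod length ?p))) (word_apex w (snd (?p ! i))) (word_D w i) (word_A w i) (w ! i)"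
    unfolding len nth[OF i] nth[OF nx] fst_conv snd_conv word_quiver_simps
  proof (cases "snd (w ! i)")
    case None
    then show "step_code (word_tail w) (word_head w) (i, []) (i, []) (Suc i mod length w, [])
        (word_apex w (i, [])) (word_D w i) (word_A w i) (w ! i)"
      using i by (simp add: step_code_def word_apex_def word_D_def word_A_def word_tail_def word_head_def
          base_tail_def base_head_def)
  next
    case (Some t)
    have "rooted_code (word_tail w) (word_head w) ((\<lambda>q. (i, 0 # q)) ` model_verts t)
        ((\<lambda>q. (i, 0 # q)) ` model_arcs t) (i, [0]) t"
      using Some by (intro rooted_code_image[OF rooted_code_model])
        (auto simp: inj_on_def word_tail_def word_head_def)
    moreover have "word_tail w (i, [1]) = word_head w (i, [])" "word_head w (i, [1]) = (i, [0])"
      "word_tail w (i, [2]) = (i, [0])" "word_head w (i, [2]) = word_tail w (i, [])"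
      by (simp_all add: word_tail_def word_head_def)
    moreover have "word_A w i = {(i, [1]), (i, [2])} \<union> (\<lambda>q. (i, 0 # q)) ` model_arcs t"
      "word_D w i = (\<lambda>q. (i, 0 # q)) ` model_verts t" "word_apex w (i, []) = Some (i, [0])"
      using Some i by (simp_all add: word_A_def word_D_def word_apex_def)
    ultimately have "\<exists>v a b F. word_apex w (i, []) = Some v \<and> word_tail w a = word_head w (i, []) \<and>
        word_head w a = v \<and> word_tail w b = v \<and> word_head w b = word_tail w (i, []) \<and>
        word_A w i = {a, b} \<union> F \<and> rooted_code (word_tail w) (word_head w) (word_D w i) F v t"
      by metis
    moreover have "if fst (w ! i)
        then word_tail w (i, []) = (i, []) \<and> word_head w (i, []) = (Suc i mod length w, [])
        else word_tail w (i, []) = (Suc i mod length w, []) \<and> word_head w (i, []) = (i, [])"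
      by (simp add: word_tail_def word_head_def base_tail_def base_head_def)
    ultimately show "step_code (word_tail w) (word_head w) (i, []) (i, []) (Suc i mod length w, [])
        (word_apex w (i, [])) (word_D w i) (word_A w i) (w ! i)"
      unfolding step_code_def Some option.case by blast
  qed
  fix j assume "i \<noteq> j"
  then show "word_D w i \<inter> word_D w j = {}" by (auto simp: word_D_def split: option.splits)
qed

text \<open>The isomorphism with the standard quiver is glued from those of the attached quivers and
  respects apexes and turn; disjointness of the pieces makes it injective.\<close>

lemma (in decomposed) model_iso:
  "\<exists>f g. inj_on f (word_verts w) \<and> inj_on g (word_arcs w) \<and>
    verts G = f ` word_verts w \<and> arcs G = g ` word_arcs w \<and>
    (\<forall>x\<in>word_arcs w. T (g x) = f (word_tail w x) \<and> H (g x) = f (word_head w x)) \<and>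
    (\<forall>x\<in>word_arcs w. z (g x) = map_option f (word_apex w x)) \<and>
    p = map (map_prod f g) (word_turn w)"
proof -
  \<comment> \<open>The data of a piece are chosen together, since the isomorphism depends on the
    chosen root and arrows.\<close>
  have "\<exists>M. \<forall>i<n. \<forall>t. snd (w ! i) = Some t \<longrightarrow> (case M i of (r, a, b, F, f, g) \<Rightarrow>
      is_attached i r a b F t \<and> inj_on f (model_verts t) \<and> inj_on g (model_arcs t) \<and>
      D i = f ` model_verts t \<and> F = g ` model_arcs t \<and> f [] = r \<and>
      (\<forall>x\<in>model_arcs t. T (g x) = f (model_tail t x) \<and> H (g x) = f (model_head t x)))"
    (is "\<exists>M. \<forall>i<n. \<forall>t. _ i t \<longrightarrow> ?P i t (M i)")
  proof -
    have m: "\<exists>m. \<forall>t. snd (w ! i) = Some t \<longrightarrow> ?P i t m" if i: "i < n" for i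
    proof (cases "snd (w ! i)")
      case (Some t)
      obtain r a b F where *: "is_attached i r a b F t" by (rule attachment_obtain[OF i Some])
      obtain f g where fg: "inj_on f (model_verts t)" "inj_on g (model_arcs t)"
        "D i = f ` model_verts t" "F = g ` model_arcs t" "f [] = r"
        "\<forall>x\<in>model_arcs t. T (g x) = f (model_tail t x) \<and> H (g x) = f (model_head t x)"
        using rooted_code_model_iso[OF attachedD(9)[OF *]] by blast
      have P: "?P i t (r, a, b, F, f, g)" unfolding prod.case by (intro conjI * fg)
      show ?thesis
      proof (intro exI allI impI)
        fix t' assume "snd (w ! i) = Some t'"
        then have "t' = t" using Some by simp
        then show "?P i t' (r, a, b, F, f, g)" using P by (simp only:)
      qed
    qed simp
    show ?thesis
    proof (rule choice, rule allI)
      fix i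
      show "\<exists>m. i < n \<longrightarrow> (\<forall>t. snd (w ! i) = Some t \<longrightarrow> ?P i t m)"
      proof (cases "i < n")
        case True
        from m[OF this] obtain m where "\<forall>t. snd (w ! i) = Some t \<longrightarrow> ?P i t m" by (elim exE)
        then show ?thesis by (intro exI[of _ m] impI)
      qed simp
    qed
  qed
  then obtain M where M': "\<forall>i<n. \<forall>t. snd (w ! i) = Some t \<longrightarrow> ?P i t (M i)" by (elim exE)
  have M: "?P i t (M i)" if "i < n" "snd (w ! i) = Some t" for i t
    by (rule M'[rule_format, OF that])
  define fa where "fa i = fst (snd (M i))" for i
  define fb where "fb i = fst (snd (snd (M i)))" for i
  define fF where "fF i = fst (snd (snd (snd (M i))))" for i
  define ff where "ff i = fst (snd (snd (snd (snd (M i)))))" for i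
  define gg where "gg i = snd (snd (snd (snd (snd (M i)))))" for i
  have at: "is_attached i (ff i []) (fa i) (fb i) (fF i) t" "inj_on (ff i) (model_verts t)"
      "inj_on (gg i) (model_arcs t)" "D i = ff i ` model_verts t" "fF i = gg i ` model_arcs t"
      "\<And>x. x \<in> model_arcs t \<Longrightarrow> T (gg i x) = ff i (model_tail t x) \<and> H (gg i x) = ff i (model_head t x)"
    if "i < n" "snd (w ! i) = Some t" for i t
    using M[OF that] by (auto simp: fa_def fb_def fF_def ff_def gg_def split_beta)
  define f where "f = (\<lambda>(i, q). if q = [] then v i else ff i (tl q))"
  define g where "g = (\<lambda>(i, q). if q = [] then e i else if q = [1] then fa i else if q = [2] then fb i
    else gg i (tl q))"
  have simps: "f (i, []) = v i" "f (i, k # q) = ff i q" "g (i, []) = e i" "g (i, [1]) = fa i"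
    "g (i, [2]) = fb i" "g (i, 0 # q) = gg i q" for i k q
    by (simp_all add: f_def g_def)
  have root: "[] \<in> model_verts t" for t by (rule rooted_code_root[OF rooted_code_model])
  have fD: "f x \<in> D (fst x) \<longleftrightarrow> snd x \<noteq> []" "f x \<in> B \<longleftrightarrow> snd x = []" if mx: "x \<in> word_verts w" for x
  proof -
    obtain i q where x: "x = (i, q)" by (cases x)
    have "i < n" using that unfolding x word_verts_def length_w by simp
    have "(f x \<in> D i \<longleftrightarrow> q \<noteq> []) \<and> (f x \<in> B \<longleftrightarrow> q = [])"
    proof (cases "q = []")
      case True
      have fx: "f x = v i" unfolding x True by (rule simps)
      show ?thesis unfolding fx using v_D[OF \<open>i < n\<close> \<open>i < n\<close>] v_B[OF \<open>i < n\<close>] True by blast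
    next
      case False
      then obtain t q' where t: "snd (w ! i) = Some t" "q = 0 # q'" "q' \<in> model_verts t"
        using mx unfolding x word_verts_def by auto
      then have "f x \<in> D i" unfolding x using at(4)[OF \<open>i < n\<close> t(1)] by (simp add: simps)
      then show ?thesis using D_base[OF \<open>i < n\<close>] False by blast
    qed
    then show "f x \<in> D (fst x) \<longleftrightarrow> snd x \<noteq> []" "f x \<in> B \<longleftrightarrow> snd x = []"
      unfolding x by simp_all
  qed
  have inj_f: "inj_on f (word_verts w)"
  proof (rule inj_onI)
    fix x y assume xy: "x \<in> word_verts w" "y \<in> word_verts w" and eq: "f x = f y"
    obtain i q j q' where x: "x = (i, q)" and y: "y = (j, q')" by (cases x, cases y)
    have ij: "i < n" "j < n" using xy unfolding x y word_verts_def length_w by auto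
    have nil: "q = [] \<longleftrightarrow> q' = []" using fD(2)[OF xy(1)] fD(2)[OF xy(2)] eq unfolding x y by simp
    show "x = y"
    proof (cases "q = []")
      case True
      then show ?thesis using nil eq v_inject[OF ij] unfolding x y by (simp add: simps)
    next
      case False
      then have "f x \<in> D i" "f x \<in> D j" using fD(1)[OF xy(1)] fD(1)[OF xy(2)] eq nil unfolding x y by simp_all
      then have "i = j" using D_disjoint[OF ij] by blast
      obtain t u where t: "snd (w ! i) = Some t" "q = 0 # u" "u \<in> model_verts t"
        using False xy(1) unfolding x word_verts_def by auto
      obtain u' where u': "q' = 0 # u'" "u' \<in> model_verts t"
        using False nil xy(2) t(1) \<open>i = j\<close> unfolding y word_verts_def by auto
      have "ff i u = ff i u'" using eq \<open>i = j\<close> unfolding x y t(2) u'(1) by (simp add: simps)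
      then have "u = u'" using at(2)[OF ij(1) t(1)] t(3) u'(2) by (auto dest: inj_onD)
      then show ?thesis using \<open>i = j\<close> unfolding x y t(2) u'(1) by simp
    qed
  qed
  have g_step: "g (i, q) \<in> step_arcs i" if iq: "(i, q) \<in> word_arcs w" for i q
  proof (cases "q = []")
    case True
    then show ?thesis unfolding step_arcs_def by (simp add: simps)
  next
    case False
    then obtain t where t: "snd (w ! i) = Some t" and q: "q = [1] \<or> q = [2] \<or> (\<exists>q'. q = 0 # q' \<and> q' \<in> model_arcs t)"
      and i: "i < n" using iq unfolding word_arcs_def length_w by auto
    have "A i = {fa i, fb i} \<union> gg i ` model_arcs t"
      using attachedD(8)[OF at(1)[OF i t]] at(5)[OF i t] by simp
    then show ?thesis using q unfolding step_arcs_def by (auto simp: simps simp del: One_nat_def)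
  qed
  have inj_g: "inj_on g (word_arcs w)"
  proof (rule inj_onI)
    fix x y assume xy: "x \<in> word_arcs w" "y \<in> word_arcs w" and eq: "g x = g y"
    obtain i q j q' where x: "x = (i, q)" and y: "y = (j, q')" by (cases x, cases y)
    have ij: "i < n" "j < n" using xy unfolding x y word_arcs_def length_w by auto
    have "g x \<in> step_arcs i" using g_step[of i q] xy(1) unfolding x .
    moreover have "g x \<in> step_arcs j" using g_step[of j q'] xy(2) unfolding eq y .
    ultimately have "i = j" by (rule step_arcs_disjoint[OF ij])
    show "x = y"
    proof (cases "snd (w ! i)")
      case None
      then have "q = []" "q' = []" using xy \<open>i = j\<close> unfolding x y word_arcs_def by auto
      then show ?thesis using \<open>i = j\<close> unfolding x y by simp
    next
      case (Some t)
      note At = attachedD[OF at(1)[OF ij(1) Some]] and en = e_notin_F[OF at(1)[OF ij(1) Some]]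
      have eqi: "g (i, q) = g (i, q')" using eq \<open>i = j\<close> unfolding x y by simp
      have gF: "gg i u \<in> fF i" if "u \<in> model_arcs t" for u using at(5)[OF ij(1) Some] that by simp
      have sep: "e i \<noteq> fa i" "e i \<noteq> fb i" "fa i \<noteq> fb i" "\<And>u. u \<in> model_arcs t \<Longrightarrow> gg i u \<noteq> e i"
        "\<And>u. u \<in> model_arcs t \<Longrightarrow> gg i u \<noteq> fa i" "\<And>u. u \<in> model_arcs t \<Longrightarrow> gg i u \<noteq> fb i"
        using en At(16-18) gF by metis+
      have cases: "s = [] \<or> s = [1] \<or> s = [2] \<or> (\<exists>u. s = 0 # u \<and> u \<in> model_arcs t)" if "(i, s) \<in> word_arcs w" for s
        using that Some unfolding word_arcs_def by auto
      have c: "q = [] \<or> q = [1] \<or> q = [2] \<or> (\<exists>u. q = 0 # u \<and> u \<in> model_arcs t)"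
        "q' = [] \<or> q' = [1] \<or> q' = [2] \<or> (\<exists>u. q' = 0 # u \<and> u \<in> model_arcs t)"
        using cases xy \<open>i = j\<close> unfolding x y by blast+
      have "q = q'"
        using c
        by (elim disjE exE conjE; use eqi sep in \<open>simp add: simps del: One_nat_def\<close>)
          (use at(3)[OF ij(1) Some] in \<open>auto dest: inj_onD\<close>)
      then show ?thesis using \<open>i = j\<close> unfolding x y by simp
    qed
  qed
  have verts: "verts G = f ` word_verts w"
  proof
    show "f ` word_verts w \<subseteq> verts G"
    proof clarify
      fix i q assume iq: "(i, q) \<in> word_verts w"
      then have "i < n" unfolding word_verts_def length_w by simp
      then show "f (i, q) \<in> verts G" using fD[OF iq] unfolding verts_eq by (cases "q = []") auto
    qed
    show "verts G \<subseteq> f ` word_verts w"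
    proof
      fix x assume "x \<in> verts G"
      then consider "x \<in> B" | i where "i < n" "x \<in> D i" unfolding verts_eq by blast
      then show "x \<in> f ` word_verts w"
      proof cases
        case 1
        then obtain i where "i < n" "x = v i" by (rule B_E)
        then have "x = f (i, [])" "(i, []) \<in> word_verts w" by (simp_all add: simps word_verts_def length_w)
        then show ?thesis by blast
      next
        case (2 i)
        then have "snd (w ! i) \<noteq> None" using no_attachment by auto
        then obtain t where t: "snd (w ! i) = Some t" by blast
        obtain q where "q \<in> model_verts t" "x = ff i q" using at(4)[OF 2(1) t] 2(2) by blast
        then have "x = f (i, 0 # q)" "(i, 0 # q) \<in> word_verts w"
          using 2(1) t by (simp_all add: simps word_verts_def length_w)
        then show ?thesis by blast
      qed
    qed
  qed
  have arcs: "arcs G = g ` word_arcs w"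
  proof
    show "g ` word_arcs w \<subseteq> arcs G"
    proof clarify
      fix i q assume iq: "(i, q) \<in> word_arcs w"
      then have "i < n" unfolding word_arcs_def length_w by simp
      then show "g (i, q) \<in> arcs G" using g_step[OF iq] step_arcs_in_arcs by blast
    qed
    show "arcs G \<subseteq> g ` word_arcs w"
    proof
      fix x assume "x \<in> arcs G"
      then show "x \<in> g ` word_arcs w"
      proof (cases rule: arc_cases)
        case (1 i)
        then have "x = g (i, [])" "(i, []) \<in> word_arcs w" by (simp_all add: simps word_arcs_def length_w)
        then show ?thesis by blast
      next
        case (2 i)
        then have "snd (w ! i) \<noteq> None" using no_attachment by auto
        then obtain t where t: "snd (w ! i) = Some t" by blast
        have "x \<in> {fa i, fb i} \<union> gg i ` model_arcs t"
          using attachedD(8)[OF at(1)[OF 2(1) t]] at(5)[OF 2(1) t] 2(2) by simp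
        then consider "x = g (i, [1])" | "x = g (i, [2])" | q where "q \<in> model_arcs t" "x = g (i, 0 # q)"
          by (auto simp: simps simp del: One_nat_def)
        then show ?thesis
          using 2(1) t by cases (auto simp: word_arcs_def length_w intro!: image_eqI simp del: One_nat_def)
      qed
    qed
  qed
  have base: "T (e i) = f (base_tail w i)" "H (e i) = f (base_head w i)" if "i < n" for i
    using e_ends[OF that] by (auto simp: base_tail_def base_head_def simps length_w split: if_splits)
  have ends: "T (g x) = f (word_tail w x) \<and> H (g x) = f (word_head w x) \<and> z (g x) = map_option f (word_apex w x)"
    if mx: "x \<in> word_arcs w" for x
  proof -
    obtain i q where x: "x = (i, q)" by (cases x)
    have i: "i < n" using mx unfolding x word_arcs_def length_w by simp
    show ?thesis
    proof (cases "q = []")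
      case True
      have "z (e i) = map_option f (word_apex w (i, []))"
      proof (cases "snd (w ! i)")
        case None
        then show ?thesis using no_attachment[OF i None] i by (simp add: word_apex_def length_w)
      next
        case (Some t)
        then show ?thesis using attachedD(3)[OF at(1)[OF i Some]] i
          by (simp add: word_apex_def length_w simps)
      qed
      then show ?thesis unfolding x True using base[OF i] by (simp add: word_tail_def word_head_def simps)
    next
      case False
      then obtain t where t: "snd (w ! i) = Some t" and q: "q = [1] \<or> q = [2] \<or> (\<exists>q'. q = 0 # q' \<and> q' \<in> model_arcs t)"
        using mx unfolding x word_arcs_def by auto
      note At = attachedD[OF at(1)[OF i t]]
      have "g x \<in> A i" using q At(8) at(5)[OF i t] unfolding x by (auto simp: simps simp del: One_nat_def)
      \<comment> \<open>Off the base arrows the apex map is undefined by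
        \<open>dom_z\<close>.\<close>
      have "g x \<notin> set (map snd p)"
      proof
        assume "g x \<in> set (map snd p)"
        then obtain k where k: "k < n" "g x = e k" by (auto simp: in_set_conv_nth)
        then show False using A_ends(3)[OF i \<open>g x \<in> A i\<close>] e_ends'[OF k(1)] D_base[OF i] unfolding k(2) by blast
      qed
      then have "z (g x) = None" using dom_z by blast
      moreover have "word_apex w x = None" using False unfolding x word_apex_def by simp
      moreover from q have "T (g x) = f (word_tail w x) \<and> H (g x) = f (word_head w x)"
      proof (elim disjE exE conjE)
        assume "q = [1]"
        then show ?thesis unfolding x using At(4,5) base[OF i]
          by (simp add: simps word_tail_def word_head_def del: One_nat_def)
      next
        assume "q = [2]"
        then show ?thesis unfolding x using At(6,7) base[OF i]
          by (simp add: simps word_tail_def word_head_def)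
      next
        fix q' assume "q = 0 # q'" "q' \<in> model_arcs t"
        then show ?thesis unfolding x using at(6)[OF i t] t
          by (simp add: simps word_tail_def word_head_def)
      qed
      ultimately show ?thesis by simp
    qed
  qed
  have "p = map (map_prod f g) (word_turn w)"
    by (rule nth_equalityI) (simp_all add: word_turn_def length_w simps)
  then show ?thesis using inj_f inj_g verts arcs ends by blast
qed

section \<open>Counting necklaces\<close>

text \<open>Each class \<open>C\<close> is met \<open>card C\<close> times with weight
  \<open>1 / card C\<close>.\<close>

lemma card_quotient_eq_sum:
  assumes "finite A" "equiv A r"
  shows "real (card (A // r)) = (\<Sum>a\<in>A. 1 / real (card (r `` {a})))"
proof -
  have fin: "finite C" if "C \<in> A // r" for C
    using in_quotient_imp_subset[OF assms(2) that] assms(1) by (rule finite_subset)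
  have "(\<Sum>a\<in>A. 1 / real (card (r `` {a}))) = (\<Sum>a\<in>\<Union>(A // r). 1 / real (card (r `` {a})))"
    using Union_quotient[OF assms(2)] by simp
  also have "\<dots> = (\<Sum>C\<in>A // r. \<Sum>a\<in>C. 1 / real (card (r `` {a})))"
    using fin quotient_disj[OF assms(2)] by (subst sum.Union_disjoint) auto
  also have "\<dots> = (\<Sum>C\<in>A // r. 1)"
  proof (rule sum.cong)
    fix C assume C: "C \<in> A // r"
    then have "C \<noteq> {}" by (rule in_quotient_imp_non_empty[OF assms(2)])
    then have "card C > 0" using fin[OF C] by (simp add: card_gt_0_iff)
    have "r `` {a} = C" if "a \<in> C" for a
      using C that assms(2) by (metis Image_singleton_iff equiv_class_eq quotientE)
    then have "(\<Sum>a\<in>C. 1 / real (card (r `` {a}))) = (\<Sum>a\<in>C. 1 / real (card C))" by simp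
    then show "(\<Sum>a\<in>C. 1 / real (card (r `` {a}))) = 1" using \<open>card C > 0\<close> by simp
  qed simp
  finally show ?thesis by simp
qed

section \<open>Powers and rotational symmetry of words\<close>

abbreviation list_pow :: "nat \<Rightarrow> 'a list \<Rightarrow> 'a list" where
  "list_pow k v \<equiv> concat (replicate k v)"

lemma length_list_pow [simp]: "length (list_pow k v) = k * length v"
  by (induction k) auto

lemma nth_list_pow: "i < k * length v \<Longrightarrow> list_pow k v ! i = v ! (i mod length v)"
proof (induction k arbitrary: i)
  case (Suc k)
  show ?case
  proof (cases "i < length v")
    case False
    then have "list_pow (Suc k) v ! i = list_pow k v ! (i - length v)" by (simp add: nth_append)
    also have "\<dots> = v ! ((i - length v) mod length v)" using Suc False by (intro Suc.IH) auto
    also have "(i - length v) mod length v = i mod length v" using False by (simp add: le_mod_geq)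
    finally show ?thesis .
  qed (simp add: nth_append)
qed simp

lemma rotate_funpow_fix: "rotate j w = w \<Longrightarrow> rotate (j * x) w = w"
  by (induction x) (simp_all add: rotate_rotate[symmetric] add.commute)

text \<open>By Bezout, a rotation by \<open>j\<close> that fixes \<open>w\<close> makes the gcd of
  \<open>j\<close> and the length a period; a period dividing the length means that \<open>w\<close>
  is a power of its initial segment.\<close>

lemma rotate_eq_self_iff:
  fixes j :: nat
  assumes "w \<noteq> []"
  defines "g \<equiv> gcd j (length w)"
  shows "rotate j w = w \<longleftrightarrow> w = list_pow (length w div g) (take g w)"
proof
  let ?n = "length w"
  have n: "?n > 0" "g > 0" "g dvd ?n" "g dvd j" "g \<le> ?n"
    using assms by (auto simp: g_def intro!: gcd_le2_nat)
  assume rot: "rotate j w = w"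
  have "rotate g w = w"
  proof (cases "j = 0")
    case False
    from bezout_nat[OF this, of ?n] obtain x y where "j * x = ?n * y + g" unfolding g_def by blast
    then have "rotate (?n * y + g) w = w" using rotate_funpow_fix[OF rot, of x] by simp
    then show ?thesis by (subst (asm) rotate_conv_mod) (simp add: rotate_conv_mod[of g])
  qed (simp add: g_def)
  then have step: "w ! (i + g) = w ! i" if "i + g < ?n" for i
    using nth_rotate[of i w g] that by (simp add: add.commute)
  have per: "w ! i = w ! (i mod g)" if "i < ?n" for i
    using that
  proof (induction i rule: less_induct)
    case (less i)
    show ?case
    proof (cases "i < g")
      case False
      then have "w ! i = w ! (i - g)" using step[of "i - g"] less.prems by simp
      also have "\<dots> = w ! ((i - g) mod g)" using False less.prems n by (intro less.IH) auto
      finally show ?thesis using False by (simp add: le_mod_geq)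
    qed simp
  qed
  show "w = list_pow (?n div g) (take g w)"
  proof (rule nth_equalityI)
    show "?n = length (list_pow (?n div g) (take g w))" using n by simp
    fix i assume "i < ?n"
    then show "w ! i = list_pow (?n div g) (take g w) ! i"
      using n per[of i] by (subst nth_list_pow) simp_all
  qed
next
  let ?n = "length w"
  have n: "?n > 0" "g > 0" "g dvd ?n" "g dvd j" "g \<le> ?n"
    using assms by (auto simp: g_def intro!: gcd_le2_nat)
  assume w: "w = list_pow (?n div g) (take g w)"
  have per: "w ! i = w ! (i mod g)" if "i < ?n" for i
  proof -
    have "w ! i = list_pow (?n div g) (take g w) ! i" using w by simp
    also have "\<dots> = take g w ! (i mod g)" using that n by (subst nth_list_pow) simp_all
    finally show ?thesis using n by simp
  qed
  show "rotate j w = w"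
  proof (rule nth_equalityI)
    fix i assume i: "i < length (rotate j w)"
    have "rotate j w ! i = w ! (((j + i) mod ?n) mod g)"
      using i n per[of "(j + i) mod ?n"] by (simp add: nth_rotate)
    also have "((j + i) mod ?n) mod g = i mod g"
      using n(4) mod_mod_cancel[OF n(3), of "j + i"] by (auto elim: dvdE)
    also have "w ! (i mod g) = w ! i" using per[of i] i by simp
    finally show "rotate j w ! i = w ! i" .
  qed simp
qed

text \<open>The fixing rotations are sorted by the gcd \<open>d\<close> of \<open>j\<close> and the
  length n. Whether \<open>w\<close> is fixed depends on \<open>d\<close> alone, and phi(n/d) of the
  \<open>j\<close> have this gcd. The exponent \<open>k = n/d\<close> finally replaces
  \<open>d\<close>.\<close>

lemma card_rotate_stabilizer:
  assumes "w \<noteq> []"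
  shows "card {j. j < length w \<and> rotate j w = w} =
    (\<Sum>k | k dvd length w \<and> (\<exists>v. w = list_pow k v). totient k)"
proof -
  let ?n = "length w"
  let ?P = "\<lambda>d. w = list_pow (?n div d) (take d w)"
  have n: "?n > 0" using assms by simp
  have div: "?n div (?n div d) = d" if "d dvd ?n" for d
  proof -
    from that obtain q where "?n = d * q" unfolding dvd_def by blast
    then show ?thesis using n by (cases "q = 0") auto
  qed
  \<comment> \<open>The identity is moved from \<open>0\<close> to \<open>n\<close>, which has the
    same gcd with \<open>n\<close>, to fit the range in \<open>card_gcd_eq_totient\<close>.\<close>
  have "card {j. j < ?n \<and> rotate j w = w} = card {j \<in> {0<..?n}. rotate j w = w}"
    by (rule bij_betw_same_card[of "\<lambda>j. if j = 0 then ?n else j"],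
        rule bij_betw_byWitness[where f' = "\<lambda>j. if j = ?n then 0 else j"]) (use n in auto)
  also have "{j \<in> {0<..?n}. rotate j w = w} =
      (\<Union>d\<in>{d. d dvd ?n \<and> ?P d}. {j \<in> {0<..?n}. gcd j ?n = d})"
    using rotate_eq_self_iff[OF assms] by auto
  also have "card \<dots> = (\<Sum>d | d dvd ?n \<and> ?P d. card {j \<in> {0<..?n}. gcd j ?n = d})"
    using n by (intro card_UN_disjoint) auto
  also have "\<dots> = (\<Sum>d | d dvd ?n \<and> ?P d. totient (?n div d))"
    using n card_gcd_eq_totient[of ?n] by (intro sum.cong) auto
  also have "\<dots> = (\<Sum>k | k dvd ?n \<and> (\<exists>v. w = list_pow k v). totient k)"
  proof (rule sum.reindex_bij_witness[of _ "\<lambda>k. ?n div k" "\<lambda>d. ?n div d"])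
    fix k assume k: "k \<in> {k. k dvd ?n \<and> (\<exists>v. w = list_pow k v)}"
    then obtain v where v: "w = list_pow k v" by auto
    then have len: "?n = k * length v" by (metis length_list_pow)
    then have "k > 0" "length v > 0" using n by auto
    have "take (length v) w = v" using v \<open>k > 0\<close> by (cases k) auto
    then show "?n div k \<in> {d. d dvd ?n \<and> ?P d}"
      using v len \<open>k > 0\<close> \<open>length v > 0\<close> by simp
  qed (use n div in auto)
  finally show ?thesis .
qed

section \<open>Rotation classes\<close>

definition rotation_rel :: "'a list set \<Rightarrow> ('a list \<times> 'a list) set" where
  "rotation_rel W = {(w, w'). w \<in> W \<and> w' \<in> W \<and> (\<exists>k. w' = rotate k w)}"

lemma rotate_inverse: "\<exists>m. rotate m (rotate k w) = w"
proof -
  \<comment> \<open>The complement of \<open>k\<close> to a multiple of the length, without any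
    assumption that \<open>k\<close> is smaller than the length.\<close>
  have "rotate (k * (length w - 1)) (rotate k w) = rotate (k * length w) w"
    by (cases "length w") (simp_all add: rotate_rotate algebra_simps)
  also have "\<dots> = w" by (subst rotate_conv_mod) simp
  finally show ?thesis by blast
qed

lemma equiv_rotation_rel: "equiv W (rotation_rel W)"
proof (rule equivI)
  show "rotation_rel W \<subseteq> W \<times> W" by (auto simp: rotation_rel_def)
  show "refl_on W (rotation_rel W)"
    by (auto simp: refl_on_def rotation_rel_def intro: exI[of _ 0])
  show "sym (rotation_rel W)"
    by (auto intro!: symI simp: rotation_rel_def) (metis rotate_inverse)
  show "trans (rotation_rel W)"
    unfolding trans_def rotation_rel_def by (auto simp: rotate_rotate)
qed

text \<open>Orbit and stabilizer for the cyclic group, carried out on exponents below the length: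
  the fibre over \<open>rotate i w\<close> is the stabilizer shifted by \<open>i\<close>.\<close>

lemma card_rotation_class:
  assumes "w \<noteq> []" "w \<in> W" "\<And>k. rotate k w \<in> W"
  shows "card (rotation_rel W `` {w}) * card {j. j < length w \<and> rotate j w = w} = length w"
proof -
  let ?n = "length w" and ?S = "{j. j < length w \<and> rotate j w = w}"
  let ?O = "(\<lambda>j. rotate j w) ` {..<?n}"
  have n: "?n > 0" using assms by simp
  have O: "rotation_rel W `` {w} = ?O"
    using assms n by (auto simp: rotation_rel_def intro!: image_eqI[of _ _ "_ mod ?n"] simp: rotate_conv_mod[symmetric])
  have fib: "card {j \<in> {..<?n}. rotate j w = y} = card ?S" if "y \<in> ?O" for y
  proof -
    from that obtain i where i: "i < ?n" "y = rotate i w" by auto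
    have "bij_betw (\<lambda>j. (j + i) mod ?n) ?S {j \<in> {..<?n}. rotate j w = y}"
    proof (rule bij_betw_byWitness[where f' = "\<lambda>j. (j + (?n - i)) mod ?n"])
      have *: "(((j + a) mod ?n) + b) mod ?n = j" if "j < ?n" "a + b = ?n" for j a b
      proof -
        have "(((j + a) mod ?n) + b) mod ?n = (j + (a + b)) mod ?n"
          by (simp add: mod_add_left_eq add.assoc)
        then show ?thesis using that by simp
      qed
      show "\<forall>a\<in>?S. ((a + i) mod ?n + (?n - i)) mod ?n = a"
        "\<forall>a'\<in>{j \<in> {..<?n}. rotate j w = y}. ((a' + (?n - i)) mod ?n + i) mod ?n = a'"
        using *[where a = i and b = "?n - i"] *[where a = "?n - i" and b = i] i(1) by auto
      show "(\<lambda>j. (j + i) mod ?n) ` ?S \<subseteq> {j \<in> {..<?n}. rotate j w = y}"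
      proof clarsimp
        fix j assume j: "j < ?n" "rotate j w = w"
        have "rotate ((j + i) mod ?n) w = rotate (i + j) w" by (simp add: rotate_conv_mod[symmetric] add.commute)
        also have "\<dots> = y" using j i by (simp add: rotate_rotate[symmetric])
        finally show "(j + i) mod ?n < ?n \<and> rotate ((j + i) mod ?n) w = y" using n by simp
      qed
      show "(\<lambda>j. (j + (?n - i)) mod ?n) ` {j \<in> {..<?n}. rotate j w = y} \<subseteq> ?S"
      proof clarsimp
        fix j assume j: "j < ?n" "y = rotate j w"
        have "rotate ((j + (?n - i)) mod ?n) w = rotate ((?n - i) + j) w"
          by (simp only: rotate_conv_mod[symmetric] add.commute)
        also have "\<dots> = rotate (?n - i) (rotate i w)" using j(2) i by (simp only: rotate_rotate[symmetric])
        also have "\<dots> = w" using i by (simp add: rotate_rotate rotate_conv_mod[of ?n])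
        finally show "(j + (?n - i)) mod ?n < ?n \<and> rotate ((j + (?n - i)) mod ?n) w = w"
          using n by simp
      qed
    qed
    then show ?thesis by (simp add: bij_betw_same_card)
  qed
  have "?n = card (\<Union>y\<in>?O. {j \<in> {..<?n}. rotate j w = y})"
    by (subst UN_simps) (auto intro!: arg_cong[where f = card, of "{..<?n}", simplified])
  also have "\<dots> = (\<Sum>y\<in>?O. card {j \<in> {..<?n}. rotate j w = y})"
    by (intro card_UN_disjoint) auto
  also have "\<dots> = card ?O * card ?S" using fib by simp
  finally show ?thesis unfolding O by simp
qed

text \<open>The number of classes is the sum of 1/|orbit| = |stabilizer|/|w|. The stabilizer
  contributes phi(k) for each \<open>k\<close> such that \<open>w\<close> is a \<open>k\<close>-th
  power; after exchanging the sums, \<open>w = v^k\<close> has length \<open>k |v|\<close>. The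
  finite set \<open>K\<close> of candidate exponents makes the exchange possible.\<close>

lemma card_necklaces:
  assumes "finite W" "[] \<notin> W" "\<And>w k. w \<in> W \<Longrightarrow> rotate k w \<in> W"
    "finite K" "0 \<notin> K" "\<And>k v. list_pow k v \<in> W \<Longrightarrow> k \<in> K"
  shows "real (card (W // rotation_rel W)) =
    (\<Sum>k\<in>K. real (totient k) / real k * (\<Sum>v | list_pow k v \<in> W. 1 / real (length v)))"
proof -
  have "real (card (W // rotation_rel W)) = (\<Sum>w\<in>W. 1 / real (card (rotation_rel W `` {w})))"
    by (rule card_quotient_eq_sum[OF assms(1) equiv_rotation_rel])
  also have "\<dots> = (\<Sum>w\<in>W. \<Sum>k | k \<in> K \<and> (\<exists>v. w = list_pow k v). real (totient k) / real (length w))"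
  proof (rule sum.cong)
    fix w assume w: "w \<in> W"
    then have "w \<noteq> []" using assms(2) by auto
    let ?s = "card {j. j < length w \<and> rotate j w = w}"
    have c: "card (rotation_rel W `` {w}) * ?s = length w"
      using card_rotation_class[OF \<open>w \<noteq> []\<close> w] assms(3)[OF w] by simp
    then have "real (card (rotation_rel W `` {w})) * real ?s = real (length w)"
      by (simp flip: of_nat_mult)
    moreover have "card (rotation_rel W `` {w}) \<noteq> 0"
      using c \<open>w \<noteq> []\<close> by (metis length_0_conv mult_0)
    ultimately have "1 / real (card (rotation_rel W `` {w})) = real ?s / real (length w)"
      using \<open>w \<noteq> []\<close> by (simp add: divide_eq_eq eq_divide_eq mult.commute)
    also have "{k. k dvd length w \<and> (\<exists>v. w = list_pow k v)} = {k. k \<in> K \<and> (\<exists>v. w = list_pow k v)}"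
      using assms(6) w by auto
    then have "real ?s = (\<Sum>k | k \<in> K \<and> (\<exists>v. w = list_pow k v). real (totient k))"
      using card_rotate_stabilizer[OF \<open>w \<noteq> []\<close>] by simp
    finally show "1 / real (card (rotation_rel W `` {w})) =
        (\<Sum>k | k \<in> K \<and> (\<exists>v. w = list_pow k v). real (totient k) / real (length w))"
      by (simp add: sum_divide_distrib)
  qed simp
  also have "\<dots> = (\<Sum>k\<in>K. \<Sum>w | w \<in> W \<and> (\<exists>v. w = list_pow k v). real (totient k) / real (length w))"
    using assms(1,4) by (rule sum.swap_restrict)
  also have "\<dots> = (\<Sum>k\<in>K. real (totient k) / real k * (\<Sum>v | list_pow k v \<in> W. 1 / real (length v)))"
  proof (rule sum.cong)
    fix k assume "k \<in> K"
    then have k: "k > 0" using assms(5) by (cases k) auto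
    have inj: "inj_on (list_pow k) {v. list_pow k v \<in> W}"
    proof (rule inj_onI)
      fix u v :: "'a list" assume eq: "list_pow k u = list_pow k v"
      then have len: "length u = length v" using k by (metis length_list_pow mult_cancel1 neq0_conv)
      have "take (length u) (list_pow k u) = u" "take (length v) (list_pow k v) = v"
        using k by (cases k; simp)+
      then show "u = v" using eq len by metis
    qed
    have "(\<Sum>w | w \<in> W \<and> (\<exists>v. w = list_pow k v). real (totient k) / real (length w)) =
        (\<Sum>w\<in>list_pow k ` {v. list_pow k v \<in> W}. real (totient k) / real (length w))"
      by (intro sum.cong) auto
    also have "\<dots> = (\<Sum>v | list_pow k v \<in> W. real (totient k) / (real k * real (length v)))"
      by (simp add: sum.reindex[OF inj])
    finally show "(\<Sum>w | w \<in> W \<and> (\<exists>v. w = list_pow k v). real (totient k) / real (length w)) =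
        real (totient k) / real k * (\<Sum>v | list_pow k v \<in> W. 1 / real (length v))"
      by (simp add: sum_distrib_left)
  qed simp
  finally show ?thesis .
qed

section \<open>Isomorphism classes as necklaces\<close>

text \<open>\<open>realization_iso\<close> compares apexes on arrows only, so the domain of the apex
  map of \<open>R'\<close> is bounded separately.\<close>

lemma realization_iso_decomposed:
  assumes "decomposed (quiver R) (apex R) p D A w" "clockwise R = set p"
    "realization_iso R R'" "dom (apex R') \<subseteq> arcs (quiver R')"
  shows "\<exists>p' D' A'. decomposed (quiver R') (apex R') p' D' A' w \<and> clockwise R' = set p'"
proof -
  from assms(3) obtain h where h: "pre_digraph.digraph_isomorphism (quiver R) h"
    "quiver R' = app_iso h (quiver R)"
    "\<And>x. x \<in> arcs (quiver R) \<Longrightarrow> apex R' (iso_arcs h x) = map_option (iso_verts h) (apex R x)"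
    "clockwise R' = map_prod (iso_verts h) (iso_arcs h) ` clockwise R"
    unfolding realization_iso_def by blast
  from h(1) have hom: "inj_on (iso_verts h) (verts (quiver R))" "inj_on (iso_arcs h) (arcs (quiver R))"
    "\<And>x. x \<in> arcs (quiver R) \<Longrightarrow> iso_tail h (iso_arcs h x) = iso_verts h (tail (quiver R) x) \<and>
      iso_head h (iso_arcs h x) = iso_verts h (head (quiver R) x)"
    unfolding pre_digraph.digraph_isomorphism_def by auto
  have "decomposed (quiver R') (apex R') (map (map_prod (iso_verts h) (iso_arcs h)) p)
      (\<lambda>i. iso_verts h ` D i) (\<lambda>i. iso_arcs h ` A i) w"
    by (rule decomposed.image[OF assms(1) hom(1,2)]) (use h(2,3) hom(3) assms(4) in auto)
  moreover have "clockwise R' = set (map (map_prod (iso_verts h) (iso_arcs h)) p)"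
    using h(4) assms(2) by simp
  ultimately show ?thesis by blast
qed

text \<open>Both quivers are copies of the standard quiver of \<open>w\<close>: the isomorphism goes
  back from the first copy and forward to the second.\<close>

lemma decomposed_realization_iso:
  fixes R R' :: "('a, 'b) realization"
  assumes "decomposed (quiver R) (apex R) p D A w" "clockwise R = set p"
    "decomposed (quiver R') (apex R') p' D' A' w" "clockwise R' = set p'"
  shows "realization_iso R R'"
proof -
  obtain f g where fg: "inj_on f (word_verts w)" "inj_on g (word_arcs w)"
    "verts (quiver R) = f ` word_verts w" "arcs (quiver R) = g ` word_arcs w"
    "\<And>x. x \<in> word_arcs w \<Longrightarrow> tail (quiver R) (g x) = f (word_tail w x) \<and> head (quiver R) (g x) = f (word_head w x)"
    "\<And>x. x \<in> word_arcs w \<Longrightarrow> apex R (g x) = map_option f (word_apex w x)"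
    "p = map (map_prod f g) (word_turn w)"
    using decomposed.model_iso[OF assms(1)] by blast
  obtain f' g' where fg': "inj_on f' (word_verts w)" "inj_on g' (word_arcs w)"
    "verts (quiver R') = f' ` word_verts w" "arcs (quiver R') = g' ` word_arcs w"
    "\<And>x. x \<in> word_arcs w \<Longrightarrow> tail (quiver R') (g' x) = f' (word_tail w x) \<and> head (quiver R') (g' x) = f' (word_head w x)"
    "\<And>x. x \<in> word_arcs w \<Longrightarrow> apex R' (g' x) = map_option f' (word_apex w x)"
    "p' = map (map_prod f' g') (word_turn w)"
    using decomposed.model_iso[OF assms(3)] by blast
  have W: "decomposed (word_quiver w) (word_apex w) (word_turn w) (word_D w) (word_A w) w"
    by (rule decomposed_word_quiver) (rule decomposed.along[OF assms(1)], rule decomposed.against[OF assms(1)])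
  define F where "F = f' \<circ> the_inv_into (word_verts w) f"
  define K where "K = g' \<circ> the_inv_into (word_arcs w) g"
  have F: "F (f x) = f' x" if "x \<in> word_verts w" for x
    unfolding F_def using the_inv_into_f_f[OF fg(1) that] by simp
  have K: "K (g x) = g' x" if "x \<in> word_arcs w" for x
    unfolding K_def using the_inv_into_f_f[OF fg(2) that] by simp
  have ends: "word_tail w x \<in> word_verts w \<and> word_head w x \<in> word_verts w" if "x \<in> word_arcs w" for x
    using wf_digraph.tail_in_verts[OF decomposed.wf[OF W]] wf_digraph.head_in_verts[OF decomposed.wf[OF W]] that
    by simp
  have apex: "map_option F (map_option f (word_apex w x)) = map_option f' (word_apex w x)" for x
  proof (cases "word_apex w x")
    case (Some r)
    moreover have "ran (word_apex w) \<subseteq> verts (word_quiver w)"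
      using decomposed.attachment[OF W, unfolded attachment_def, THEN conjunct2, THEN conjunct1] by blast
    ultimately have "r \<in> word_verts w" using ranI[of "word_apex w" x r] by auto
    then show ?thesis using Some F by simp
  qed simp
  define h where "h = \<lparr>iso_verts = F, iso_arcs = K, iso_head = head (quiver R'), iso_tail = tail (quiver R')\<rparr>"
  have h: "iso_verts h = F" "iso_arcs h = K" "iso_head h = head (quiver R')" "iso_tail h = tail (quiver R')"
    unfolding h_def by simp_all
  have "inj_on F (verts (quiver R))"
    unfolding fg(3) by (rule inj_onI) (use F fg'(1) in \<open>auto dest: inj_onD\<close>)
  moreover have "inj_on K (arcs (quiver R))"
    unfolding fg(4) by (rule inj_onI) (use K fg'(2) in \<open>auto dest: inj_onD\<close>)
  ultimately have "pre_digraph.digraph_isomorphism (quiver R) h"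
    unfolding pre_digraph.digraph_isomorphism_def h
    using decomposed.wf[OF assms(1)] fg(4,5) fg'(5) F K ends by auto
  moreover have "quiver R' = app_iso h (quiver R)"
  proof (rule pre_digraph.equality)
    show "verts (quiver R') = verts (app_iso h (quiver R))"
      using F by (simp add: h fg(3) fg'(3) image_image)
    show "arcs (quiver R') = arcs (app_iso h (quiver R))"
      using K by (simp add: h fg(4) fg'(4) image_image)
  qed (simp_all add: h)
  moreover have "\<forall>x\<in>arcs (quiver R). apex R' (iso_arcs h x) = map_option (iso_verts h) (apex R x)"
    unfolding h fg(4) using K fg(6) fg'(6) apex by auto
  moreover have "clockwise R' = map_prod (iso_verts h) (iso_arcs h) ` clockwise R"
  proof -
    have "word_turn w = map (\<lambda>i. ((i, []), (i, []))) [0..<length w]" by (simp add: word_turn_def)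
    moreover have "(i, []) \<in> word_verts w" "(i, []) \<in> word_arcs w" if "i < length w" for i
      using that by (simp_all add: word_verts_def word_arcs_def)
    ultimately have "set p' = map_prod F K ` set p"
      unfolding fg(7) fg'(7) using F K by (force simp: image_image)
    then show ?thesis unfolding h assms(2,4) .
  qed
  ultimately show ?thesis unfolding realization_iso_def by blast
qed

lemma card_quotient_kernel:
  "card (S // {(x, y). x \<in> S \<and> y \<in> S \<and> f x = f y}) = card (f ` S)"
proof -
  let ?g = "\<lambda>c. {y \<in> S. c = f y}"
  have "S // {(x, y). x \<in> S \<and> y \<in> S \<and> f x = f y} = ?g ` f ` S"
    unfolding quotient_def by auto
  moreover have "inj_on ?g (f ` S)" by (rule inj_onI) blast
  ultimately show ?thesis by (simp add: card_image)
qed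

lemma dir_letters_nonempty: "dir_letters d w \<noteq> [] \<longleftrightarrow> (\<exists>l\<in>set w. fst l = d)"
  by (auto simp: dir_letters_def filter_empty_conv)

lemma rotate_in_params:
  "word_narr (dir_letters d (rotate k w)) = word_narr (dir_letters d w)"
  "word_ntri (dir_letters d (rotate k w)) = word_ntri (dir_letters d w)"
proof -
  have "mset (rotate k w) = mset w"
    unfolding rotate_drop_take by (metis append_take_drop_id mset_append union_commute)
  then have m: "mset (dir_letters d (rotate k w)) = mset (dir_letters d w)"
    unfolding dir_letters_def by (simp only: mset_map mset_filter)
  have "sum_list (map f u) = sum_list (map f u')" if "mset u = mset u'"
    for f :: "rtree option \<Rightarrow> nat" and u u'
    using that by (metis mset_map sum_mset_sum_list)
  with m show "word_narr (dir_letters d (rotate k w)) = word_narr (dir_letters d w)"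
    "word_ntri (dir_letters d (rotate k w)) = word_ntri (dir_letters d w)"
    unfolding word_narr_def word_ntri_def by blast+
qed

text \<open>The predicate \<open>Q\<close> covers both counts of the theorem. The complete invariant
  of a realization is the set \<open>code R\<close> of all its words, one for each starting point of
  the turn; this is a full rotation class.\<close>

lemma num_up_to_iso_eq_necklaces:
  fixes Q :: "nat \<Rightarrow> nat \<Rightarrow> nat \<Rightarrow> nat \<Rightarrow> bool"
  assumes Q: "\<And>a b c d. Q a b c d \<Longrightarrow> a + 2 * b \<ge> 1 \<and> c + 2 * d \<ge> 1 \<and> a + 2 * b + (c + 2 * d) = m"
  defines "W \<equiv> {w. Q (word_narr (dir_letters False w)) (word_ntri (dir_letters False w))
    (word_narr (dir_letters True w)) (word_ntri (dir_letters True w))}"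
  shows "num_up_to_iso {R \<in> (realizations m :: (nat, nat) realization set).
      Q (par_r1 R) (par_r2 R) (par_s1 R) (par_s2 R)} = card (W // rotation_rel W)"
proof -
  let ?S = "{R \<in> (realizations m :: (nat, nat) realization set). Q (par_r1 R) (par_r2 R) (par_s1 R) (par_s2 R)}"
  define dec where "dec R w \<longleftrightarrow> (\<exists>p D A. decomposed (quiver R) (apex R) p D A w \<and> clockwise R = set p)"
    for R :: "(nat, nat) realization" and w
  define code where "code R = {w. dec R w}" for R
  have ex: "\<exists>w. dec R w" if "R \<in> ?S" for R
  proof -
    from that have "R \<in> realizations m" by blast
    then obtain p D A w where "decomposed (quiver R) (apex R) p D A w" "clockwise R = set p"
      by (rule realization_decomposed)
    then show ?thesis unfolding dec_def by blast
  qed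
  have inW: "w \<in> W" if "R \<in> ?S" "dec R w" for R w
  proof -
    from that(2) obtain p D A where d: "decomposed (quiver R) (apex R) p D A w" "clockwise R = set p"
      unfolding dec_def by blast
    from decomposed.params[OF d(1) refl refl d(2)] that(1) show ?thesis unfolding W_def by simp
  qed
  have rot: "\<exists>k. w' = rotate k w" if "dec R w" "dec R w'" for R w w'
    using that decomposed_unique unfolding dec_def by metis
  have rot': "dec R (rotate k w)" if "dec R w" for R w k
  proof -
    from that obtain p D A where d: "decomposed (quiver R) (apex R) p D A w" "clockwise R = set p"
      unfolding dec_def by blast
    show ?thesis unfolding dec_def using decomposed.rotate[OF d(1), of k] d(2) by (metis set_rotate)
  qed
  have rotW: "rotate k w \<in> W" if "w \<in> W" for k w
    using that unfolding W_def by (simp add: rotate_in_params)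
  have code: "code R = rotation_rel W `` {w}" if "R \<in> ?S" "dec R w" for R w
  proof
    show "code R \<subseteq> rotation_rel W `` {w}"
      unfolding code_def rotation_rel_def using rot[OF that(2)] inW[OF that(1)] that(2) by blast
    show "rotation_rel W `` {w} \<subseteq> code R"
      unfolding code_def rotation_rel_def using rot'[OF that(2)] by blast
  qed
  have iso: "realization_iso R R' \<longleftrightarrow> code R = code R'" if RR: "R \<in> ?S" "R' \<in> ?S" for R R'
  proof
    assume *: "realization_iso R R'"
    obtain w where w: "dec R w" using ex[OF RR(1)] by blast
    then obtain p D A where d: "decomposed (quiver R) (apex R) p D A w" "clockwise R = set p"
      unfolding dec_def by blast
    have "dom (apex R') \<subseteq> arcs (quiver R')"
    proof -
      obtain w' p' D' A' where d': "decomposed (quiver R') (apex R') p' D' A' w'"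
        using ex[OF RR(2)] unfolding dec_def by blast
      show ?thesis using decomposed.dom_z[OF d'] decomposed.arcs_eq[OF d'] by blast
    qed
    from realization_iso_decomposed[OF d * this] have "dec R' w" unfolding dec_def by blast
    then show "code R = code R'" using code[OF RR(1) w] code[OF RR(2)] by simp
  next
    assume *: "code R = code R'"
    obtain w where w: "dec R w" using ex[OF RR(1)] by blast
    then have "dec R' w" using * unfolding code_def by blast
    with w show "realization_iso R R'" unfolding dec_def using decomposed_realization_iso by metis
  qed
  have onto: "\<exists>R\<in>?S. dec R w" if w: "w \<in> W" for w
  proof -
    \<comment> \<open>\<open>Q\<close> makes both totals positive, so both directions occur and the
      base is non-oriented.\<close>
    have "dir_letters d w \<noteq> []" for d
    proof
      assume "dir_letters d w = []"
      then have "word_narr (dir_letters d w) + 2 * word_ntri (dir_letters d w) = 0" by (simp add: word_narr_def word_ntri_def)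
      then show False using w Q unfolding W_def by (cases d) fastforce+
    qed
    then have dirs: "\<exists>l\<in>set w. fst l" "\<exists>l\<in>set w. \<not> fst l"
      using dir_letters_nonempty[of True w] dir_letters_nonempty[of False w] by auto
    \<comment> \<open>The vertices and arrows of the standard quiver are pairs; a countable coding
      moves them into the required type.\<close>
    let ?f = "to_nat :: nat \<times> nat list \<Rightarrow> nat" and ?t = "from_nat :: nat \<Rightarrow> nat \<times> nat list"
    define R where "R = \<lparr>quiver = \<lparr>verts = ?f ` word_verts w, arcs = ?f ` word_arcs w,
        tail = (\<lambda>x. ?f (word_tail w (?t x))), head = (\<lambda>x. ?f (word_head w (?t x)))\<rparr>,
      apex = (\<lambda>x. if x \<in> ?f ` word_arcs w then map_option ?f (word_apex w (?t x)) else None),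
      clockwise = set (map (map_prod ?f ?f) (word_turn w))\<rparr>"
    have d: "decomposed (quiver R) (apex R) (map (map_prod ?f ?f) (word_turn w))
        (\<lambda>i. ?f ` word_D w i) (\<lambda>i. ?f ` word_A w i) w"
      by (rule decomposed.image[OF decomposed_word_quiver[OF dirs]])
        (auto simp: R_def inj_on_def dom_def split: if_splits)
    have cl: "clockwise R = set (map (map_prod ?f ?f) (word_turn w))" by (simp add: R_def)
    have "card (verts (quiver R)) = m"
    proof -
      have "card (verts (quiver R)) = (\<Sum>i<length w. opt_narr (snd (w ! i)) + 2 * opt_ntri (snd (w ! i)))"
        using decomposed.card_verts[OF d] decomposed.length_w[OF d] by simp
      also have "\<dots> = (\<Sum>i | i < length w \<and> fst (w ! i) = False. opt_narr (snd (w ! i)) + 2 * opt_ntri (snd (w ! i))) +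
          (\<Sum>i | i < length w \<and> fst (w ! i) = True. opt_narr (snd (w ! i)) + 2 * opt_ntri (snd (w ! i)))"
        by (subst sum.union_disjoint[symmetric]) (auto intro!: sum.cong)
      also have "\<dots> = word_narr (dir_letters False w) + 2 * word_ntri (dir_letters False w) +
          (word_narr (dir_letters True w) + 2 * word_ntri (dir_letters True w))"
        unfolding word_narr_def word_ntri_def sum_list_dir_letters by (simp only: sum.distrib sum_distrib_left)
      also have "\<dots> = m" using w Q unfolding W_def by blast
      finally show ?thesis .
    qed
    then have "R \<in> realizations m" using decomposed.realization[OF d refl refl cl] by simp
    moreover have "Q (par_r1 R) (par_r2 R) (par_s1 R) (par_s2 R)"
      using w decomposed.params[OF d refl refl cl] unfolding W_def by simp
    moreover have "dec R w" unfolding dec_def using d cl by blast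
    ultimately show ?thesis by blast
  qed
  have "code ` ?S = W // rotation_rel W"
  proof
    show "code ` ?S \<subseteq> W // rotation_rel W"
    proof
      fix C assume "C \<in> code ` ?S"
      then obtain R where R: "R \<in> ?S" "C = code R" by (rule imageE)
      obtain w where w: "dec R w" using ex[OF R(1)] by blast
      show "C \<in> W // rotation_rel W"
        unfolding R(2) code[OF R(1) w] by (rule quotientI[OF inW[OF R(1) w]])
    qed
    show "W // rotation_rel W \<subseteq> code ` ?S"
    proof
      fix C assume "C \<in> W // rotation_rel W"
      then obtain w where w: "w \<in> W" "C = rotation_rel W `` {w}" by (rule quotientE)
      then obtain R where "R \<in> ?S" "dec R w" using onto by blast
      then show "C \<in> code ` ?S" using code w(2) by blast
    qed
  qed
  moreover have "{(R, R'). R \<in> ?S \<and> R' \<in> ?S \<and> realization_iso R R'} =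
      {(R, R'). R \<in> ?S \<and> R' \<in> ?S \<and> code R = code R'}"
    using iso by blast
  ultimately show ?thesis unfolding num_up_to_iso_def using card_quotient_kernel[of ?S code] by simp
qed

section \<open>Generating functions\<close>

unbundle fps_syntax

text \<open>Ordinary generating function by size with weights \<open>v\<close>. An infinite level
  set would be given the coefficient 0, so finiteness of the levels is assumed where sums are
  split.\<close>

definition gfs :: "('x \<Rightarrow> nat) \<Rightarrow> ('x \<Rightarrow> 'a::comm_ring_1) \<Rightarrow> 'x set \<Rightarrow> 'a fps" where
  "gfs sz v S = Abs_fps (\<lambda>n. \<Sum>x | x \<in> S \<and> sz x = n. v x)"

lemma gfs_nth: "gfs sz v S $ n = (\<Sum>x | x \<in> S \<and> sz x = n. v x)"
  by (simp add: gfs_def)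

lemma level_set_product:
  fixes sz :: "'x \<Rightarrow> nat" and sz' :: "'y \<Rightarrow> nat"
  shows "{p \<in> S \<times> S'. (case p of (x, y) \<Rightarrow> sz x + sz' y) = n} =
    (\<Union>i\<in>{0..n}. {x \<in> S. sz x = i} \<times> {y \<in> S'. sz' y = n - i})"
  by auto

lemma gfs_times:
  assumes "\<And>n. finite {x \<in> S. sz x = n}" "\<And>n. finite {y \<in> S'. sz' y = n}"
  shows "gfs sz v S * gfs sz' v' S' =
    gfs (\<lambda>(x, y). sz x + sz' y) (\<lambda>(x, y). v x * v' y) (S \<times> S')"
proof (rule fps_ext)
  fix n
  have "gfs (\<lambda>(x, y). sz x + sz' y) (\<lambda>(x, y). v x * v' y) (S \<times> S') $ n =
      (\<Sum>i\<in>{0..n}. \<Sum>(x, y)\<in>{x \<in> S. sz x = i} \<times> {y \<in> S'. sz' y = n - i}. v x * v' y)"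
    unfolding gfs_nth level_set_product using assms
    by (intro sum.UNION_disjoint) auto
  also have "\<dots> = (gfs sz v S * gfs sz' v' S') $ n"
    by (simp add: fps_mult_nth gfs_nth sum_product sum.cartesian_product)
  finally show "(gfs sz v S * gfs sz' v' S') $ n =
    gfs (\<lambda>(x, y). sz x + sz' y) (\<lambda>(x, y). v x * v' y) (S \<times> S') $ n" ..
qed

lemma gfs_image:
  assumes "inj_on h S" "\<And>x. x \<in> S \<Longrightarrow> sz' (h x) = k + sz x" "\<And>x. x \<in> S \<Longrightarrow> v' (h x) = c * v x"
  shows "gfs sz' v' (h ` S) = fps_X ^ k * (fps_const c * gfs sz v S)"
proof (rule fps_ext)
  fix n
  have "{y \<in> h ` S. sz' y = n} = h ` {x \<in> S. k + sz x = n}" using assms(2) by auto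
  moreover have "inj_on h {x \<in> S. k + sz x = n}" using assms(1) by (auto simp: inj_on_def)
  ultimately have "gfs sz' v' (h ` S) $ n = (\<Sum>x | x \<in> S \<and> k + sz x = n. c * v x)"
    using assms(3) by (simp add: gfs_nth sum.reindex)
  also have "\<dots> = (if n < k then 0 else c * (\<Sum>x | x \<in> S \<and> sz x = n - k. v x))"
  proof (cases "n < k")
    case False
    then have "{x \<in> S. k + sz x = n} = {x \<in> S. sz x = n - k}" by auto
    with False show ?thesis by (simp add: sum_distrib_left)
  qed (simp add: sum.neutral)
  finally show "gfs sz' v' (h ` S) $ n = (fps_X ^ k * (fps_const c * gfs sz v S)) $ n"
    by (simp add: fps_X_power_mult_nth gfs_nth)
qed

lemma gfs_Un:
  assumes "\<And>n. finite {x \<in> S \<union> S'. sz x = n}" "S \<inter> S' = {}"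
  shows "gfs sz v (S \<union> S') = gfs sz v S + gfs sz v S'"
proof (rule fps_ext)
  fix n
  have "{x \<in> S \<union> S'. sz x = n} = {x \<in> S. sz x = n} \<union> {x \<in> S'. sz x = n}" by auto
  moreover have "finite {x \<in> S. sz x = n}" "finite {x \<in> S'. sz x = n}"
    by (rule finite_subset[OF _ assms(1)[of n]], blast)+
  ultimately show "gfs sz v (S \<union> S') $ n = (gfs sz v S + gfs sz v S') $ n"
    using assms(2) by (simp add: gfs_nth) (subst sum.union_disjoint, auto)
qed

section \<open>Generating functions of rooted quivers and letters\<close>

text \<open>The number of vertices other than the root, by \<open>rooted_code_card\<close>.\<close>

abbreviation rtree_size :: "rtree \<Rightarrow> nat" where
  "rtree_size t \<equiv> narr t + 2 * ntri t"

lemma UNIV_rtree: "(UNIV :: rtree set) =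
    {Leaf} \<union> (range (Arr True) \<union> (range (Arr False) \<union> case_prod Tri ` (UNIV \<times> UNIV)))"
proof -
  have "t \<in> {Leaf} \<union> (range (Arr True) \<union> (range (Arr False) \<union> case_prod Tri ` (UNIV \<times> UNIV)))" for t
  proof (cases t)
    case (Arr d s)
    then show ?thesis by (cases d) auto
  qed auto
  then show ?thesis by blast
qed

lemma finite_rtree_size: "finite {t. rtree_size t = n}"
proof (induction n rule: less_induct)
  case (less n)
  let ?S = "\<Union>m<n. {t. rtree_size t = m}"
  have "finite ?S" using less by auto
  have "t \<in> {Leaf} \<union> Arr True ` ?S \<union> Arr False ` ?S \<union> case_prod Tri ` (?S \<times> ?S)"
    if "rtree_size t = n" for t
  proof (cases t)
    case (Arr d s)
    with that show ?thesis by (cases d) auto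
  qed (use that in auto)
  then have "{t. rtree_size t = n} \<subseteq> {Leaf} \<union> Arr True ` ?S \<union> Arr False ` ?S \<union> case_prod Tri ` (?S \<times> ?S)"
    by blast
  then show ?case by (rule finite_subset) (use \<open>finite ?S\<close> in blast)
qed

definition rtree_gf :: "'a \<Rightarrow> 'a::comm_ring_1 fps" where
  "rtree_gf \<tau> = gfs rtree_size (\<lambda>t. \<tau> ^ ntri t) UNIV"

text \<open>The factor 2 stands for the two directions of an arrow at the root. A triangle at the
  root adds two vertices, one factor \<open>\<tau>\<close> and two independent rooted
  quivers.\<close>

lemma rtree_gf_eq:
  "rtree_gf \<tau> = 1 + 2 * fps_X * rtree_gf \<tau> + fps_const \<tau> * fps_X ^ 2 * rtree_gf \<tau> ^ 2"
proof -
  let ?g = "gfs rtree_size (\<lambda>t. \<tau> ^ ntri t)"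
  have fin: "finite {t \<in> S. rtree_size t = n}" for S n
    by (rule finite_subset[OF _ finite_rtree_size[of n]]) auto
  have un: "?g (A \<union> B) = ?g A + ?g B" if "A \<inter> B = {}" for A B
    by (rule gfs_Un[OF fin that])
  have arr: "?g (range (Arr d)) = fps_X * rtree_gf \<tau>" for d
  proof -
    have "?g (range (Arr d)) = fps_X ^ 1 * (fps_const 1 * gfs rtree_size (\<lambda>t. \<tau> ^ ntri t) UNIV)"
    proof (rule gfs_image)
      show "inj_on (Arr d) UNIV" by (simp add: inj_on_def)
      show "rtree_size (Arr d x) = 1 + rtree_size x" for x by simp
      show "\<tau> ^ ntri (Arr d x) = 1 * \<tau> ^ ntri x" for x by simp
    qed
    then show ?thesis by (simp only: rtree_gf_def power_one_right fps_const_1_eq_1 mult_1_left)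
  qed
  let ?C = "case_prod Tri ` (UNIV \<times> UNIV)"
  have d: "{Leaf} \<inter> (range (Arr True) \<union> (range (Arr False) \<union> ?C)) = {}"
    "range (Arr True) \<inter> (range (Arr False) \<union> ?C) = {}" "range (Arr False) \<inter> ?C = {}" by auto
  have "rtree_gf \<tau> = ?g ({Leaf} \<union> (range (Arr True) \<union> (range (Arr False) \<union> ?C)))"
    by (simp only: rtree_gf_def UNIV_rtree[symmetric])
  also have "\<dots> = ?g {Leaf} + (?g (range (Arr True)) + (?g (range (Arr False)) + ?g ?C))"
    by (simp only: un[OF d(1)] un[OF d(2)] un[OF d(3)])
  also have "?g {Leaf} = 1"
  proof (rule fps_ext)
    fix n
    have "{x. x \<in> {Leaf} \<and> rtree_size x = n} = (if n = 0 then {Leaf} else {})" by auto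
    then show "?g {Leaf} $ n = 1 $ n" by (simp only: gfs_nth) (simp add: fps_one_nth)
  qed
  also note arr[of True]
  also note arr[of False]
  also have "?g (case_prod Tri ` (UNIV \<times> UNIV)) = fps_X ^ 2 * (fps_const \<tau> *
      gfs (\<lambda>(x, y). rtree_size x + rtree_size y) (\<lambda>(x, y). \<tau> ^ ntri x * \<tau> ^ ntri y) (UNIV \<times> UNIV))"
  proof (rule gfs_image)
    fix x :: "rtree \<times> rtree"
    show "rtree_size (case_prod Tri x) = 2 + (case x of (x, y) \<Rightarrow> rtree_size x + rtree_size y)"
      by (cases x) simp
    show "\<tau> ^ ntri (case_prod Tri x) = \<tau> * (case x of (x, y) \<Rightarrow> \<tau> ^ ntri x * \<tau> ^ ntri y)"
      by (cases x) (simp add: power_add)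
  qed (auto simp: inj_on_def)
  also have "gfs (\<lambda>(x, y). rtree_size x + rtree_size y) (\<lambda>(x, y). \<tau> ^ ntri x * \<tau> ^ ntri y) (UNIV \<times> UNIV) =
      rtree_gf \<tau> * rtree_gf \<tau>"
    unfolding rtree_gf_def by (rule gfs_times[symmetric]) (use finite_rtree_size in auto)
  finally show ?thesis by (simp add: algebra_simps power2_eq_square)
qed

text \<open>A letter accounts for one base vertex and all vertices attached to its arrow, by
  \<open>card_D\<close>.\<close>

abbreviation opt_size :: "rtree option \<Rightarrow> nat" where
  "opt_size x \<equiv> opt_narr x + 2 * opt_ntri x"

lemma opt_size_pos: "opt_size x > 0"
  by (cases x) auto

definition opt_gf :: "'a \<Rightarrow> 'a::comm_ring_1 fps" where
  "opt_gf \<tau> = gfs opt_size (\<lambda>x. \<tau> ^ opt_ntri x) UNIV"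

lemma finite_opt_size: "finite {x. opt_size x = n}"
proof -
  have "x \<in> insert None (\<Union>m\<le>n. Some ` {t. rtree_size t = m})" if "opt_size x = n" for x
    using that by (cases x) auto
  then have "{x. opt_size x = n} \<subseteq> insert None (\<Union>m\<le>n. Some ` {t. rtree_size t = m})" by blast
  then show ?thesis by (rule finite_subset) (use finite_rtree_size in blast)
qed

text \<open>A letter is a bare arrow or carries a rooted quiver on a triangle, so
  \<open>F = x + \<tau> x^2 R\<close>. In \<open>F - F^2\<close> the series \<open>R\<close> occurs
  only through \<open>R - 2 x R - \<tau> x^2 R^2\<close>, which is 1 by its own equation.\<close>

lemma opt_gf_quadratic: "opt_gf \<tau> - opt_gf \<tau> ^ 2 = fps_X + fps_const (\<tau> - 1) * fps_X ^ 2"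
proof -
  let ?g = "gfs opt_size (\<lambda>x. \<tau> ^ opt_ntri x)" and ?R = "rtree_gf \<tau>"
  have fin: "finite {x \<in> S. opt_size x = n}" for S n
    by (rule finite_subset[OF _ finite_opt_size[of n]]) auto
  have "opt_gf \<tau> = ?g {None} + ?g (range Some)"
    unfolding opt_gf_def UNIV_option_conv insert_is_Un[of None "range Some"]
    by (rule gfs_Un[OF fin]) auto
  also have "?g {None} = fps_X"
    by (rule fps_ext) (auto simp: gfs_nth fps_X_nth conj_commute intro: sum.neutral cong: conj_cong)
  also have "?g (range Some) = fps_X ^ 2 * (fps_const \<tau> * ?R)"
    unfolding rtree_gf_def by (rule gfs_image) auto
  finally have F: "opt_gf \<tau> = fps_X + fps_const \<tau> * fps_X ^ 2 * ?R" by (simp add: algebra_simps)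
  have "opt_gf \<tau> - opt_gf \<tau> ^ 2 = fps_X - fps_X ^ 2 +
      fps_const \<tau> * fps_X ^ 2 * (?R - 2 * fps_X * ?R - fps_const \<tau> * fps_X ^ 2 * ?R ^ 2)"
    unfolding F by (simp add: algebra_simps power2_eq_square)
  also have "?R - 2 * fps_X * ?R - fps_const \<tau> * fps_X ^ 2 * ?R ^ 2 = 1"
    using rtree_gf_eq[of \<tau>] by (simp add: algebra_simps)
  finally show ?thesis by (simp add: algebra_simps fps_const_sub[symmetric] del: fps_const_sub)
qed

lemma opt_gf_nth_0: "opt_gf \<tau> $ 0 = 0"
proof -
  have "{x \<in> UNIV. opt_size x = 0} = {}" using opt_size_pos by (metis (mono_tags, lifting) empty_Collect_eq less_irrefl)
  then show ?thesis unfolding opt_gf_def gfs_nth by (simp only: sum.empty)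
qed

section \<open>Lists of letters and powers of the series\<close>

abbreviation word_size :: "rtree option list \<Rightarrow> nat" where
  "word_size w \<equiv> word_narr w + 2 * word_ntri w"

lemma word_size_simps [simp]:
  "word_narr [] = 0" "word_narr (x # w) = opt_narr x + word_narr w"
  "word_ntri [] = 0" "word_ntri (x # w) = opt_ntri x + word_ntri w"
  by (simp_all add: word_narr_def word_ntri_def)

lemma length_le_word_size: "length w \<le> word_size w"
proof (induction w)
  case (Cons x w)
  then show ?case using opt_size_pos[of x] unfolding word_size_simps list.size by presburger
qed simp

lemma finite_word_size: "finite {w. length w = a \<and> word_size w = n}"
proof (induction a arbitrary: n)
  case 0
  show ?case by (rule finite_subset[of _ "{[]}"]) auto
next
  case (Suc a)
  let ?A = "\<Union>m\<le>n. {x. opt_size x = m}" and ?B = "\<Union>m\<le>n. {w. length w = a \<and> word_size w = m}"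
  have "w \<in> case_prod (#) ` (?A \<times> ?B)" if "length w = Suc a" "word_size w = n" for w
    using that by (cases w) auto
  then have "{w. length w = Suc a \<and> word_size w = n} \<subseteq> case_prod (#) ` (?A \<times> ?B)" by blast
  then show ?case by (rule finite_subset) (use finite_opt_size Suc in blast)
qed

lemma opt_gf_power:
  "opt_gf \<tau> ^ a = gfs word_size (\<lambda>w. \<tau> ^ word_ntri w) {w. length w = a}"
proof (induction a)
  case 0
  have "{w. w \<in> {w :: rtree option list. length w = 0} \<and> word_size w = n} = (if n = 0 then {[]} else {})" for n
    by auto
  then show ?case by (intro fps_ext) (simp only: gfs_nth, simp add: fps_one_nth)
next
  case (Suc a)
  have "opt_gf \<tau> ^ Suc a = opt_gf \<tau> * gfs word_size (\<lambda>w. \<tau> ^ word_ntri w) {w. length w = a}"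
    using Suc by simp
  also have "\<dots> = gfs (\<lambda>(x, w). opt_size x + word_size w) (\<lambda>(x, w). \<tau> ^ opt_ntri x * \<tau> ^ word_ntri w)
      (UNIV \<times> {w. length w = a})"
    unfolding opt_gf_def by (rule gfs_times) (use finite_opt_size finite_word_size in auto)
  also have "\<dots> = fps_X ^ 0 * (fps_const 1 * \<dots>)" by simp
  also have "\<dots> = gfs word_size (\<lambda>w. \<tau> ^ word_ntri w) (case_prod (#) ` (UNIV \<times> {w. length w = a}))"
  proof (rule gfs_image[symmetric])
    fix x :: "rtree option \<times> rtree option list"
    show "word_size (case_prod (#) x) = 0 + (case x of (x, w) \<Rightarrow> opt_size x + word_size w)"
      by (cases x) simp
    show "\<tau> ^ word_ntri (case_prod (#) x) = 1 * (case x of (x, w) \<Rightarrow> \<tau> ^ opt_ntri x * \<tau> ^ word_ntri w)"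
      by (cases x) (simp add: power_add)
  qed (auto simp: inj_on_def)
  also have "case_prod (#) ` (UNIV \<times> {w. length w = a}) = {w :: rtree option list. length w = Suc a}"
    by (auto simp: length_Suc_conv image_iff)
  finally show ?case .
qed

text \<open>A ballot number: the coefficient of \<open>x^n\<close> in the \<open>a\<close>-th power
  of the Catalan series.\<close>

definition num_words :: "nat \<Rightarrow> nat \<Rightarrow> nat" where
  "num_words a n = card {w. length w = a \<and> word_size w = n}"

lemma opt_gf_1_power_nth: "(opt_gf 1 ^ a) $ n = of_nat (num_words a n)"
  by (simp add: opt_gf_power gfs_nth num_words_def)

lemma fps_linear_power_nth:
  "((fps_X + fps_const c * fps_X ^ 2) ^ i :: 'a::comm_ring_1 fps) $ n =
    (if n < i then 0 else of_nat (i choose (n - i)) * c ^ (n - i))"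
proof -
  let ?L = "1 + fps_const c * fps_X :: 'a fps"
  have nth: "(?L ^ i) $ m = of_nat (i choose m) * c ^ m" for m
  proof -
    have "?L ^ i = (\<Sum>k\<le>i. of_nat (i choose k) * (fps_const c * fps_X) ^ k)"
      using binomial_ring[of "fps_const c * fps_X" 1 i] by (simp add: add.commute)
    also have "\<dots> = (\<Sum>k\<le>i. fps_const (of_nat (i choose k) * c ^ k) * fps_X ^ k)"
      by (intro sum.cong) (simp_all add: power_mult_distrib fps_of_nat[symmetric] mult.assoc[symmetric])
    also have "\<dots> $ m = (\<Sum>k\<le>i. if k = m then of_nat (i choose k) * c ^ k else 0)"
      unfolding fps_sum_nth by (intro sum.cong) auto
    also have "\<dots> = of_nat (i choose m) * c ^ m"
      by (auto simp: sum.delta binomial_eq_0)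
    finally show ?thesis .
  qed
  have "(fps_X + fps_const c * fps_X ^ 2) ^ i = fps_X ^ i * ?L ^ i"
    by (simp add: power_mult_distrib[symmetric] algebra_simps power2_eq_square)
  then show ?thesis by (simp only: fps_X_power_mult_nth nth)
qed

text \<open>
  Both sides solve \<open>y - y\<^sup>2 = x + (\<tau> - 1) x\<^sup>2\<close>, whose solution without constant term is unique.
\<close>

lemma opt_gf_compose:
  fixes \<tau> :: "'a::idom"
  shows "opt_gf \<tau> = opt_gf 1 oo (fps_X + fps_const (\<tau> - 1) * fps_X ^ 2)"
proof -
  let ?P = "fps_X + fps_const (\<tau> - 1) * fps_X ^ 2 :: 'a fps" and ?F = "opt_gf \<tau>"
  let ?G = "opt_gf 1 oo ?P"
  have "?G - ?G ^ 2 = (opt_gf 1 - opt_gf 1 ^ 2) oo ?P"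
    by (simp add: fps_compose_sub_distrib fps_compose_power)
  also have "\<dots> = ?P" by (simp add: opt_gf_quadratic)
  also have "\<dots> = ?F - ?F ^ 2" by (simp add: opt_gf_quadratic)
  finally have "?G - ?G ^ 2 = ?F - ?F ^ 2" .
  then have "(?F - ?G) * (1 - ?F - ?G) = 0" by (simp add: algebra_simps power2_eq_square)
  \<comment> \<open>The second factor has constant term 1 and is not zero, so the first one
    vanishes.\<close>
  moreover have "(1 - ?F - ?G) $ 0 = 1" by (simp add: opt_gf_nth_0)
  then have "1 - ?F - ?G \<noteq> 0" by (metis fps_zero_nth zero_neq_one)
  ultimately show ?thesis by simp
qed

lemma coeff_X_minus_1_power:
  "coeff (([:0, 1:] - 1) ^ n) m = (of_nat (n choose m) * (-1) ^ (n - m) :: 'a::idom)"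
proof -
  have "[:0, 1:] - 1 = [:-1, 1 :: 'a:]" by (simp add: one_pCons)
  moreover have "coeff ([:-1, 1 :: 'a:] ^ n) m = of_nat (n choose m) * (-1) ^ (n - m)"
  proof (cases "m \<le> n")
    case True
    then show ?thesis by (simp add: coeff_linear_poly_power)
  next
    case False
    then show ?thesis using degree_linear_power[of "-1 :: 'a" n] by (simp add: coeff_eq_0 binomial_eq_0)
  qed
  ultimately show ?thesis by simp
qed

lemma coeff_of_nat_mult: "coeff (of_nat a * p) m = of_nat a * coeff p m"
  by (simp add: of_nat_poly)

text \<open>
  The coefficient of \<open>x\<^sup>n\<^sup>-\<^sup>2\<^sup>m t\<^sup>m\<close> in \<open>(x - x\<^sup>2 + t)\<^sup>i\<close>, obtained from
  \<open>(x + (\<tau> - 1) x\<^sup>2)\<^sup>i\<close> with \<open>t = \<tau> x\<^sup>2\<close>.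
\<close>

definition split_coeff :: "nat \<Rightarrow> nat \<Rightarrow> nat \<Rightarrow> real" where
  "split_coeff n m i = real (i choose (n - i)) * real ((n - i) choose m) * (-1) ^ (n - i - m)"

text \<open>With \<open>\<tau>\<close> the variable of a polynomial ring, the coefficient of
  \<open>\<tau>^m\<close> counts the lists with \<open>m\<close> 3-cycles. The powers of the Catalan
  series have natural coefficients, so \<open>\<tau>\<close> occurs only in the powers of
  \<open>x + (\<tau> - 1) x^2\<close>.\<close>

lemma card_words_eq:
  "real (card {w. length w = a \<and> word_size w = n \<and> word_ntri w = m}) =
    (\<Sum>i\<le>n. real (num_words a i) * split_coeff n m i)"
proof -
  let ?\<tau> = "[:0, 1 :: real:]" and ?W = "{w. length w = a \<and> word_size w = n}"
  have "coeff (?\<tau> ^ k) m = (if k = m then 1 else 0)" for k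
    by (simp add: monom_altdef[of 1, simplified, symmetric] coeff_monom)
  then have "coeff ((opt_gf ?\<tau> ^ a) $ n) m = (\<Sum>w\<in>?W. if word_ntri w = m then 1 else 0)"
    by (simp add: opt_gf_power gfs_nth coeff_sum)
  also have "\<dots> = real (card {w \<in> ?W. word_ntri w = m})"
    using finite_word_size[of a n] by (simp add: sum.If_cases Int_def)
  also have "{w \<in> ?W. word_ntri w = m} = {w. length w = a \<and> word_size w = n \<and> word_ntri w = m}"
    by auto
  finally have "real (card \<dots>) = coeff ((opt_gf ?\<tau> ^ a) $ n) m" ..
  also have "opt_gf ?\<tau> ^ a = opt_gf 1 ^ a oo (fps_X + fps_const (?\<tau> - 1) * fps_X ^ 2)"
    by (subst opt_gf_compose) (simp add: fps_compose_power)
  also have "\<dots> $ n = (\<Sum>i\<in>{0..n}. of_nat (num_words a i) * (of_nat (i choose (n - i)) * (?\<tau> - 1) ^ (n - i)))"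
    unfolding fps_compose_nth by (intro sum.cong) (auto simp: opt_gf_1_power_nth fps_linear_power_nth)
  also have "coeff \<dots> m = (\<Sum>i\<in>{0..n}. real (num_words a i) * split_coeff n m i)"
    by (simp add: coeff_sum coeff_of_nat_mult coeff_X_minus_1_power split_coeff_def mult.assoc)
  finally show ?thesis by (simp add: atLeast0AtMost)
qed

section \<open>Ballot numbers\<close>

abbreviation cat :: "real fps" where "cat \<equiv> opt_gf 1"

lemma cat_quadratic: "cat = fps_X + cat ^ 2"
  using opt_gf_quadratic[of "1 :: real"] by (simp add: algebra_simps)

lemma num_words_0: "num_words 0 n = (if n = 0 then 1 else 0)"
proof -
  have "{w :: rtree option list. length w = 0 \<and> word_size w = n} = (if n = 0 then {[]} else {})" by auto
  then show ?thesis by (simp add: num_words_def)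
qed

lemma num_words_less: "n < a \<Longrightarrow> num_words a n = 0"
proof -
  assume "n < a"
  then have "{w :: rtree option list. length w = a \<and> word_size w = n} = {}"
    using length_le_word_size by (metis (mono_tags, lifting) empty_Collect_eq leD)
  then show ?thesis unfolding num_words_def by (simp only: card.empty)
qed

text \<open>Coefficients of \<open>c^(a+1) = x c^a + c^(a+2)\<close>, the quadratic equation times
  \<open>c^a\<close>.\<close>

lemma num_words_Suc:
  "real (num_words (Suc a) (Suc n)) = real (num_words a n) + real (num_words (a + 2) (Suc n))"
proof -
  have "cat ^ Suc a = fps_X * cat ^ a + cat ^ (a + 2)"
    using arg_cong[OF cat_quadratic, of "\<lambda>c. c * cat ^ a"] by (simp add: algebra_simps power2_eq_square)
  from arg_cong[OF this, of "\<lambda>f. f $ Suc n"] show ?thesis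
    by (simp add: opt_gf_1_power_nth del: power_Suc)
qed

lemma num_words_diag: "num_words a a = 1"
proof (induction a)
  case (Suc a)
  then show ?case using num_words_Suc[of a a] num_words_less[of "Suc a" "a + 2"] by simp
qed (simp add: num_words_0)

text \<open>This is \<open>a / (a + 2 d)\<close> times \<open>(a + 2 d) choose d\<close>. The
  recursion leads to \<open>a - 1\<close> with the same \<open>d\<close> and to \<open>a + 1\<close>
  with \<open>d - 1\<close>, hence the induction on \<open>a\<close> inside that on
  \<open>d\<close>.\<close>

lemma num_words_closed:
  "a + d > 0 \<Longrightarrow> real (num_words a (a + d)) = real a * fact (a + 2 * d - 1) / (fact (a + d) * fact d)"
proof (induction d arbitrary: a)
  case 0
  then show ?case by (cases a) (simp_all add: num_words_diag)
next
  case (Suc d)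
  note IH = Suc.IH
  show ?case
  proof (induction a)
    case 0
    then show ?case by (simp add: num_words_0)
  next
    case (Suc a)
    have "real (num_words (a + 2) (a + 2 + d)) =
        real (a + 2) * fact (a + 2 + 2 * d - 1) / (fact (a + 2 + d) * fact d)"
      by (rule IH) simp
    moreover have "real (num_words (Suc a) (Suc a + Suc d)) =
        real (num_words a (a + Suc d)) + real (num_words (a + 2) (a + 2 + d))"
      using num_words_Suc[of a "a + Suc d"] by (simp add: add_ac)
    ultimately have "real (num_words (Suc a) (Suc a + Suc d)) =
        real a * fact (a + 2 * Suc d - 1) / (fact (a + Suc d) * fact (Suc d)) +
        real (a + 2) * fact (a + 2 + 2 * d - 1) / (fact (a + 2 + d) * fact d)"
      using Suc.IH by simp
    also have "\<dots> = real (Suc a) * fact (Suc a + 2 * Suc d - 1) / (fact (Suc a + Suc d) * fact (Suc d))"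
    proof -
      have f: "fact (Suc a + 2 * Suc d - 1) = real (a + 2 * d + 2) * fact (a + 2 * d + 1)"
        "fact (Suc a + Suc d) = real (a + d + 2) * fact (a + d + 1)"
        "fact (Suc d) = real (Suc d) * fact d" by (simp_all add: algebra_simps)
      have e: "a + 2 * Suc d - 1 = a + 2 * d + 1" "a + 2 + 2 * d - 1 = a + 2 * d + 1"
        "a + Suc d = a + d + 1" "a + 2 + d = Suc a + Suc d" by simp_all
      show ?thesis unfolding e f by (simp add: divide_simps) (simp add: algebra_simps)
    qed
    finally show ?case .
  qed
qed


section \<open>Evaluation of the sum over both lengths\<close>

text \<open>The equation \<open>c (1 - c) = x\<close> divided by \<open>x\<close>.\<close>

lemma opt_gf_1_inverse: "(1 - cat) * fps_shift 1 cat = 1"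
proof -
  have X: "cat = fps_X * fps_shift 1 cat"
    by (rule fps_ext) (simp add: opt_gf_nth_0)
  have "fps_X * ((1 - cat) * fps_shift 1 cat) = (1 - cat) * cat"
    by (subst (3) X) (simp only: mult_ac)
  also have "\<dots> = fps_X * 1"
    using opt_gf_quadratic[of "1 :: real"] by (simp add: algebra_simps power2_eq_square)
  finally show ?thesis by (simp only: mult_left_cancel[OF fps_X_neq_zero])
qed

text \<open>As \<open>c / x = 1 / (1 - c)\<close>, this is the negative binomial series at
  \<open>c\<close>. For \<open>a = 0\<close> and \<open>b > 0\<close>, truncated subtraction gives
  \<open>(b - 1) choose b = 0\<close>, as required.\<close>

lemma opt_gf_1_shift_power: "fps_shift 1 cat ^ a =
    Abs_fps (\<lambda>b. real ((a + b - 1) choose b)) oo cat"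
proof (induction a)
  case 0
  have "Abs_fps (\<lambda>b. real ((0 + b - 1) choose b)) = 1"
    by (rule fps_ext) (auto simp: fps_one_nth)
  then show ?case by simp
next
  case (Suc a)
  let ?H = "fps_shift 1 cat" and ?g = "\<lambda>a. Abs_fps (\<lambda>b. real ((a + b - 1) choose b))"
  have "(1 - fps_X) * ?g (Suc a) = ?g a"
  proof (rule fps_ext)
    fix b
    show "((1 - fps_X) * ?g (Suc a)) $ b = ?g a $ b"
    proof (cases b)
      case (Suc m)
      have "((1 - fps_X) * ?g (Suc a)) $ b = real ((a + Suc m) choose Suc m) - real ((a + m) choose m)"
        by (simp only: left_diff_distrib mult_1_left fps_sub_nth fps_X_mult_nth) (simp add: Suc)
      then show ?thesis using Suc by simp
    qed (simp add: left_diff_distrib)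
  qed
  then have "((1 - fps_X) * ?g (Suc a)) oo cat = ?H ^ a" using Suc by simp
  then have "(1 - cat) * (?g (Suc a) oo cat) = ?H ^ a"
    by (simp only: fps_compose_mult_distrib[OF opt_gf_nth_0] fps_compose_sub_distrib fps_compose_1
        fps_X_fps_compose_startby0[OF opt_gf_nth_0])
  then have "(1 - cat) * ?H * (?g (Suc a) oo cat) = ?H * ?H ^ a" by (simp only: mult_ac)
  then show ?case by (simp only: opt_gf_1_inverse mult_1_left power_Suc)
qed

text \<open>Both sides are the coefficient of \<open>x^j\<close> in \<open>(c / x)^a\<close>. This
  disposes of the sum over one of the two lengths.\<close>

lemma sum_binomial_num_words:
  "(\<Sum>b\<le>j. real ((a + b - 1) choose b) * real (num_words b j)) = real (num_words a (a + j))"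
proof -
  have X: "cat = fps_X * fps_shift 1 cat"
    by (rule fps_ext) (simp add: opt_gf_nth_0)
  have "cat ^ a = fps_X ^ a * fps_shift 1 cat ^ a"
    by (subst X) (simp only: power_mult_distrib)
  then have "(cat ^ a) $ (a + j) = (fps_shift 1 cat ^ a) $ j"
    by (simp add: fps_X_power_mult_nth)
  then show ?thesis
    by (simp only: opt_gf_1_shift_power fps_compose_nth opt_gf_1_power_nth atLeast0AtMost) simp
qed

text \<open>The right-hand side \<open>S k\<close> telescopes: \<open>S k - S (k + 1)\<close> is the \<open>k\<close>-th summand on the left.\<close>

lemma sum_num_words_telescope:
  assumes "1 \<le> k" "k \<le> i" "1 \<le> j"
  shows "(\<Sum>a=k..i. real (num_words a i) * real (num_words a (a + j)) / real a) *
      (fact i * fact j * real (i + j)) =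
    fact (2 * i - k) / fact (i - k) * (fact (2 * j + k - 1) / fact (j + k - 1))"
  using assms(2,1)
proof (induction rule: inc_induct)
  have t: "real (num_words a i) * real (num_words a (a + j)) / real a =
      real a * fact (2 * i - a - 1) * fact (2 * j + a - 1) / (fact i * fact (i - a) * fact (a + j) * fact j)"
    if "1 \<le> a" "a \<le> i" for a
  proof -
    obtain d where d: "i = a + d" using \<open>a \<le> i\<close> le_Suc_ex by blast
    have e: "a + 2 * d - 1 = 2 * i - a - 1" "a + 2 * j - 1 = 2 * j + a - 1" "d = i - a" using d by auto
    have n: "real (num_words a i) = real a * fact (2 * i - a - 1) / (fact i * fact (i - a))"
      "real (num_words a (a + j)) = real a * fact (2 * j + a - 1) / (fact (a + j) * fact j)"
      using num_words_closed[of a d] num_words_closed[of a j] that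
      unfolding d[symmetric] e(1,2) unfolding e(3) by simp_all
    show ?thesis unfolding n using that by (simp add: field_simps)
  qed
  { case base
    obtain m where m: "i = Suc m" using base by (cases i) auto
    have f: "(fact i :: real) = real i * fact m" "(fact (i + j) :: real) = real (i + j) * fact (m + j)"
      using m by simp_all
    have e: "2 * i - i - 1 = m" "j + i - 1 = m + j" "2 * i - i = i" using m by auto
    show ?case using base by (simp add: t e) (simp add: f divide_simps, simp add: algebra_simps m)
  next
    case (step k)
    obtain d where d: "i = Suc (k + d)" using \<open>k < i\<close> less_iff_Suc_add by auto
    obtain m where m: "k = Suc m" using step.prems by (cases k) auto
    have "(\<Sum>a=k..i. real (num_words a i) * real (num_words a (a + j)) / real a) *
        (fact i * fact j * real (i + j)) =
      real k * fact (2 * i - k - 1) * fact (2 * j + k - 1) / (fact i * fact (i - k) * fact (k + j) * fact j) *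
        (fact i * fact j * real (i + j)) +
      fact (2 * i - Suc k) / fact (i - Suc k) * (fact (2 * j + Suc k - 1) / fact (j + Suc k - 1))"
      using step by (subst sum.atLeast_Suc_atMost) (simp_all add: t distrib_right)
    also have "\<dots> = fact (2 * i - k) / fact (i - k) * (fact (2 * j + k - 1) / fact (j + k - 1))"
    proof -
      \<comment> \<open>Arguments of factorials with all truncated subtractions resolved.\<close>
      define A B where "A = k + 2 * d + 1" and "B = 2 * j + m"
      have e: "2 * i - k = Suc A" "2 * i - k - 1 = A" "2 * i - Suc k = A" "i - k = Suc d" "i - Suc k = d"
        "2 * j + k - 1 = B" "2 * j + Suc k - 1 = Suc B" "k + j = Suc (m + j)" "j + Suc k - 1 = Suc (m + j)"
        "j + k - 1 = m + j" using d m by (auto simp: A_def B_def)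
      have r: "real i = real k + real d + 1" "real k = real m + 1" "real A = real k + 2 * real d + 1"
        "real B = 2 * real j + real m" using d m by (auto simp: A_def B_def)
      have "(real k * fact A * fact B / (fact i * fact (Suc d) * fact (Suc (m + j)) * fact j)) *
          (fact i * fact j * real (i + j)) = real k * real (i + j) * (fact A * fact B / (fact (Suc d) * fact (Suc (m + j))))"
      proof -
        have "x * y * z / (p * q * r * s) * (p * s * t) = x * t * (y * z / (q * r))"
          if "p \<noteq> 0" "s \<noteq> 0" for x y z p q r s t :: real using that by simp
        from this[OF fact_nonzero fact_nonzero] show ?thesis .
      qed
      moreover have "fact A / fact d * (fact (Suc B) / fact (Suc (m + j))) =
          real (Suc d) * real (Suc B) * (fact A * fact B / (fact (Suc d) * fact (Suc (m + j))))"
        by (simp add: divide_simps) 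
      moreover have "fact (Suc A) / fact (Suc d) * (fact B / fact (m + j)) =
          real (Suc A) * real (Suc (m + j)) * (fact A * fact B / (fact (Suc d) * fact (Suc (m + j))))"
        by (simp add: divide_simps)
      \<comment> \<open>What is left of the telescoping once the common factorials are taken out;
        both sides equal \<open>(k + 2 d + 2) (k + j)\<close>.\<close>
      moreover have "real k * real (i + j) + real (Suc d) * real (Suc B) = real (Suc A) * real (Suc (m + j))"
        unfolding of_nat_Suc of_nat_add r by (simp add: algebra_simps)
      ultimately show ?thesis unfolding e by (simp only: distrib_right[symmetric] diff_Suc_1)
    qed
    finally show ?case . }
qed

text \<open>The kernel is rewritten as \<open>(a + b - 1) choose b\<close> over \<open>a\<close>.
  This gives up the symmetry in \<open>a\<close> and \<open>b\<close>, but
  \<open>sum_binomial_num_words\<close> then removes \<open>b\<close>, and the sum over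
  \<open>a\<close> telescopes.\<close>

lemma sum_num_words_eq:
  assumes "1 \<le> i" "1 \<le> j"
  shows "(\<Sum>a\<le>i. \<Sum>b\<le>j. real ((a + b) choose a) / real (a + b) *
      (real (num_words a i) * real (num_words b j))) =
    real ((2 * i) choose i) * real ((2 * j) choose j) / (2 * real (i + j))"
proof -
  \<comment> \<open>The term \<open>a = 0\<close> vanishes because \<open>i > 0\<close>; dropping it
    permits the division by \<open>a\<close>.\<close>
  have "(\<Sum>a\<le>i. \<Sum>b\<le>j. real ((a + b) choose a) / real (a + b) * (real (num_words a i) * real (num_words b j))) =
      (\<Sum>a=1..i. \<Sum>b\<le>j. real ((a + b) choose a) / real (a + b) * (real (num_words a i) * real (num_words b j)))"
    by (rule sum.mono_neutral_right) (use assms in \<open>auto simp: num_words_0 not_le\<close>)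
  also have "\<dots> = (\<Sum>a=1..i. real (num_words a i) * real (num_words a (a + j)) / real a)"
  proof (rule sum.cong[OF refl])
    fix a assume a: "a \<in> {1..i}"
    have "real ((a + b) choose a) / real (a + b) = real ((a + b - 1) choose b) / real a" for b
    proof -
      obtain m where m: "a = Suc m" using a by (cases a) auto
      have "Suc m * ((Suc m + b) choose Suc m) = (Suc m + b) * ((m + b) choose m)"
        using Suc_times_binomial_eq[of "m + b" m] by (simp add: mult.commute)
      also have "(m + b) choose m = (m + b) choose b" using binomial_symmetric[of m "m + b"] by simp
      finally have "real a * real ((a + b) choose a) = real (a + b) * real ((a + b - 1) choose b)"
        unfolding m by (metis add_Suc diff_Suc_1 of_nat_mult)
      then show ?thesis using a by (simp add: field_simps)
    qed
    then have "(\<Sum>b\<le>j. real ((a + b) choose a) / real (a + b) * (real (num_words a i) * real (num_words b j))) =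
        real (num_words a i) / real a * (\<Sum>b\<le>j. real ((a + b - 1) choose b) * real (num_words b j))"
      by (simp add: sum_distrib_left mult_ac)
    then show "(\<Sum>b\<le>j. real ((a + b) choose a) / real (a + b) * (real (num_words a i) * real (num_words b j))) =
        real (num_words a i) * real (num_words a (a + j)) / real a"
      unfolding sum_binomial_num_words by simp
  qed
  also have "\<dots> = real ((2 * i) choose i) * real ((2 * j) choose j) / (2 * real (i + j))"
  proof -
    obtain m where m: "i = Suc m" using assms by (cases i) auto
    let ?t = "\<Sum>a=1..i. real (num_words a i) * real (num_words a (a + j)) / real a"
    let ?K = "fact i * fact j * real (i + j)"
    have tK: "?t * ?K = fact (2 * i - 1) / fact m * (fact (2 * j) / fact j)"
      using sum_num_words_telescope[of 1 i j] assms m by simp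
    have b: "real ((2 * i) choose i) = 2 * fact (2 * i - 1) / (fact m * fact i)"
    proof -
      have "(fact (2 * i) :: real) = real (2 * i) * fact (2 * i - 1)" "(fact i :: real) = real i * fact m"
        using m by (simp_all add: fact_reduce)
      then have "fact (2 * i) / (fact i * fact i) =
          real i * (2 * fact (2 * i - 1)) / (real i * (fact m * fact i) :: real)"
        by (simp only: of_nat_mult of_nat_numeral mult_ac)
      also have "\<dots> = 2 * fact (2 * i - 1) / (fact m * fact i)"
        using assms by (intro mult_divide_mult_cancel_left) simp
      also have "fact (2 * i) / (fact i * fact i) = real ((2 * i) choose i)"
        using binomial_fact[of i "2 * i", where ?'a = real] by (simp add: mult_2)
      finally show ?thesis .
    qed
    have b': "real ((2 * j) choose j) = fact (2 * j) / (fact j * fact j)"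
      using binomial_fact[of j "2 * j", where ?'a = real] by (simp add: mult_2)
    have "?K \<noteq> 0" using assms by simp
    then have "?t = ?t * ?K / ?K" by (rule nonzero_mult_div_cancel_right[symmetric])
    also have "\<dots> = real ((2 * i) choose i) * real ((2 * j) choose j) / (2 * real (i + j))"
    proof -
      have "x / y * (u / t) / (q * t * k) = 2 * x / (y * q) * (u / (t * t)) / (2 * k)" for x y u t q k :: real
        by (simp add: field_split_simps)
      then show ?thesis unfolding tK b b' .
    qed
    finally show ?thesis .
  qed
  finally show ?thesis .
qed

section \<open>Sums over words\<close>

text \<open>A word is an interleaving of its letters of the two directions. The direction tags make
  the two lists disjoint, so the interleavings are counted by a binomial coefficient.\<close>

lemma dir_letters_fiber_eq_shuffles:
  "{v. dir_letters False v = us \<and> dir_letters True v = ws} = shuffles (map (Pair False) us) (map (Pair True) ws)"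
proof (intro equalityI subsetI)
  fix v :: word assume v: "v \<in> {v. dir_letters False v = us \<and> dir_letters True v = ws}"
  have "filter (\<lambda>l. fst l = d) v = map (Pair d) (dir_letters d v)" for d
    unfolding dir_letters_def by (induction v) auto
  moreover have "v \<in> shuffles (filter (\<lambda>l. fst l = False) v) (filter (\<lambda>l. \<not> fst l = False) v)"
    by (rule partition_in_shuffles)
  moreover have "filter (\<lambda>l. \<not> fst l = False) v = filter (\<lambda>l. fst l = True) v" by (rule filter_cong) auto
  ultimately have "v \<in> shuffles (map (Pair False) (dir_letters False v)) (map (Pair True) (dir_letters True v))" by (simp only:)
  then show "v \<in> shuffles (map (Pair False) us) (map (Pair True) ws)" using v by simp
next
  fix v :: word assume v: "v \<in> shuffles (map (Pair False) us) (map (Pair True) ws)"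
  let ?xs = "map (Pair False) us" and ?ys = "map (Pair True) ws"
  have disj: "set ?xs \<inter> set ?ys = {}" by auto
  have set: "set v = set ?xs \<union> set ?ys" by (rule set_shuffles[OF v])
  have "filter (\<lambda>l. fst l = False) v = filter (\<lambda>x. x \<in> set ?xs) v"
    using set by (intro filter_cong) auto
  also have "\<dots> = ?xs" by (rule filter_shuffles_disjoint1(1)[OF disj v])
  finally have "dir_letters False v = us" unfolding dir_letters_def by (simp add: comp_def)
  moreover have "filter (\<lambda>l. fst l = True) v = filter (\<lambda>x. x \<notin> set ?xs) v"
    using set by (intro filter_cong) auto
  then have "filter (\<lambda>l. fst l = True) v = ?ys"
    using filter_shuffles_disjoint1(2)[OF disj v] by simp
  then have "dir_letters True v = ws" unfolding dir_letters_def by (simp add: comp_def)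
  ultimately show "v \<in> {v. dir_letters False v = us \<and> dir_letters True v = ws}" by simp
qed

lemma words_eq_shuffles: "{v. dir_letters False v \<in> U \<and> dir_letters True v \<in> W} =
    (\<Union>(us, ws)\<in>U \<times> W. shuffles (map (Pair False) us) (map (Pair True) ws))"
  unfolding dir_letters_fiber_eq_shuffles[symmetric] by blast

lemma finite_words: "finite U \<Longrightarrow> finite W \<Longrightarrow> finite {v. dir_letters False v \<in> U \<and> dir_letters True v \<in> W}"
  unfolding words_eq_shuffles by auto

lemma sum_words_by_shuffles:
  assumes "finite U" "finite W"
  shows "(\<Sum>v | dir_letters False v \<in> U \<and> dir_letters True v \<in> W. 1 / real (length v)) =
    (\<Sum>us\<in>U. \<Sum>ws\<in>W. real ((length us + length ws) choose length us) / real (length us + length ws))"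
proof -
  let ?S = "\<lambda>us ws. shuffles (map (Pair False) us) (map (Pair True) ws)"
  have "(\<Sum>v | dir_letters False v \<in> U \<and> dir_letters True v \<in> W. 1 / real (length v)) =
      (\<Sum>p\<in>U \<times> W. \<Sum>v\<in>(case p of (us, ws) \<Rightarrow> ?S us ws). 1 / real (length v))"
    unfolding words_eq_shuffles
  proof (rule sum.UNION_disjoint)
    show "\<forall>p\<in>U \<times> W. \<forall>p'\<in>U \<times> W. p \<noteq> p' \<longrightarrow>
        (case p of (us, ws) \<Rightarrow> ?S us ws) \<inter> (case p' of (us, ws) \<Rightarrow> ?S us ws) = {}"
      by (auto simp: dir_letters_fiber_eq_shuffles[symmetric])
  qed (use assms in auto)
  also have "\<dots> = (\<Sum>(us, ws)\<in>U \<times> W. real ((length us + length ws) choose length us) / real (length us + length ws))"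
  proof (rule sum.cong[OF refl], clarify)
    fix us ws :: "rtree option list"
    have "(\<Sum>v\<in>?S us ws. 1 / real (length v)) = (\<Sum>v\<in>?S us ws. 1 / real (length us + length ws))"
      by (rule sum.cong[OF refl]) (simp add: length_shuffles)
    also have "\<dots> = real (card (?S us ws)) / real (length us + length ws)" by simp
    also have "card (?S us ws) = (length us + length ws) choose length us"
      by (subst card_disjoint_shuffles) auto
    finally show "(\<Sum>v\<in>?S us ws. 1 / real (length v)) =
        real ((length us + length ws) choose length us) / real (length us + length ws)" .
  qed
  finally show ?thesis by (simp add: sum.cartesian_product)
qed

lemma sum_by_length:
  fixes f :: "nat \<Rightarrow> real"
  assumes "finite U" "\<And>u. u \<in> U \<Longrightarrow> length u \<le> r"
  shows "(\<Sum>u\<in>U. f (length u)) = (\<Sum>a\<le>r. real (card {u \<in> U. length u = a}) * f a)"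
proof -
  have "(\<Sum>u\<in>U. f (length u)) = (\<Sum>a\<in>{..r}. \<Sum>u | u \<in> U \<and> length u = a. f (length u))"
    using assms by (intro sum.group[symmetric]) auto
  then show ?thesis by simp
qed

text \<open>The number of shuffles of lists of lengths \<open>a\<close> and \<open>b\<close>,
  divided by the length of the result.\<close>

definition word_kernel :: "nat \<Rightarrow> nat \<Rightarrow> real" where
  "word_kernel a b = real ((a + b) choose a) / real (a + b)"

lemma sum_words_by_length:
  assumes "finite U" "finite W" "\<And>u. u \<in> U \<Longrightarrow> length u \<le> r" "\<And>w. w \<in> W \<Longrightarrow> length w \<le> s"
  shows "(\<Sum>v | dir_letters False v \<in> U \<and> dir_letters True v \<in> W. 1 / real (length v)) =
    (\<Sum>a\<le>r. \<Sum>b\<le>s. real (card {u \<in> U. length u = a}) * real (card {w \<in> W. length w = b}) * word_kernel a b)"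
proof -
  have "(\<Sum>v | dir_letters False v \<in> U \<and> dir_letters True v \<in> W. 1 / real (length v)) =
      (\<Sum>us\<in>U. \<Sum>ws\<in>W. word_kernel (length us) (length ws))"
    unfolding word_kernel_def by (rule sum_words_by_shuffles[OF assms(1,2)])
  also have "\<dots> = (\<Sum>us\<in>U. \<Sum>b\<le>s. real (card {w \<in> W. length w = b}) * word_kernel (length us) b)"
    by (intro sum.cong refl sum_by_length assms)
  also have "\<dots> = (\<Sum>a\<le>r. real (card {u \<in> U. length u = a}) *
      (\<Sum>b\<le>s. real (card {w \<in> W. length w = b}) * word_kernel a b))"
    by (rule sum_by_length[OF assms(1,3)])
  finally show ?thesis by (simp add: sum_distrib_left mult.assoc)
qed

lemma finite_word_size': "finite {w. word_size w = n}"
proof -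
  have "{w. word_size w = n} \<subseteq> (\<Union>a\<le>n. {w. length w = a \<and> word_size w = n})"
    using length_le_word_size by fastforce
  then show ?thesis by (rule finite_subset) (use finite_word_size in blast)
qed

text \<open>Terms with \<open>a > i\<close> or \<open>b > j\<close> vanish; the common ranges
  \<open>r\<close> and \<open>s\<close> allow \<open>i\<close> and \<open>j\<close> to vary under
  the sum later.\<close>

lemma sum_num_words_kernel:
  assumes "1 \<le> i" "i \<le> r" "1 \<le> j" "j \<le> s"
  shows "(\<Sum>a\<le>r. \<Sum>b\<le>s. real (num_words a i) * real (num_words b j) * word_kernel a b) =
    real ((2 * i) choose i) * real ((2 * j) choose j) / (2 * real (i + j))"
proof -
  have "(\<Sum>b\<le>s. real (num_words a i) * real (num_words b j) * word_kernel a b) =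
      (\<Sum>b\<le>j. real (num_words a i) * real (num_words b j) * word_kernel a b)" for a
    by (rule sum.mono_neutral_right) (use assms in \<open>auto simp: num_words_less\<close>)
  then have "(\<Sum>a\<le>r. \<Sum>b\<le>s. real (num_words a i) * real (num_words b j) * word_kernel a b) =
      (\<Sum>a\<le>r. \<Sum>b\<le>j. real (num_words a i) * real (num_words b j) * word_kernel a b)" by simp
  also have "\<dots> = (\<Sum>a\<le>i. \<Sum>b\<le>j. real (num_words a i) * real (num_words b j) * word_kernel a b)"
    by (rule sum.mono_neutral_right) (use assms in \<open>auto simp: num_words_less\<close>)
  also have "\<dots> = (\<Sum>a\<le>i. \<Sum>b\<le>j. real ((a + b) choose a) / real (a + b) *
      (real (num_words a i) * real (num_words b j)))"
    by (simp add: word_kernel_def mult.commute)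
  finally show ?thesis using sum_num_words_eq assms by simp
qed

lemma sum_words_size:
  assumes "1 \<le> r" "1 \<le> s"
  shows "(\<Sum>v | word_size (dir_letters False v) = r \<and> word_size (dir_letters True v) = s. 1 / real (length v)) =
    real ((2 * r) choose r) * real ((2 * s) choose s) / (2 * real (r + s))"
proof -
  have "(\<Sum>v | dir_letters False v \<in> {w. word_size w = r} \<and> dir_letters True v \<in> {w. word_size w = s}. 1 / real (length v)) =
      (\<Sum>a\<le>r. \<Sum>b\<le>s. real (card {u \<in> {w. word_size w = r}. length u = a}) *
        real (card {w \<in> {w. word_size w = s}. length w = b}) * word_kernel a b)"
    using length_le_word_size by (intro sum_words_by_length finite_word_size') auto
  also have "\<dots> = (\<Sum>a\<le>r. \<Sum>b\<le>s. real (num_words a r) * real (num_words b s) * word_kernel a b)"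
    by (simp add: num_words_def conj_commute)
  finally show ?thesis using sum_num_words_kernel[OF assms(1) _ assms(2)] by simp
qed

section \<open>Prescribed numbers of 3-cycles\<close>

lemma split_coeff_0: "1 \<le> n \<Longrightarrow> split_coeff n m 0 = 0"
  by (simp add: split_coeff_def binomial_eq_0)

text \<open>By \<open>card_words_eq\<close> the numbers of lists are combinations of ballot numbers
  with coefficients independent of the lengths \<open>a\<close> and \<open>b\<close>. The sums over
  the lengths therefore move inside and are already known.\<close>

lemma sum_words_size_ntri:
  assumes "1 \<le> r" "1 \<le> s"
  shows "(\<Sum>v | word_size (dir_letters False v) = r \<and> word_ntri (dir_letters False v) = m \<and>
      word_size (dir_letters True v) = s \<and> word_ntri (dir_letters True v) = q. 1 / real (length v)) =
    (\<Sum>i\<le>r. \<Sum>j\<le>s. split_coeff r m i * split_coeff s q j *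
      (real ((2 * i) choose i) * real ((2 * j) choose j) / (2 * real (i + j))))"
proof -
  let ?U = "{w. word_size w = r \<and> word_ntri w = m}" and ?W = "{w. word_size w = s \<and> word_ntri w = q}"
  have fin: "finite {w. word_size w = n \<and> word_ntri w = k}" for n k
    by (rule finite_subset[OF _ finite_word_size'[of n]]) auto
  have c: "real (card {w \<in> {w. word_size w = n \<and> word_ntri w = k}. length w = a}) =
      (\<Sum>i\<le>n. real (num_words a i) * split_coeff n k i)" for n k a
  proof -
    have "{w \<in> {w. word_size w = n \<and> word_ntri w = k}. length w = a} =
      {w. length w = a \<and> word_size w = n \<and> word_ntri w = k}" by auto
    then show ?thesis by (simp only: card_words_eq)
  qed
  have "(\<Sum>v | dir_letters False v \<in> ?U \<and> dir_letters True v \<in> ?W. 1 / real (length v)) =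
      (\<Sum>a\<le>r. \<Sum>b\<le>s. (\<Sum>i\<le>r. real (num_words a i) * split_coeff r m i) *
        (\<Sum>j\<le>s. real (num_words b j) * split_coeff s q j) * word_kernel a b)"
    unfolding c[symmetric] using length_le_word_size by (intro sum_words_by_length fin) auto
  also have "\<dots> = (\<Sum>a\<le>r. \<Sum>b\<le>s. \<Sum>i\<le>r. \<Sum>j\<le>s. split_coeff r m i * split_coeff s q j *
      (real (num_words a i) * real (num_words b j) * word_kernel a b))"
    by (simp only: sum_product, simp only: sum_distrib_right, simp only: mult_ac)
  also have "\<dots> = (\<Sum>a\<le>r. \<Sum>i\<le>r. \<Sum>b\<le>s. \<Sum>j\<le>s. split_coeff r m i * split_coeff s q j *
      (real (num_words a i) * real (num_words b j) * word_kernel a b))"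
    by (intro sum.cong refl sum.swap)
  also have "\<dots> = (\<Sum>a\<le>r. \<Sum>i\<le>r. \<Sum>j\<le>s. \<Sum>b\<le>s. split_coeff r m i * split_coeff s q j *
      (real (num_words a i) * real (num_words b j) * word_kernel a b))"
    by (intro sum.cong refl sum.swap)
  also have "\<dots> = (\<Sum>i\<le>r. \<Sum>a\<le>r. \<Sum>j\<le>s. \<Sum>b\<le>s. split_coeff r m i * split_coeff s q j *
      (real (num_words a i) * real (num_words b j) * word_kernel a b))"
    by (rule sum.swap)
  also have "\<dots> = (\<Sum>i\<le>r. \<Sum>j\<le>s. \<Sum>a\<le>r. \<Sum>b\<le>s. split_coeff r m i * split_coeff s q j *
      (real (num_words a i) * real (num_words b j) * word_kernel a b))"
    by (intro sum.cong refl sum.swap)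
  also have "\<dots> = (\<Sum>i\<le>r. \<Sum>j\<le>s. split_coeff r m i * split_coeff s q j *
      (real ((2 * i) choose i) * real ((2 * j) choose j) / (2 * real (i + j))))"
  proof (intro sum.cong refl)
    fix i j assume ij: "i \<in> {..r}" "j \<in> {..s}"
    show "(\<Sum>a\<le>r. \<Sum>b\<le>s. split_coeff r m i * split_coeff s q j *
        (real (num_words a i) * real (num_words b j) * word_kernel a b)) =
      split_coeff r m i * split_coeff s q j *
        (real ((2 * i) choose i) * real ((2 * j) choose j) / (2 * real (i + j)))"
    proof (cases "i = 0 \<or> j = 0")
      \<comment> \<open>The closed form of the inner sum is available for positive \<open>i\<close>
        and \<open>j\<close> only; the remaining terms have coefficient 0.\<close>
      case True
      then have "split_coeff r m i * split_coeff s q j = 0" using split_coeff_0 assms by auto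
      then show ?thesis by auto
    next
      case False
      then have "1 \<le> i" "i \<le> r" "1 \<le> j" "j \<le> s" using ij by auto
      from sum_num_words_kernel[OF this] show ?thesis by (simp only: sum_distrib_left[symmetric])
    qed
  qed
  finally show ?thesis by (simp add: conj_assoc)
qed

text \<open>In the expansion of \<open>(x - x^2 + t)^i\<close>, the relevant monomial takes
  \<open>x\<close> from \<open>2 i - r\<close> factors, \<open>- x^2\<close> from
  \<open>r - m - i\<close> and \<open>t\<close> from \<open>m\<close>. Multiplied by
  \<open>(2 i) choose i\<close>, this trinomial coefficient becomes the one with four lower entries,
  and the sign comes from \<open>- x^2\<close>.\<close>

lemma multinomial_eq_split_coeff:
  assumes "m \<le> r" "i \<le> r"
  shows "multinomial (2 * i) [int i, 2 * int i - int r, int m, int (r - m) - int i] =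
    (-1) ^ (i + r + m) * split_coeff r m i * real ((2 * i) choose i)"
proof (cases "r \<le> 2 * i \<and> i + m \<le> r")
  case True
  then have n: "nat (2 * int i - int r) = 2 * i - r" "nat (int (r - m) - int i) = r - m - i" by auto
  have "multinomial (2 * i) [int i, 2 * int i - int r, int m, int (r - m) - int i] =
      fact (2 * i) / (fact i * (fact (2 * i - r) * (fact m * fact (r - m - i))))"
  proof -
    have c: "\<forall>a\<in>set [int i, 2 * int i - int r, int m, int (r - m) - int i]. 0 \<le> a" using True by auto
    have p: "(\<Prod>a\<leftarrow>[int i, 2 * int i - int r, int m, int (r - m) - int i]. fact (nat a)) =
        fact i * (fact (2 * i - r) * (fact m * fact (r - m - i)) :: real)"
      by (simp only: list.map prod_list.Cons prod_list.Nil n nat_int mult_1_right)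
    show ?thesis unfolding multinomial_def if_P[OF c] p ..
  qed
  moreover have "real ((2 * i) choose i) = fact (2 * i) / (fact i * fact i)"
    using binomial_fact[of i "2 * i", where ?'a = real] by (simp add: mult_2)
  moreover have "real (i choose (r - i)) = fact i / (fact (r - i) * fact (2 * i - r))"
  proof -
    have "i - (r - i) = 2 * i - r" "r - i \<le> i" using assms(2) True by auto
    then show ?thesis using binomial_fact[of "r - i" i, where ?'a = real] by simp
  qed
  moreover have "real ((r - i) choose m) = fact (r - i) / (fact m * fact (r - m - i))"
  proof -
    have "r - i - m = r - m - i" "m \<le> r - i" using True by auto
    then show ?thesis using binomial_fact[of m "r - i", where ?'a = real] by simp
  qed
  moreover have "(-1 :: real) ^ (i + r + m) * (-1) ^ (r - i - m) = 1"
  proof -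
    have "i + r + m + (r - i - m) = 2 * r" using True by auto
    then show ?thesis by (simp flip: power_add)
  qed
  ultimately show ?thesis
    unfolding split_coeff_def
    by (simp add: mult_ac)
next
  \<comment> \<open>Outside the range some lower entry is negative, and one of the two binomials in
    \<open>split_coeff\<close> vanishes as well.\<close>
  case False
  have "split_coeff r m i = 0"
  proof (cases "r \<le> 2 * i")
    case True
    then have "r - i < m" using False assms by auto
    then show ?thesis by (simp add: split_coeff_def binomial_eq_0)
  next
    case no: False
    then have "i < r - i" by auto
    then show ?thesis by (simp add: split_coeff_def binomial_eq_0)
  qed
  moreover have "2 * int i - int r < 0 \<or> int (r - m) - int i < 0" using False assms by auto
  then have "multinomial (2 * i) [int i, 2 * int i - int r, int m, int (r - m) - int i] = 0"
    unfolding multinomial_def by auto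
  ultimately show ?thesis by simp
qed

text \<open>The infinite sum is finite because \<open>i > r\<close> or \<open>j > s\<close> makes a
  last lower entry negative, and the sign in front cancels those of the summands.\<close>

lemma infsum_multinomials:
  assumes "m \<le> r" "q \<le> s"
  shows "(-1) ^ (r + m + s + q) * (\<Sum>\<^sub>\<infinity>(i, j)\<in>{(i :: nat, j :: nat). (i, j) \<noteq> (0, 0)}.
      (-1) ^ (i + j) / (2 * real (i + j)) *
      multinomial (2 * i) [int i, 2 * int i - int r, int m, int (r - m) - int i] *
      multinomial (2 * j) [int j, 2 * int j - int s, int q, int (s - q) - int j]) =
    (\<Sum>i\<le>r. \<Sum>j\<le>s. split_coeff r m i * split_coeff s q j *
      (real ((2 * i) choose i) * real ((2 * j) choose j) / (2 * real (i + j))))"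
proof -
  let ?M = "\<lambda>r m i. multinomial (2 * i) [int i, 2 * int i - int r, int m, int (r - m) - int i]"
  let ?f = "\<lambda>(i, j). (-1) ^ (i + j) / (2 * real (i + j)) * ?M r m i * ?M s q j"
  have zero: "?M r m i = 0" if "r < i" for r m i
  proof -
    have "int (r - m) - int i < 0" using that by auto
    then show ?thesis unfolding multinomial_def by auto
  qed
  \<comment> \<open>The pair \<open>(0, 0)\<close> lies in the rectangle but not in the index set;
    its summand is 0 by the convention for division by 0.\<close>
  have "infsum ?f {(i, j). (i, j) \<noteq> (0, 0)} = infsum ?f ({..r} \<times> {..s})"
  proof (rule infsum_cong_neutral)
    fix x assume x: "x \<in> {(i, j). (i, j) \<noteq> (0, 0)} - {..r} \<times> {..s}"
    obtain i j where ij: "x = (i, j)" by (cases x)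
    then have "r < i \<or> s < j" using x by auto
    then show "?f x = 0" unfolding ij using zero by auto
  qed auto
  also have "\<dots> = (\<Sum>i\<le>r. \<Sum>j\<le>s. ?f (i, j))"
    by (simp add: sum.cartesian_product)
  finally have inf: "infsum ?f {(i, j). (i, j) \<noteq> (0, 0)} = (\<Sum>i\<le>r. \<Sum>j\<le>s. ?f (i, j))" .
  have summand: "(-1) ^ (r + m + s + q) * ?f (i, j) = split_coeff r m i * split_coeff s q j *
      (real ((2 * i) choose i) * real ((2 * j) choose j) / (2 * real (i + j)))" if "i \<le> r" "j \<le> s" for i j
  proof -
    have "(-1) ^ (r + m + s + q) * ?f (i, j) =
        ((-1) ^ (r + m + s + q) * (-1) ^ (i + j) * (-1) ^ (i + r + m) * (-1) ^ (j + s + q)) *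
        (split_coeff r m i * split_coeff s q j *
          (real ((2 * i) choose i) * real ((2 * j) choose j) / (2 * real (i + j))))"
    proof -
      have "x * (y / k * (c * u * b) * (d * v * b')) = (x * y * c * d) * (u * v * (b * b' / k))"
        for x y k c u b d v b' :: real by simp
      then show ?thesis
        by (simp only: prod.case multinomial_eq_split_coeff[OF assms(1) that(1)]
            multinomial_eq_split_coeff[OF assms(2) that(2)])
    qed
    also have "(-1 :: real) ^ (r + m + s + q) * (-1) ^ (i + j) * (-1) ^ (i + r + m) * (-1) ^ (j + s + q) = 1"
    proof -
      have "r + m + s + q + (i + j) + (i + r + m) + (j + s + q) = 2 * (r + m + s + q + i + j)" by simp
      then show ?thesis by (simp only: power_add[symmetric]) (simp add: power_mult)
    qed
    finally show ?thesis by simp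
  qed
  show ?thesis
    unfolding inf sum_distrib_left by (intro sum.cong refl) (rule summand; simp)
qed

lemma word_sums_list_pow:
  "dir_letters d (concat (replicate k v)) = concat (replicate k (dir_letters d v))"
  "word_narr (concat (replicate k u)) = k * word_narr u"
  "word_ntri (concat (replicate k u)) = k * word_ntri u"
proof -
  show "dir_letters d (concat (replicate k v)) = concat (replicate k (dir_letters d v))"
    by (induction k) (auto simp: dir_letters_def)
  show "word_narr (concat (replicate k u)) = k * word_narr u"
    by (induction k) (auto simp: word_narr_def)
  show "word_ntri (concat (replicate k u)) = k * word_ntri u"
    by (induction k) (auto simp: word_ntri_def)
qed

lemma finite_word_size_le: "finite {w. word_size w \<le> n}"
proof -
  have "{w. word_size w \<le> n} = (\<Union>m\<le>n. {w. word_size w = m})" by auto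
  then show ?thesis using finite_word_size' by simp
qed

text \<open>The \<open>k\<close>-th power of a word has \<open>k\<close> times its parameters, so
  the condition on the power becomes one on the word itself.\<close>

lemma num_up_to_iso_eq_sum:
  fixes Q :: "nat \<Rightarrow> nat \<Rightarrow> nat \<Rightarrow> nat \<Rightarrow> bool"
  assumes Q: "\<And>a b c d. Q a b c d \<Longrightarrow> a + 2 * b \<ge> 1 \<and> c + 2 * d \<ge> 1 \<and> a + 2 * b + (c + 2 * d) = m"
    and K: "finite K" "0 \<notin> K" "\<And>k a b c d. Q (k * a) (k * b) (k * c) (k * d) \<Longrightarrow> k \<in> K"
  shows "real (num_up_to_iso {R \<in> (realizations m :: (nat, nat) realization set).
      Q (par_r1 R) (par_r2 R) (par_s1 R) (par_s2 R)}) =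
    (\<Sum>k\<in>K. real (totient k) / real k * (\<Sum>v | Q (k * word_narr (dir_letters False v))
      (k * word_ntri (dir_letters False v)) (k * word_narr (dir_letters True v))
      (k * word_ntri (dir_letters True v)). 1 / real (length v)))"
proof -
  define W where "W = {w. Q (word_narr (dir_letters False w)) (word_ntri (dir_letters False w))
    (word_narr (dir_letters True w)) (word_ntri (dir_letters True w))}"
  have pow: "list_pow k v \<in> W \<longleftrightarrow> Q (k * word_narr (dir_letters False v))
      (k * word_ntri (dir_letters False v)) (k * word_narr (dir_letters True v))
      (k * word_ntri (dir_letters True v))" for k v
    by (simp add: W_def word_sums_list_pow)
  let ?U = "{w. word_size w \<le> m}"
  have "W \<subseteq> {v. dir_letters False v \<in> ?U \<and> dir_letters True v \<in> ?U}"
    unfolding W_def using Q by fastforce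
  then have "finite W" by (rule finite_subset) (intro finite_words finite_word_size_le)
  moreover have "[] \<notin> W"
    using Q[of 0 0 0 0] by (auto simp: W_def dir_letters_def)
  moreover have "rotate k w \<in> W" if "w \<in> W" for w k
    using that unfolding W_def by (simp add: rotate_in_params)
  ultimately have "real (card (W // rotation_rel W)) =
      (\<Sum>k\<in>K. real (totient k) / real k * (\<Sum>v | list_pow k v \<in> W. 1 / real (length v)))"
    by (rule card_necklaces) (use K pow in auto)
  then show ?thesis
    unfolding pow using num_up_to_iso_eq_necklaces[of Q m, OF Q] unfolding W_def by simp
qed

section \<open>The two counting formulas\<close>

theorem theorem3p5:
  fixes r s :: nat
  assumes "r \<ge> 1" and "s \<ge> 1"
  shows
    "real (num_up_to_iso {R \<in> (realizations (r + s) :: (nat, nat) realization set).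
         par_r1 R + 2 * par_r2 R = r \<and> par_s1 R + 2 * par_s2 R = s}) =
       1 / 2 * (\<Sum>k | k dvd r \<and> k dvd s.
         real (totient k) / real (r + s) *
         real ((2 * r div k) choose (r div k)) * real ((2 * s div k) choose (s div k)))
     \<and>
     (\<forall>r1 r2 s1 s2 :: nat. r = r1 + 2 * r2 \<longrightarrow> s = s1 + 2 * s2 \<longrightarrow>
       real (num_up_to_iso {R \<in> (realizations (r + s) :: (nat, nat) realization set).
         par_r1 R = r1 \<and> par_r2 R = r2 \<and> par_s1 R = s1 \<and> par_s2 R = s2}) =
       (\<Sum>k | k dvd r \<and> k dvd r2 \<and> k dvd s \<and> k dvd s2.
         real (totient k) / real k * (- 1) ^ ((r + r2 + s + s2) div k) *
         (\<Sum>\<^sub>\<infinity>(i, j)\<in>{(i :: nat, j :: nat). (i, j) \<noteq> (0, 0)}.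
           (- 1) ^ (i + j) / (2 * real (i + j)) *
           multinomial (2 * i)
             [int i, 2 * int i - int (r div k), int (r2 div k), int ((r - r2) div k) - int i] *
           multinomial (2 * j)
             [int j, 2 * int j - int (s div k), int (s2 div k), int ((s - s2) div k) - int j])))"
proof (intro conjI allI impI)
  let ?N = "real (num_up_to_iso {R \<in> (realizations (r + s) :: (nat, nat) realization set).
    par_r1 R + 2 * par_r2 R = r \<and> par_s1 R + 2 * par_s2 R = s})"
  let ?u = "\<lambda>k. real (totient k) / real (r + s) *
    real ((2 * r div k) choose (r div k)) * real ((2 * s div k) choose (s div k))"
  let ?w1 = "\<lambda>k. \<Sum>v |
    k * word_narr (dir_letters False v) + 2 * (k * word_ntri (dir_letters False v)) = r \<and>
    k * word_narr (dir_letters True v) + 2 * (k * word_ntri (dir_letters True v)) = s.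
    1 / real (length v)"
  let ?K = "{k. k dvd r \<and> k dvd s}"
  have fin: "finite {k. k dvd r \<and> P k}" for P
    by (rule finite_subset[of _ "{..r}"]) (use assms(1) in \<open>auto dest: dvd_imp_le\<close>)
  have "?N =
    (\<Sum>k\<in>?K. real (totient k) / real k * ?w1 k)"
  proof (rule num_up_to_iso_eq_sum[of "\<lambda>a b c d. a + 2 * b = r \<and> c + 2 * d = s" "r + s" ?K])
    show "finite ?K" by (rule fin)
    show "k \<in> ?K" if "k * a + 2 * (k * b) = r \<and> k * c + 2 * (k * d) = s" for k a b c d
      using that by auto
  qed (use assms in auto)
  also have "\<dots> = (\<Sum>k\<in>?K. 1 / 2 * (?u k))"
  proof (rule sum.cong[OF refl])
    fix k assume "k \<in> ?K"
    then obtain r' s' where k: "r = k * r'" "s = k * s'" by (auto elim!: dvdE)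
    then have pos: "k > 0" "1 \<le> r'" "1 \<le> s'" using assms by (auto intro: Suc_leI gr0I)
    have eq: "k * x + 2 * (k * y) = k * q \<longleftrightarrow> x + 2 * y = q" for x y q
    proof -
      have "k * x + 2 * (k * y) = k * (x + 2 * y)" by (simp add: algebra_simps)
      then show ?thesis using pos(1) by simp
    qed
    have div: "r div k = r'" "s div k = s'" "2 * r div k = 2 * r'" "2 * s div k = 2 * s'"
      using k pos(1) by (simp_all add: mult.left_commute)
    \<comment> \<open>The factor \<open>1 / k\<close> of the necklace count and
      \<open>1 / (2 (r' + s'))\<close> combine to \<open>1 / (2 (r + s))\<close>.\<close>
    have "real (r + s) = real k * real (r' + s')" using k by (simp add: algebra_simps)
    then show "real (totient k) / real k * ?w1 k =
      1 / 2 * (?u k)"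
      unfolding div unfolding k eq sum_words_size[OF pos(2,3)] by (simp add: mult_ac)
  qed
  finally show "?N =
       1 / 2 * (\<Sum>k | k dvd r \<and> k dvd s.
         ?u k)"
    by (simp only: sum_distrib_left)
  fix r1 r2 s1 s2 :: nat
  assume r: "r = r1 + 2 * r2" and s: "s = s1 + 2 * s2"
  let ?M = "real (num_up_to_iso {R \<in> (realizations (r + s) :: (nat, nat) realization set).
    par_r1 R = r1 \<and> par_r2 R = r2 \<and> par_s1 R = s1 \<and> par_s2 R = s2})"
  let ?t = "\<lambda>k. real (totient k) / real k * (- 1) ^ ((r + r2 + s + s2) div k) *
    (\<Sum>\<^sub>\<infinity>(i, j)\<in>{(i :: nat, j :: nat). (i, j) \<noteq> (0, 0)}.
      (- 1) ^ (i + j) / (2 * real (i + j)) *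
      multinomial (2 * i)
        [int i, 2 * int i - int (r div k), int (r2 div k), int ((r - r2) div k) - int i] *
      multinomial (2 * j)
        [int j, 2 * int j - int (s div k), int (s2 div k), int ((s - s2) div k) - int j])"
  let ?w2 = "\<lambda>k. \<Sum>v |
    k * word_narr (dir_letters False v) = r1 \<and> k * word_ntri (dir_letters False v) = r2 \<and>
    k * word_narr (dir_letters True v) = s1 \<and> k * word_ntri (dir_letters True v) = s2.
    1 / real (length v)"
  let ?L = "{k. k dvd r \<and> k dvd r2 \<and> k dvd s \<and> k dvd s2}"
  have "?M =
    (\<Sum>k\<in>?L. real (totient k) / real k * ?w2 k)"
  proof (rule num_up_to_iso_eq_sum[of "\<lambda>a b c d. a = r1 \<and> b = r2 \<and> c = s1 \<and> d = s2" "r + s" ?L])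
    show "finite ?L" by (rule fin)
    show "k \<in> ?L" if "k * a = r1 \<and> k * b = r2 \<and> k * c = s1 \<and> k * d = s2" for k a b c d
      using that r s by auto
  qed (use assms r s in auto)
  also have "\<dots> = (\<Sum>k\<in>?L. ?t k)"
  proof (rule sum.cong[OF refl])
    fix k assume "k \<in> ?L"
    then obtain r' s' m q where k: "r = k * r'" "s = k * s'" "r2 = k * m" "s2 = k * q" by (auto elim!: dvdE)
    then have pos: "k > 0" "1 \<le> r'" "1 \<le> s'" using assms by (auto intro: Suc_leI gr0I)
    have "k * m \<le> k * r'" "k * q \<le> k * s'" using r s k by linarith+
    then have le: "m \<le> r'" "q \<le> s'" using pos(1) by simp_all
    \<comment> \<open>The conditions on \<open>k\<close> do not name \<open>r1\<close>; its
      divisibility by \<open>k\<close> follows from that of \<open>r\<close> and \<open>r2\<close>,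
      and likewise for \<open>s1\<close>.\<close>
    have eq: "k * x = u \<and> k * y = k * l \<longleftrightarrow> x + 2 * y = c \<and> y = l" if "k * c = u + 2 * (k * l)" for x y u l c
    proof -
      have "k * x = u \<longleftrightarrow> x + 2 * l = c"
      proof -
        have "x + 2 * l = c \<longleftrightarrow> k * (x + 2 * l) = k * c" using pos(1) by simp
        also have "\<dots> \<longleftrightarrow> k * x = u" unfolding that by (simp add: algebra_simps)
        finally show ?thesis ..
      qed
      then show ?thesis using pos(1) by auto
    qed
    have rs: "k * r' = r1 + 2 * (k * m)" "k * s' = s1 + 2 * (k * q)" using r s k by simp_all
    have set: "{v. k * word_narr (dir_letters False v) = r1 \<and> k * word_ntri (dir_letters False v) = r2 \<and>
        k * word_narr (dir_letters True v) = s1 \<and> k * word_ntri (dir_letters True v) = s2} =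
      {v. word_size (dir_letters False v) = r' \<and> word_ntri (dir_letters False v) = m \<and>
        word_size (dir_letters True v) = s' \<and> word_ntri (dir_letters True v) = q}"
      unfolding k(3,4) using eq[OF rs(1)] eq[OF rs(2)] by blast
    have div: "r div k = r'" "s div k = s'" "r2 div k = m" "s2 div k = q"
      "(r - r2) div k = r' - m" "(s - s2) div k = s' - q" "(r + r2 + s + s2) div k = r' + m + s' + q"
      using k pos(1) by (simp_all flip: right_diff_distrib' distrib_left)
    show "real (totient k) / real k * ?w2 k =
      ?t k"
      unfolding set div sum_words_size_ntri[OF pos(2,3)] infsum_multinomials[OF le, symmetric]
      by (simp only: mult.assoc)
  qed
  finally show "?M =
       (\<Sum>k | k dvd r \<and> k dvd r2 \<and> k dvd s \<and> k dvd s2.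
         ?t k)" .
qed

end
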